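(* Let $\mathbb{E}$ be a (finite-dimensional) Euclidean space, $f\in\Gamma_0(\mathbb{E})$ and $\bar x\in\mathbb{E}$. Let $\eta(\lambda)=f(P_\lambda f(\bar x))$ for $\lambda>0$ and $\eta(\lambda)=f(P_{\mathrm{cl}(\mathrm{dom} f)}(\bar x))$ for $\lambda\le0$. Then $\eta$ is semismooth at $\bar\lambda>0$ if $\partial f$ is proto-differentiable and semismooth* at $\left(P_{\bar\lambda}f(\bar x),\ \frac1{\bar\lambda}[\bar x-P_{\bar\lambda}f(\bar x)]\right)$. This is the case under either of the following conditions: (a) $f$ is piecewise linear-quadratic; (b) $f$ is twice continuously differentiable around $P_{\bar\lambda}f(\bar x)$; in this case, $\eta$ is continuously differentiable (around $\bar\lambda$).
   Context: $\Gamma_0(\mathbb{E})$ denotes the closed proper convex functions $\mathbb{E}\to\mathbb{R}\cup\{+\infty\}$. For $\lambda>0$, $P_\lambda f(x)=\mathrm{argmin}_u\{f(u)+\frac1{2\lambda}\|x-u\|^2\}$; $P_C$ is Euclidean projection onto $C$. A function $F$ is semismooth (in the sense of Qi and Sun) at a point $x$ in the interior of its domain if $F$ is locally Lipschitz at $x$ and for every direction $h$ the limit $\lim Vh'$ over $V\in\partial_CF(x+th')$, $h'\to h$, $t\downarrow0$ exists, where $\partial_C$ is the Clarke generalized Jacobian. Tangent cone: $T_A(\bar a)$ is the set of $z$ for which there are $t_k\downarrow0$, $z_k\to z$ with $\bar a+t_kz_k\in A$. Regular normal cone: $\hat N_A(\bar a)=\{v\mid\langle v,z\rangle\le0\ \forall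 z\in T_A(\bar a)\}$ (empty if $\bar a\notin A$). Directional normal cone: $N_A(\bar a;u)=\{v\mid\exists t_k\downarrow0,u_k\to u,v_k\to v,\ v_k\in\hat N_A(\bar a+t_ku_k)\}$. A set-valued map $S$ is semismooth* at $(\bar x,\bar y)\in\mathrm{gph}\,S$ if, with $A=\mathrm{gph}\,S$ and $\bar a=(\bar x,\bar y)$, $\langle a^*,u\rangle=0$ for all $u$ and all $a^*\in N_A(\bar a;u)$. $S$ is proto-differentiable at $(\bar x,\bar y)$ if for every $(\bar w,\bar z)\in T_{\mathrm{gph}S}(\bar x,\bar y)$ and every $t_k\downarrow0$ there exist $w_k\to\bar w$, $z_k\to\bar z$ with $z_k\in(S(\bar x+t_kw_k)-\bar y)/t_k$ for all $k$. A function is piecewise linear-quadratic if its domain is a union of finitely many polyhedral sets, relative to each of which it is a polynomial of degree at most two. *)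

theory Defs
  imports "HOL-Analysis.Analysis"
begin

definition edom :: "('a \<Rightarrow> ereal) \<Rightarrow> 'a set" where
  "edom f = {x. f x < \<infinity>}"

definition finite_dom :: "('a \<Rightarrow> ereal) \<Rightarrow> 'a set" where
  "finite_dom f = {x. \<bar>f x\<bar> \<noteq> \<infinity>}"

definition epi :: "('a \<Rightarrow> ereal) \<Rightarrow> ('a \<times> real) set" where
  "epi f = {(x, r). f x \<le> ereal r}"

definition proper_fun :: "('a \<Rightarrow> ereal) \<Rightarrow> bool" where
  "proper_fun f \<longleftrightarrow> edom f \<noteq> {} \<and> (\<forall>x. f x \<noteq> -\<infinity>)"

definition Gamma0 :: "('a::euclidean_space \<Rightarrow> ereal) set" where
  "Gamma0 = {f. proper_fun f \<and> closed (epi f) \<and> convex (epi f)}"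

definition subdiff :: "('a::euclidean_space \<Rightarrow> ereal) \<Rightarrow> 'a \<Rightarrow> 'a set" where
  "subdiff f x = {v. x \<in> edom f \<and> (\<forall>y. f x + ereal (v \<bullet> (y - x)) \<le> f y)}"

text \<open>For \<open>f \<in> Gamma0\<close> and \<open>0 < l\<close> the minimizer exists and is unique, so the choice made by
  \<^const>\<open>arg_min\<close> is immaterial there.\<close>

definition prox :: "real \<Rightarrow> ('a::euclidean_space \<Rightarrow> ereal) \<Rightarrow> 'a \<Rightarrow> 'a" where
  "prox l f x = arg_min (\<lambda>u. f u + ereal (1 / (2 * l) * (norm (x - u))\<^sup>2)) (\<lambda>_. True)"

definition eta :: "('a::euclidean_space \<Rightarrow> ereal) \<Rightarrow> 'a \<Rightarrow> real \<Rightarrow> ereal" where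
  "eta f x l = (if 0 < l then f (prox l f x) else f (closest_point (closure (edom f)) x))"

definition piecewise_linear_quadratic :: "('a::euclidean_space \<Rightarrow> ereal) \<Rightarrow> bool" where
  "piecewise_linear_quadratic f \<longleftrightarrow>
     (\<exists>\<P>. finite \<P> \<and> (\<forall>P\<in>\<P>. polyhedron P) \<and> edom f = \<Union>\<P> \<and>
        (\<forall>P\<in>\<P>. \<exists>A b c. linear A \<and> (\<forall>x\<in>P. f x = ereal (x \<bullet> A x + b \<bullet> x + c))))"

text \<open>\<open>t\<^sub>k \<down> 0\<close> means convergence to zero through positive values; monotonicity is not required.\<close>

definition pos_null :: "(nat \<Rightarrow> real) \<Rightarrow> bool" where
  "pos_null t \<longleftrightarrow> (\<forall>k. 0 < t k) \<and> t \<longlonglongrightarrow> 0"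

definition clarke_jacobian ::
    "('a::euclidean_space \<Rightarrow> 'b::euclidean_space) \<Rightarrow> 'a \<Rightarrow> ('a \<Rightarrow>\<^sub>L 'b) set" where
  "clarke_jacobian F x = convex hull
     {V. \<exists>xs Vs. xs \<longlonglongrightarrow> x \<and> (\<forall>k. (F has_derivative blinfun_apply (Vs k)) (at (xs k))) \<and>
          Vs \<longlonglongrightarrow> V}"

text \<open>\<open>D\<close> is the domain of \<open>F\<close>. All notions below are local, and \<open>x\<close> is interior to \<open>D\<close>, so
  the values of the total function \<open>F\<close> outside \<open>D\<close> play no role.\<close>

definition semismooth_at ::
    "'a set \<Rightarrow> ('a::euclidean_space \<Rightarrow> 'b::euclidean_space) \<Rightarrow> 'a \<Rightarrow> bool" where
  "semismooth_at D F x \<longleftrightarrow>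
     x \<in> interior D \<and>
     (\<exists>e>0. \<exists>L. L-lipschitz_on (ball x e) F) \<and>
     (\<forall>h. \<exists>l. \<forall>t hs V.
        pos_null t \<and> hs \<longlonglongrightarrow> h \<and> (\<forall>k. V k \<in> clarke_jacobian F (x + t k *\<^sub>R hs k)) \<longrightarrow>
        (\<lambda>k. blinfun_apply (V k) (hs k)) \<longlonglongrightarrow> l)"

definition C2_around ::
    "'a set \<Rightarrow> ('a::euclidean_space \<Rightarrow> 'b::euclidean_space) \<Rightarrow> 'a \<Rightarrow> bool" where
  "C2_around D F x \<longleftrightarrow>
     (\<exists>U. open U \<and> x \<in> U \<and> U \<subseteq> D \<and>
        (\<exists>(F' :: 'a \<Rightarrow> 'a \<Rightarrow>\<^sub>L 'b) (F'' :: 'a \<Rightarrow> 'a \<Rightarrow>\<^sub>L 'a \<Rightarrow>\<^sub>L 'b).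
           (\<forall>y\<in>U. (F has_derivative blinfun_apply (F' y)) (at y)) \<and>
           (\<forall>y\<in>U. (F' has_derivative blinfun_apply (F'' y)) (at y)) \<and>
           continuous_on U F''))"

definition C1_around :: "real set \<Rightarrow> (real \<Rightarrow> 'b::euclidean_space) \<Rightarrow> real \<Rightarrow> bool" where
  "C1_around D F x \<longleftrightarrow>
     (\<exists>U. open U \<and> x \<in> U \<and> U \<subseteq> D \<and> F C1_differentiable_on U)"

definition tangent_cone :: "'a::euclidean_space set \<Rightarrow> 'a \<Rightarrow> 'a set" where
  "tangent_cone A a =
     {z. \<exists>t zs. pos_null t \<and> zs \<longlonglongrightarrow> z \<and> (\<forall>k. a + t k *\<^sub>R zs k \<in> A)}"

definition regular_normal_cone :: "'a::euclidean_space set \<Rightarrow> 'a \<Rightarrow> 'a set" where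
  "regular_normal_cone A a = (if a \<in> A then {v. \<forall>z\<in>tangent_cone A a. v \<bullet> z \<le> 0} else {})"

definition directional_normal_cone :: "'a::euclidean_space set \<Rightarrow> 'a \<Rightarrow> 'a \<Rightarrow> 'a set" where
  "directional_normal_cone A a u =
     {v. \<exists>t us vs. pos_null t \<and> us \<longlonglongrightarrow> u \<and> vs \<longlonglongrightarrow> v \<and>
        (\<forall>k. vs k \<in> regular_normal_cone A (a + t k *\<^sub>R us k))}"

definition gph :: "('a \<Rightarrow> 'b set) \<Rightarrow> ('a \<times> 'b) set" where
  "gph S = {(x, y). y \<in> S x}"

definition semismooth_star_at ::
    "('a::euclidean_space \<Rightarrow> 'b::euclidean_space set) \<Rightarrow> 'a \<times> 'b \<Rightarrow> bool" where
  "semismooth_star_at S a \<longleftrightarrow>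
     a \<in> gph S \<and> (\<forall>u. \<forall>v\<in>directional_normal_cone (gph S) a u. v \<bullet> u = 0)"

definition proto_differentiable_at ::
    "('a::euclidean_space \<Rightarrow> 'b::euclidean_space set) \<Rightarrow> 'a \<times> 'b \<Rightarrow> bool" where
  "proto_differentiable_at S a \<longleftrightarrow>
     a \<in> gph S \<and>
     (\<forall>(w, z)\<in>tangent_cone (gph S) a. \<forall>t. pos_null t \<longrightarrow>
        (\<exists>ws zs. ws \<longlonglongrightarrow> w \<and> zs \<longlonglongrightarrow> z \<and>
           (\<forall>k. zs k \<in> (\<lambda>y. (y - snd a) /\<^sub>R t k) ` S (fst a + t k *\<^sub>R ws k))))"

end

theory Submission
  imports Defs
begin

text \<open>
  Write \<open>p l = prox l f x\<close>, \<open>v l = (x - p l) / l\<close> and \<open>h l = f (p l)\<close>. By the optimality condition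
  the curve \<open>(p l, v l)\<close> runs in the graph of the subdifferential, subject to \<open>p l + l v l = x\<close>.
  Monotonicity makes it Lipschitz near \<open>lbar > 0\<close>, and the subgradient inequality at both ends of
  an interval gives \<open>h m - h l = v l \<bullet> (p m - p l) + O(|m - l|\<^sup>2)\<close>. On the real line,
  semismoothness amounts to the existence of a limit of the derivatives of \<open>h\<close> on either side of
  \<open>lbar\<close> (\<open>semismooth_at_if_one_sided_limits\<close>).

  These limits come from the two hypotheses on the graph. Proto-differentiability and monotonicity
  provide one-sided derivatives \<open>(q, w)\<close> of the curve at \<open>lbar\<close>
  (\<open>prox_curve_one_sided_derivative\<close>). The derivative of \<open>h\<close> at a nearby \<open>l\<close> is nearly a
  difference quotient of the Lipschitz function \<open>z \<mapsto> v lbar \<bullet> prox lbar f z\<close>, and such quotients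
  are bounded from both sides by proximal subgradients \<open>s\<close> at nearby points
  (\<open>proximal_mean_value\<close>); this takes the place of Rademacher's theorem, which could not be used
  directly because the curve may stay among the points where the proximal map fails to be
  differentiable. Each \<open>s\<close> yields a regular normal \<open>(s - v lbar, lbar s)\<close> to the graph
  (\<open>regular_normal_if_proximal_subgradient\<close>). In the limit these normals are orthogonal to \<open>(q,
  w)\<close> by semismoothness*, and orthogonality determines the limit of the derivatives
  (\<open>one_sided_limit_of_derivatives\<close>).

  For a piecewise linear-quadratic \<open>f\<close> the graph of the subdifferential is near each of its points
  a cone with apex at that point (\<open>locally_conic_gph_subdiff\<close>), from which both hypotheses are
  immediate. If \<open>f\<close> is twice continuously differentiable near \<open>p lbar\<close>, the graph is there a
  continuously differentiable manifold, the graph of the gradient; both hypotheses hold again, and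
  implicit differentiation of \<open>p l + l g (p l) = x\<close>, with \<open>g\<close> the gradient of \<open>f\<close>, shows that \<open>h\<close>
  is continuously differentiable (\<open>eta_C1_around\<close>).
\<close>

section \<open>Convex functions, subgradients and proximal points\<close>

text \<open>The real value of an extended-real function; for \<open>f \<in> Gamma0\<close> it represents \<open>f\<close> faithfully
  on \<open>edom f\<close>, and it is the default \<open>0\<close> where \<open>f\<close> is infinite.\<close>

abbreviation (input) rval :: "('a \<Rightarrow> ereal) \<Rightarrow> 'a \<Rightarrow> real" where
  "rval f x \<equiv> real_of_ereal (f x)"

lemma Gamma0_eq_rval:
  assumes "f \<in> Gamma0" "x \<in> edom f"
  shows "f x = ereal (rval f x)"
  using assms by (cases "f x") (auto simp: Gamma0_def proper_fun_def edom_def)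

lemma Gamma0_le_ereal_iff:
  assumes "f \<in> Gamma0"
  shows "f x \<le> ereal r \<longleftrightarrow> x \<in> edom f \<and> rval f x \<le> r"
  using assms by (cases "f x") (auto simp: Gamma0_def proper_fun_def edom_def)

lemma Gamma0_convex:
  assumes "f \<in> Gamma0" "x \<in> edom f" "y \<in> edom f" "0 \<le> t" "t \<le> 1"
  shows "x + t *\<^sub>R (y - x) \<in> edom f"
    and "rval f (x + t *\<^sub>R (y - x)) \<le> (1 - t) * rval f x + t * rval f y"
proof -
  have c: "convex (epi f)"
    using assms(1) by (simp add: Gamma0_def)
  have "(x, rval f x) \<in> epi f" "(y, rval f y) \<in> epi f"
    using assms by (auto simp: epi_def Gamma0_le_ereal_iff)
  then have "(1 - t) *\<^sub>R (x, rval f x) + t *\<^sub>R (y, rval f y) \<in> epi f"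
    using convexD_alt[OF c _ _ assms(4,5)] by blast
  then have "(x + t *\<^sub>R (y - x), (1 - t) * rval f x + t * rval f y) \<in> epi f"
    by (simp add: algebra_simps)
  then show "x + t *\<^sub>R (y - x) \<in> edom f"
    "rval f (x + t *\<^sub>R (y - x)) \<le> (1 - t) * rval f x + t * rval f y"
    using assms(1) by (auto simp: epi_def Gamma0_le_ereal_iff)
qed

text \<open>A hyperplane that strictly separates a point just below the graph from the epigraph cannot
  be vertical, because that point lies below a point of the epigraph.\<close>

lemma Gamma0_affine_minorant:
  fixes f :: "'a::euclidean_space \<Rightarrow> ereal"
  assumes f: "f \<in> Gamma0"
  obtains w b where "\<And>x. x \<in> edom f \<Longrightarrow> w \<bullet> x + b \<le> rval f x"
proof -
  obtain x0 where x0: "x0 \<in> edom f"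
    using f by (auto simp: Gamma0_def proper_fun_def)
  have "(x0, rval f x0 - 1) \<notin> epi f"
    using f x0 by (auto simp: epi_def Gamma0_le_ereal_iff)
  then obtain ab c where ab: "ab \<bullet> (x0, rval f x0 - 1) < c" "\<forall>z\<in>epi f. ab \<bullet> z > c"
    using separating_hyperplane_closed_point[of "epi f" "(x0, rval f x0 - 1)"] f
    by (auto simp: Gamma0_def)
  obtain \<alpha> \<beta> where [simp]: "ab = (\<alpha>, \<beta>)" by (cases ab)
  have low: "\<alpha> \<bullet> x0 + \<beta> * (rval f x0 - 1) < c"
    using ab(1) by (simp add: inner_Pair)
  have up: "\<alpha> \<bullet> x + \<beta> * r > c" if "x \<in> edom f" "rval f x \<le> r" for x r
    using ab(2) that f by (force simp: epi_def Gamma0_le_ereal_iff inner_Pair)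
  have "\<beta> > 0"
    using low up[OF x0, of "rval f x0"] by (simp add: algebra_simps)
  show ?thesis
  proof
    fix x assume "x \<in> edom f"
    from up[OF this order_refl] \<open>\<beta> > 0\<close>
    show "(- (1 / \<beta>) *\<^sub>R \<alpha>) \<bullet> x + c / \<beta> \<le> rval f x"
      by (simp add: field_simps)
  qed
qed

text \<open>The minimum is sought over the epigraph, where the objective is continuous. An affine
  minorant is dominated by the quadratic term, so that the sublevel sets are compact.\<close>

lemma prox_objective_attains:
  fixes f :: "'a::euclidean_space \<Rightarrow> ereal"
  assumes f: "f \<in> Gamma0" and c: "0 < c"
  obtains p where "p \<in> edom f"
    "\<And>u. u \<in> edom f \<Longrightarrow> rval f p + c * (norm (x - p))\<^sup>2 \<le> rval f u + c * (norm (x - u))\<^sup>2"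
proof -
  obtain x0 where x0: "x0 \<in> edom f"
    using f by (auto simp: Gamma0_def proper_fun_def)
  obtain w b where minor: "\<And>x. x \<in> edom f \<Longrightarrow> w \<bullet> x + b \<le> rval f x"
    using Gamma0_affine_minorant[OF f] by blast
  define \<alpha> where "\<alpha> = rval f x0 + c * (norm (x - x0))\<^sup>2"
  define J where "J = (\<lambda>z::'a \<times> real. snd z + c * (norm (x - fst z))\<^sup>2)"
  define S where "S = epi f \<inter> {z. J z \<le> \<alpha>}"
  have contJ: "continuous_on UNIV J"
    unfolding J_def by (intro continuous_intros)
  have "closed {z. J z \<le> \<alpha>}"
    by (rule closed_Collect_le[OF contJ]) simp
  then have "closed S"
    using f by (auto simp: S_def Gamma0_def)
  define M where "M = \<bar>\<alpha> - b - w \<bullet> x\<bar>"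
  define R where "R = 1 + (norm w + M) / c"
  \<comment> \<open>the radius \<open>R\<close> comes from \<open>c d\<^sup>2 \<le> norm w * d + M\<close> with \<open>d = norm (u - x)\<close>\<close>
  have bd: "norm (u - x) \<le> R \<and> \<bar>r\<bar> \<le> \<bar>\<alpha>\<bar> + norm w * (norm x + R) + \<bar>b\<bar>" if "(u, r) \<in> S" for u r
  proof -
    have u: "u \<in> edom f" "rval f u \<le> r" "r + c * (norm (x - u))\<^sup>2 \<le> \<alpha>"
      using that f by (auto simp: S_def J_def epi_def Gamma0_le_ereal_iff)
    define d where "d = norm (u - x)"
    have "w \<bullet> u + b \<le> r" using minor u by fastforce
    moreover have "w \<bullet> u = w \<bullet> x + w \<bullet> (u - x)" by (simp add: inner_diff_right)
    moreover have "\<bar>w \<bullet> (u - x)\<bar> \<le> norm w * d"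
      unfolding d_def by (rule Cauchy_Schwarz_ineq2)
    ultimately have *: "c * d\<^sup>2 \<le> norm w * d + M"
      using u(3) unfolding M_def d_def by (simp add: norm_minus_commute)
    have "M \<ge> 0" "d \<ge> 0" by (auto simp: M_def d_def)
    have dR: "d \<le> R"
    proof (cases "d \<le> 1")
      case True
      have "0 \<le> (norm w + M) / c" using \<open>M \<ge> 0\<close> c by simp
      then show ?thesis using True by (simp add: R_def)
    next
      case False
      have "M \<le> M * d" using False \<open>M \<ge> 0\<close> mult_left_mono[of 1 d M] by simp
      with * have "c * d * d \<le> (norm w + M) * d" by (simp add: power2_eq_square algebra_simps)
      then have "c * d \<le> norm w + M" using False by simp
      then have "d \<le> (norm w + M) / c" using c by (simp add: field_simps)
      then show ?thesis by (simp add: R_def)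
    qed
    have "norm u \<le> norm x + R"
      using norm_triangle_ineq[of x "u - x"] dR by (simp add: d_def)
    then have "\<bar>w \<bullet> u\<bar> \<le> norm w * (norm x + R)"
      using Cauchy_Schwarz_ineq2[of w u] mult_left_mono[of "norm u" "norm x + R" "norm w"] by simp
    moreover have "0 \<le> c * (norm (x - u))\<^sup>2" using c by simp
    then have "r \<le> \<alpha>" using u(3) by linarith
    ultimately show ?thesis
      using dR \<open>w \<bullet> u + b \<le> r\<close> by (simp add: d_def)
  qed
  have "bounded S"
  proof (rule bounded_subset)
    show "bounded (cball x R \<times> cball (0::real) (\<bar>\<alpha>\<bar> + norm w * (norm x + R) + \<bar>b\<bar>))"
      by (intro bounded_Times bounded_cball)
    show "S \<subseteq> cball x R \<times> cball (0::real) (\<bar>\<alpha>\<bar> + norm w * (norm x + R) + \<bar>b\<bar>)"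
      using bd by (auto simp: dist_norm norm_minus_commute)
  qed
  then have "compact S" using \<open>closed S\<close> by (simp add: compact_eq_bounded_closed)
  moreover have ne: "(x0, rval f x0) \<in> S"
    using x0 f by (auto simp: S_def J_def \<alpha>_def epi_def Gamma0_le_ereal_iff)
  ultimately obtain z where z: "z \<in> S" "\<forall>y\<in>S. J z \<le> J y"
    using continuous_attains_inf[of S J] contJ continuous_on_subset by blast
  obtain p r where [simp]: "z = (p, r)" by (cases z)
  have p: "p \<in> edom f" "rval f p \<le> r" "J z \<le> \<alpha>"
    using z(1) f by (auto simp: S_def epi_def Gamma0_le_ereal_iff)
  show ?thesis
  proof
    show "p \<in> edom f" by fact
    fix u assume u: "u \<in> edom f"
    have "J z \<le> J (u, rval f u)"
    proof (cases "J (u, rval f u) \<le> \<alpha>")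
      case True
      then have "(u, rval f u) \<in> S"
        using u f by (auto simp: S_def epi_def Gamma0_le_ereal_iff)
      then show ?thesis using z by blast
    qed (use p in auto)
    then show "rval f p + c * (norm (x - p))\<^sup>2 \<le> rval f u + c * (norm (x - u))\<^sup>2"
      using p by (simp add: J_def)
  qed
qed

lemma subdiff_iff:
  assumes f: "f \<in> Gamma0"
  shows "v \<in> subdiff f x \<longleftrightarrow>
    x \<in> edom f \<and> (\<forall>y\<in>edom f. rval f x + v \<bullet> (y - x) \<le> rval f y)"
proof (cases "x \<in> edom f")
  case True
  have "f x + ereal (v \<bullet> (y - x)) \<le> f y \<longleftrightarrow> (y \<in> edom f \<longrightarrow> rval f x + v \<bullet> (y - x) \<le> rval f y)" for y
  proof (cases "y \<in> edom f")
    case y: True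
    show ?thesis
      using Gamma0_eq_rval[OF f True] Gamma0_eq_rval[OF f y] y
      by (metis ereal_less_eq(3) plus_ereal.simps(1))
  next
    case y: False
    then have "f y = \<infinity>" by (simp add: edom_def)
    then show ?thesis using y by simp
  qed
  then show ?thesis using True by (simp add: subdiff_def Ball_def)
qed (simp add: subdiff_def)

lemma subdiff_monotone:
  assumes "f \<in> Gamma0" "v \<in> subdiff f x" "w \<in> subdiff f y"
  shows "0 \<le> (v - w) \<bullet> (x - y)"
proof -
  have "rval f x + v \<bullet> (y - x) \<le> rval f y" "rval f y + w \<bullet> (x - y) \<le> rval f x"
    using assms by (auto simp: subdiff_iff)
  then show ?thesis by (simp add: algebra_simps)
qed

lemma le_of_le_add_small:
  fixes A B C :: real
  assumes "\<And>t. 0 < t \<Longrightarrow> t \<le> 1 \<Longrightarrow> A \<le> B + t * C"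
  shows "A \<le> B"
proof (rule field_le_epsilon)
  fix e :: real assume e: "e > 0"
  define t where "t = min 1 (e / (\<bar>C\<bar> + 1))"
  have t: "0 < t" "t \<le> 1" using e by (auto simp: t_def)
  have "t * C \<le> t * (\<bar>C\<bar> + 1)" using t by (intro mult_left_mono) auto
  also have "\<dots> \<le> (e / (\<bar>C\<bar> + 1)) * (\<bar>C\<bar> + 1)"
    by (intro mult_right_mono) (auto simp: t_def)
  also have "\<dots> = e" by simp
  finally show "A \<le> B + e" using assms[OF t] by simp
qed

text \<open>Compare the minimizer with the points \<open>p + t (y - p)\<close>, use convexity of \<open>f\<close>, and let \<open>t\<close>
  tend to zero.\<close>

lemma subdiff_if_prox_minimizer:
  fixes f :: "'a::euclidean_space \<Rightarrow> ereal"
  assumes f: "f \<in> Gamma0" and l: "0 < l" and p: "p \<in> edom f"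
    and min: "\<And>u. u \<in> edom f \<Longrightarrow>
      rval f p + 1 / (2 * l) * (norm (x - p))\<^sup>2 \<le> rval f u + 1 / (2 * l) * (norm (x - u))\<^sup>2"
  shows "(1 / l) *\<^sub>R (x - p) \<in> subdiff f p"
  unfolding subdiff_iff[OF f]
proof (intro conjI ballI)
  fix y assume y: "y \<in> edom f"
  show "rval f p + (1 / l) *\<^sub>R (x - p) \<bullet> (y - p) \<le> rval f y"
  proof (rule le_of_le_add_small)
    fix t :: real assume t: "0 < t" "t \<le> 1"
    define u where "u = p + t *\<^sub>R (y - p)"
    have u: "u \<in> edom f" "rval f u \<le> (1 - t) * rval f p + t * rval f y"
      using Gamma0_convex[OF f p y, of t] t by (auto simp: u_def)
    have "(norm (x - u))\<^sup>2 = (norm (x - p))\<^sup>2 - 2 * t * ((x - p) \<bullet> (y - p)) + t\<^sup>2 * (norm (y - p))\<^sup>2"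
      unfolding u_def power2_norm_eq_inner
      by (simp add: inner_diff_left inner_diff_right inner_add_left inner_add_right inner_commute
          algebra_simps power2_eq_square)
    then have "(1 / (2 * l)) * (norm (x - u))\<^sup>2 = (1 / (2 * l)) * (norm (x - p))\<^sup>2
        + t * (t * ((1 / (2 * l)) * (norm (y - p))\<^sup>2) - (1 / l) * ((x - p) \<bullet> (y - p)))"
      using l by (simp add: field_simps power2_eq_square)
    with min[OF u(1)] u(2)
    have "0 \<le> t * (rval f y - rval f p - (1 / l) * ((x - p) \<bullet> (y - p)) + t * ((1 / (2 * l)) * (norm (y - p))\<^sup>2))"
      by (simp add: algebra_simps)
    then have "0 \<le> rval f y - rval f p - (1 / l) * ((x - p) \<bullet> (y - p)) + t * ((1 / (2 * l)) * (norm (y - p))\<^sup>2)"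
      using t by (simp add: zero_le_mult_iff)
    then show "rval f p + (1 / l) *\<^sub>R (x - p) \<bullet> (y - p) \<le> rval f y + t * ((1 / (2 * l)) * (norm (y - p))\<^sup>2)"
      by simp
  qed
qed (fact p)

lemma prox_strict_minimizer_if_subdiff:
  fixes f :: "'a::euclidean_space \<Rightarrow> ereal"
  assumes f: "f \<in> Gamma0" and l: "0 < l" and v: "(1 / l) *\<^sub>R (x - p) \<in> subdiff f p"
    and u: "u \<in> edom f" "u \<noteq> p"
  shows "rval f p + 1 / (2 * l) * (norm (x - p))\<^sup>2 < rval f u + 1 / (2 * l) * (norm (x - u))\<^sup>2"
proof -
  have le: "rval f p + (1 / l) *\<^sub>R (x - p) \<bullet> (u - p) \<le> rval f u"
    using v u subdiff_iff[OF f] by blast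
  have "(norm (x - u))\<^sup>2 = (norm (x - p))\<^sup>2 - 2 * ((x - p) \<bullet> (u - p)) + (norm (u - p))\<^sup>2"
    unfolding power2_norm_eq_inner
    by (simp add: inner_diff_left inner_diff_right inner_commute algebra_simps)
  then have "(1 / (2 * l)) * (norm (x - u))\<^sup>2 = (1 / (2 * l)) * (norm (x - p))\<^sup>2
      - (1 / l) * ((x - p) \<bullet> (u - p)) + (1 / (2 * l)) * (norm (u - p))\<^sup>2"
    using l by (simp add: field_simps)
  moreover have "(1 / (2 * l)) * (norm (u - p))\<^sup>2 > 0"
    using l u by simp
  ultimately show ?thesis using le by simp
qed

text \<open>Conversely, \<open>(x - p) / l \<in> subdiff f p\<close> makes \<open>p\<close> the strict minimizer. With \<open>prox_subdiff\<close>
  this identifies \<open>prox l f\<close> with the resolvent of \<open>l\<close> times the subdifferential.\<close>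

lemma prox_eqI:
  fixes f :: "'a::euclidean_space \<Rightarrow> ereal"
  assumes f: "f \<in> Gamma0" and l: "0 < l" and v: "(1 / l) *\<^sub>R (x - p) \<in> subdiff f p"
  shows "prox l f x = p"
proof -
  let ?J = "\<lambda>u. f u + ereal (1 / (2 * l) * (norm (x - u))\<^sup>2)"
  have p: "p \<in> edom f" using v by (simp add: subdiff_def)
  have less: "?J p < ?J u" if "u \<noteq> p" for u
  proof (cases "u \<in> edom f")
    case True
    then show ?thesis
      using prox_strict_minimizer_if_subdiff[OF f l v True that] Gamma0_eq_rval[OF f p] Gamma0_eq_rval[OF f True]
      by (metis less_ereal.simps(1) plus_ereal.simps(1))
  next
    case False
    then have "f u = \<infinity>" by (simp add: edom_def)
    then show ?thesis using Gamma0_eq_rval[OF f p] by (metis ereal_infty_less(1) plus_ereal.simps(1) plus_ereal.simps(2) PInfty_neq_ereal(1))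
  qed
  show ?thesis
    unfolding prox_def arg_min_def is_arg_min_def
  proof (rule some_equality)
    show "True \<and> \<not> (\<exists>y. True \<and> ?J y < ?J p)" using less by (metis less_asym less_irrefl)
  qed (use less in blast)
qed

lemma prox_subdiff:
  fixes f :: "'a::euclidean_space \<Rightarrow> ereal"
  assumes f: "f \<in> Gamma0" and l: "0 < l"
  shows "(1 / l) *\<^sub>R (x - prox l f x) \<in> subdiff f (prox l f x)"
proof -
  obtain p where p: "p \<in> edom f" "\<And>u. u \<in> edom f \<Longrightarrow>
      rval f p + 1 / (2 * l) * (norm (x - p))\<^sup>2 \<le> rval f u + 1 / (2 * l) * (norm (x - u))\<^sup>2"
    using prox_objective_attains[OF f, of "1 / (2 * l)" x] l by auto
  then have v: "(1 / l) *\<^sub>R (x - p) \<in> subdiff f p"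
    by (rule subdiff_if_prox_minimizer[OF f l])
  then show ?thesis using prox_eqI[OF f l v] by simp
qed

lemma prox_add_subgradient:
  assumes "f \<in> Gamma0" "0 < l" "v \<in> subdiff f p"
  shows "prox l f (p + l *\<^sub>R v) = p"
  by (rule prox_eqI) (use assms in auto)

section \<open>The proximal curve\<close>

lemma norm_le_of_inner_le:
  fixes d :: "'a::real_inner"
  assumes "d \<bullet> d \<le> c * norm d" "0 \<le> c"
  shows "norm d \<le> c"
proof (cases "d = 0")
  case False
  have "norm d * norm d \<le> c * norm d"
    using assms by (simp add: power2_norm_eq_inner[symmetric] power2_eq_square)
  then show ?thesis using False by simp
qed (use assms in simp)

lemma prox_nonexpansive:
  assumes f: "f \<in> Gamma0" and l: "0 < l"
  shows "norm (prox l f x - prox l f y) \<le> norm (x - y)"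
proof -
  define d where "d = prox l f x - prox l f y"
  have "0 \<le> ((1 / l) *\<^sub>R (x - prox l f x) - (1 / l) *\<^sub>R (y - prox l f y)) \<bullet> d"
    unfolding d_def by (intro subdiff_monotone[OF f] prox_subdiff f l)
  also have "\<dots> = (1 / l) * ((x - y) \<bullet> d - d \<bullet> d)"
    by (simp add: d_def algebra_simps inner_commute)
  finally have "d \<bullet> d \<le> (x - y) \<bullet> d"
    using l by (simp add: zero_le_divide_iff)
  also have "\<dots> \<le> norm (x - y) * norm d" by (rule norm_cauchy_schwarz)
  finally have "norm d \<le> norm (x - y)" by (rule norm_le_of_inner_le) simp
  then show ?thesis by (simp add: d_def)
qed

text \<open>The subgradient that belongs to the proximal point: for \<open>f \<in> Gamma0\<close> and \<open>l > 0\<close>, the pair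
  of \<open>prox l f x\<close> and \<open>prox_slope l f x\<close> lies in the graph of \<open>subdiff f\<close>, and \<open>prox l f x + l *\<^sub>R
  prox_slope l f x = x\<close>.\<close>

definition prox_slope :: "real \<Rightarrow> ('a::euclidean_space \<Rightarrow> ereal) \<Rightarrow> 'a \<Rightarrow> 'a" where
  "prox_slope l f x = (1 / l) *\<^sub>R (x - prox l f x)"

lemma prox_slope_subdiff:
  "f \<in> Gamma0 \<Longrightarrow> 0 < l \<Longrightarrow> prox_slope l f x \<in> subdiff f (prox l f x)"
  unfolding prox_slope_def by (rule prox_subdiff)

lemma prox_add_slope: "0 < l \<Longrightarrow> prox l f x + l *\<^sub>R prox_slope l f x = x"
  by (simp add: prox_slope_def)

lemma prox_edom: "f \<in> Gamma0 \<Longrightarrow> 0 < l \<Longrightarrow> prox l f x \<in> edom f"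
  using prox_subdiff[of f l x] by (simp add: subdiff_def)

lemma prox_parameter_identities:
  assumes f: "f \<in> Gamma0" and l: "0 < l" and m: "0 < m"
  shows "prox m f x - prox l f x = - m *\<^sub>R (prox_slope m f x - prox_slope l f x) - (m - l) *\<^sub>R prox_slope l f x"
    and "0 \<le> (prox_slope m f x - prox_slope l f x) \<bullet> (prox m f x - prox l f x)"
proof -
  have "prox m f x = x - m *\<^sub>R prox_slope m f x" "prox l f x = x - l *\<^sub>R prox_slope l f x"
    using prox_add_slope[OF l, of f x] prox_add_slope[OF m, of f x] by (metis add_diff_cancel_right')+
  then show "prox m f x - prox l f x = - m *\<^sub>R (prox_slope m f x - prox_slope l f x) - (m - l) *\<^sub>R prox_slope l f x"
    by (simp add: algebra_simps)
  show "0 \<le> (prox_slope m f x - prox_slope l f x) \<bullet> (prox m f x - prox l f x)"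
    by (intro subdiff_monotone[OF f] prox_slope_subdiff f l m)
qed

text \<open>Insert the expression for either increment from the identity above into the monotonicity
  inequality.\<close>

lemma prox_lipschitz_parameter:
  assumes f: "f \<in> Gamma0" and l: "0 < l" and m: "0 < m"
  shows "norm (prox m f x - prox l f x) \<le> \<bar>m - l\<bar> * norm (prox_slope l f x)"
    and "m * norm (prox_slope m f x - prox_slope l f x) \<le> \<bar>m - l\<bar> * norm (prox_slope l f x)"
proof -
  define d where "d = prox m f x - prox l f x"
  define e where "e = prox_slope m f x - prox_slope l f x"
  define v where "v = prox_slope l f x"
  have de: "d = - m *\<^sub>R e - (m - l) *\<^sub>R v" and ed: "0 \<le> e \<bullet> d"
    using prox_parameter_identities[OF f l m] by (auto simp: d_def e_def v_def)
  have cs: "- (m - l) * (v \<bullet> w) \<le> \<bar>m - l\<bar> * norm v * norm w" for w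
  proof -
    have "- (m - l) * (v \<bullet> w) \<le> \<bar>m - l\<bar> * \<bar>v \<bullet> w\<bar>"
      by (metis abs_ge_self abs_minus_cancel abs_mult)
    also have "\<dots> \<le> \<bar>m - l\<bar> * (norm v * norm w)"
      by (intro mult_left_mono Cauchy_Schwarz_ineq2) auto
    finally show ?thesis by simp
  qed
  have "m *\<^sub>R e = - d - (m - l) *\<^sub>R v" using de by simp
  then have "m * (e \<bullet> d) = - (d \<bullet> d) - (m - l) * (v \<bullet> d)"
    by (metis inner_diff_left inner_minus_left inner_scaleR_left)
  moreover have "0 \<le> m * (e \<bullet> d)" using m ed by simp
  ultimately have "d \<bullet> d \<le> - (m - l) * (v \<bullet> d)" by linarith
  also have "\<dots> \<le> (\<bar>m - l\<bar> * norm v) * norm d" by (rule cs)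
  finally show "norm (prox m f x - prox l f x) \<le> \<bar>m - l\<bar> * norm (prox_slope l f x)"
    unfolding d_def[symmetric] v_def[symmetric] by (rule norm_le_of_inner_le) simp
  have "e \<bullet> d = - m * (e \<bullet> e) - (m - l) * (v \<bullet> e)"
    unfolding de by (simp add: inner_diff_right inner_commute)
  with ed have "m * (e \<bullet> e) \<le> - (m - l) * (v \<bullet> e)" by linarith
  also have "\<dots> \<le> (\<bar>m - l\<bar> * norm v) * norm e" by (rule cs)
  finally have "m * (m * (e \<bullet> e)) \<le> m * ((\<bar>m - l\<bar> * norm v) * norm e)"
    using m by simp
  then have "(m *\<^sub>R e) \<bullet> (m *\<^sub>R e) \<le> (\<bar>m - l\<bar> * norm v) * norm (m *\<^sub>R e)"
    using m by (simp add: mult.left_commute)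
  then have "norm (m *\<^sub>R e) \<le> \<bar>m - l\<bar> * norm v" by (rule norm_le_of_inner_le) simp
  then show "m * norm (prox_slope m f x - prox_slope l f x) \<le> \<bar>m - l\<bar> * norm (prox_slope l f x)"
    using m by (simp add: e_def v_def)
qed

text \<open>Near \<open>lbar\<close> everything is Lipschitz in the parameter. The last bound says that \<open>f\<close> along the
  proximal curve agrees with its linearization by the subgradient up to second order; this is what
  lets derivatives of \<open>f (prox l f x)\<close> be computed from the curve alone. It combines the
  subgradient inequalities at both end points.\<close>

lemma prox_curve_bounds:
  fixes f :: "'a::euclidean_space \<Rightarrow> ereal"
  assumes f: "f \<in> Gamma0" and lb: "0 < lbar"
  obtains B where "0 < B"
    "\<And>l. \<bar>l - lbar\<bar> < lbar / 2 \<Longrightarrow> norm (prox_slope l f x) \<le> B"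
    "\<And>l m. \<bar>l - lbar\<bar> < lbar / 2 \<Longrightarrow> \<bar>m - lbar\<bar> < lbar / 2 \<Longrightarrow>
       norm (prox m f x - prox l f x) \<le> B * \<bar>m - l\<bar>"
    "\<And>l m. \<bar>l - lbar\<bar> < lbar / 2 \<Longrightarrow> \<bar>m - lbar\<bar> < lbar / 2 \<Longrightarrow>
       norm (prox_slope m f x - prox_slope l f x) \<le> B * \<bar>m - l\<bar>"
    "\<And>l m. \<bar>l - lbar\<bar> < lbar / 2 \<Longrightarrow> \<bar>m - lbar\<bar> < lbar / 2 \<Longrightarrow>
       \<bar>rval f (prox m f x) - rval f (prox l f x)\<bar> \<le> B * \<bar>m - l\<bar>"
    "\<And>l m. \<bar>l - lbar\<bar> < lbar / 2 \<Longrightarrow> \<bar>m - lbar\<bar> < lbar / 2 \<Longrightarrow>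
       \<bar>rval f (prox m f x) - rval f (prox l f x) - prox_slope l f x \<bullet> (prox m f x - prox l f x)\<bar> \<le> B * \<bar>m - l\<bar>\<^sup>2"
proof -
  define I where "I = {l. \<bar>l - lbar\<bar> < lbar / 2}"
  define C where "C = 2 * norm (prox_slope lbar f x) + 1"
  define D where "D = 2 / lbar * C"
  have pos: "l > lbar / 2" if "l \<in> I" for l
    using that unfolding I_def mem_Collect_eq by linarith
  have pos0: "l > 0" if "l \<in> I" for l
    using pos[OF that] lb by simp
  have C0: "C \<ge> 1" by (simp add: C_def)
  then have D0: "D > 0" using lb by (simp add: D_def)
  have VC: "norm (prox_slope l f x) \<le> C" if l: "l \<in> I" for l
  proof -
    let ?e = "norm (prox_slope l f x - prox_slope lbar f x)"
    have "l * ?e \<le> \<bar>l - lbar\<bar> * norm (prox_slope lbar f x)"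
      by (rule prox_lipschitz_parameter[OF f lb pos0[OF l]])
    also have "\<dots> \<le> l * norm (prox_slope lbar f x)"
      using l pos[OF l] by (intro mult_right_mono) (auto simp: I_def)
    finally have "?e \<le> norm (prox_slope lbar f x)"
      using pos0[OF l] by simp
    then show ?thesis
      using norm_triangle_ineq2[of "prox_slope l f x" "prox_slope lbar f x"] by (simp add: C_def)
  qed
  have PC: "norm (prox m f x - prox l f x) \<le> C * \<bar>m - l\<bar>" if "l \<in> I" "m \<in> I" for l m
  proof -
    have "norm (prox m f x - prox l f x) \<le> \<bar>m - l\<bar> * norm (prox_slope l f x)"
      by (rule prox_lipschitz_parameter[OF f pos0[OF that(1)] pos0[OF that(2)]])
    also have "\<dots> \<le> \<bar>m - l\<bar> * C" by (intro mult_left_mono VC that) auto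
    finally show ?thesis by (simp add: mult.commute)
  qed
  have VD: "norm (prox_slope m f x - prox_slope l f x) \<le> D * \<bar>m - l\<bar>" if "l \<in> I" "m \<in> I" for l m
  proof -
    have "(lbar / 2) * norm (prox_slope m f x - prox_slope l f x) \<le> m * norm (prox_slope m f x - prox_slope l f x)"
      using pos[OF that(2)] by (intro mult_right_mono) auto
    also have "\<dots> \<le> \<bar>m - l\<bar> * norm (prox_slope l f x)"
      by (rule prox_lipschitz_parameter[OF f pos0[OF that(1)] pos0[OF that(2)]])
    also have "\<dots> \<le> \<bar>m - l\<bar> * C" by (intro mult_left_mono VC that) auto
    finally show ?thesis using lb by (simp add: D_def field_simps)
  qed
  have sub: "rval f (prox l f x) + prox_slope l f x \<bullet> (prox m f x - prox l f x) \<le> rval f (prox m f x)"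
    if "l \<in> I" "m \<in> I" for l m
    using prox_slope_subdiff[OF f pos0[OF that(1)], of x] prox_edom[OF f pos0[OF that(2)], of x]
    by (auto simp: subdiff_iff[OF f])
  have h1: "rval f (prox l f x) - rval f (prox m f x) \<le> C * C * \<bar>m - l\<bar>" if "l \<in> I" "m \<in> I" for l m
  proof -
    have "rval f (prox l f x) - rval f (prox m f x) \<le> - (prox_slope l f x \<bullet> (prox m f x - prox l f x))"
      using sub[OF that] by simp
    also have "\<dots> \<le> norm (prox_slope l f x) * norm (prox m f x - prox l f x)"
      using Cauchy_Schwarz_ineq2[of "prox_slope l f x" "prox m f x - prox l f x"] by simp
    also have "\<dots> \<le> C * (C * \<bar>m - l\<bar>)"
      using C0 by (intro mult_mono VC PC that) auto
    finally show ?thesis by simp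
  qed
  have h2: "\<bar>rval f (prox m f x) - rval f (prox l f x) - prox_slope l f x \<bullet> (prox m f x - prox l f x)\<bar> \<le> D * C * \<bar>m - l\<bar>\<^sup>2"
    if "l \<in> I" "m \<in> I" for l m
  proof -
    have "rval f (prox m f x) - rval f (prox l f x) - prox_slope l f x \<bullet> (prox m f x - prox l f x)
        \<le> (prox_slope m f x - prox_slope l f x) \<bullet> (prox m f x - prox l f x)"
      using sub[OF that(2) that(1)] by (simp add: algebra_simps)
    also have "\<dots> \<le> norm (prox_slope m f x - prox_slope l f x) * norm (prox m f x - prox l f x)"
      by (rule norm_cauchy_schwarz)
    also have "\<dots> \<le> (D * \<bar>m - l\<bar>) * (C * \<bar>m - l\<bar>)"
      using D0 by (intro mult_mono VD PC that) auto
    also have "\<dots> = D * C * \<bar>m - l\<bar>\<^sup>2" by (simp add: power2_eq_square)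
    finally show ?thesis using sub[OF that] by simp
  qed
  define B where "B = max (max C D) (max (C * C) (D * C))"
  have BB: "C \<le> B" "D \<le> B" "C * C \<le> B" "D * C \<le> B" by (auto simp: B_def)
  have le: "y * r \<le> B * r" if "y \<le> B" "0 \<le> r" for y r using that by (rule mult_right_mono)
  show ?thesis
  proof (rule that[of B])
    show "0 < B" using C0 BB(1) by simp
  next
    fix l assume "\<bar>l - lbar\<bar> < lbar / 2"
    then have "l \<in> I" by (simp add: I_def)
    then show "norm (prox_slope l f x) \<le> B" using VC BB(1) by fastforce
  next
    fix l m assume "\<bar>l - lbar\<bar> < lbar / 2" "\<bar>m - lbar\<bar> < lbar / 2"
    then have lm: "l \<in> I" "m \<in> I" by (auto simp: I_def)
    show "norm (prox m f x - prox l f x) \<le> B * \<bar>m - l\<bar>"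
      using PC[OF lm] le[OF BB(1), of "\<bar>m - l\<bar>"] by simp
    show "norm (prox_slope m f x - prox_slope l f x) \<le> B * \<bar>m - l\<bar>"
      using VD[OF lm] le[OF BB(2), of "\<bar>m - l\<bar>"] by simp
    show "\<bar>rval f (prox m f x) - rval f (prox l f x)\<bar> \<le> B * \<bar>m - l\<bar>"
      using h1[OF lm] h1[OF lm(2) lm(1)] le[OF BB(3), of "\<bar>m - l\<bar>"] by (simp add: abs_minus_commute)
    show "\<bar>rval f (prox m f x) - rval f (prox l f x) - prox_slope l f x \<bullet> (prox m f x - prox l f x)\<bar> \<le> B * \<bar>m - l\<bar>\<^sup>2"
      using h2[OF lm] le[OF BB(4), of "\<bar>m - l\<bar>\<^sup>2"] by simp
  qed
qed


section \<open>An approximate mean value inequality\<close>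

text \<open>An approximate mean value inequality for a Lipschitz function: some proximal subgradient,
  taken near the segment from \<open>a\<close> to \<open>a + r v\<close>, has slope along \<open>v\<close> at least the difference
  quotient, up to \<open>\<epsilon>\<close>. It is read off from a minimizer of \<open>\<phi> w + K/2 |w - a - \<theta> v|\<^sup>2 - Q \<theta>\<close> over
  \<open>w\<close> and \<open>0 \<le> \<theta> \<le> r\<close>, where \<open>Q\<close> is the difference quotient minus \<open>\<epsilon>\<close> and \<open>K\<close> is large.
  Stationarity in \<open>w\<close> yields the proximal subgradient, stationarity in \<open>\<theta>\<close> the slope estimate.\<close>

lemma proximal_mean_value:
  fixes \<phi> :: "'a::euclidean_space \<Rightarrow> real"
  assumes lip: "L-lipschitz_on UNIV \<phi>" and r: "0 < r" and \<epsilon>: "0 < \<epsilon>" and \<delta>: "0 < \<delta>"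
  obtains w s K where "norm (w - a) \<le> r * norm v + \<delta>" "norm s \<le> 2 * L"
    "\<And>w'. \<phi> w + s \<bullet> (w' - w) - K * (norm (w' - w))\<^sup>2 \<le> \<phi> w'"
    "(\<phi> (a + r *\<^sub>R v) - \<phi> a) / r \<le> s \<bullet> v + \<epsilon>"
proof -
  have L0: "L \<ge> 0" using lip by (rule lipschitz_on_nonneg)
  have lipD: "\<bar>\<phi> y - \<phi> z\<bar> \<le> L * norm (y - z)" for y z
    using lipschitz_onD[OF lip, of y z] by (simp add: dist_norm)
  define Q where "Q = (\<phi> (a + r *\<^sub>R v) - \<phi> a) / r - \<epsilon>"
  define K where "K = 1 + L\<^sup>2 / (\<epsilon> * r) + 2 * L / \<delta>"
  have K: "K > 0" "L\<^sup>2 / (2 * K) < \<epsilon> * r" "2 * L / K \<le> \<delta>"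
  proof -
    have n: "0 \<le> L\<^sup>2 / (\<epsilon> * r)" "0 \<le> 2 * L / \<delta>" using L0 r \<epsilon> \<delta> by auto
    then show "K > 0" by (simp add: K_def)
    have "L\<^sup>2 / (\<epsilon> * r) < 2 * K" "2 * L / \<delta> \<le> K" using n by (auto simp: K_def)
    then show "L\<^sup>2 / (2 * K) < \<epsilon> * r" "2 * L / K \<le> \<delta>"
      using \<open>K > 0\<close> r \<epsilon> \<delta> by (auto simp: field_simps)
  qed
  define F where "F = (\<lambda>z::'a \<times> real. \<phi> (fst z) + K / 2 * (norm (fst z - a - snd z *\<^sub>R v))\<^sup>2 - Q * snd z)"
  have cphi: "continuous_on UNIV \<phi>" using lip by (rule lipschitz_on_continuous_on)
  have contF: "continuous_on UNIV F"
    unfolding F_def by (intro continuous_intros continuous_on_compose2[OF cphi]) auto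
  define R where "R = r * norm v + 2 * L / K"
  define S where "S = cball a R \<times> {0..r}"
  have "compact S" unfolding S_def by (intro compact_Times) auto
  moreover have "(a, 0) \<in> S"
    using r K L0 by (auto simp: S_def R_def)
  ultimately obtain z where z: "z \<in> S" "\<forall>y\<in>S. F z \<le> F y"
    using continuous_attains_inf[of S F] contF continuous_on_subset by blast
  obtain w \<theta> where [simp]: "z = (w, \<theta>)" by (cases z)
  have \<theta>: "0 \<le> \<theta>" "\<theta> \<le> r" using z(1) by (auto simp: S_def)
  define d where "d = w - a - \<theta> *\<^sub>R v"
  have seg: "norm (\<theta>' *\<^sub>R v) \<le> r * norm v" if "0 \<le> \<theta>'" "\<theta>' \<le> r" for \<theta>'
    using that by (simp add: mult_right_mono)
  have inS: "(a + \<theta>' *\<^sub>R v, \<theta>') \<in> S" if "0 \<le> \<theta>'" "\<theta>' \<le> r" for \<theta>'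
  proof -
    have "0 \<le> 2 * L / K" using L0 K by simp
    then show ?thesis using seg[OF that] that by (simp add: S_def R_def dist_norm)
  qed
  have nd: "norm d \<le> 2 * L / K"
  proof -
    have "F z \<le> F (a + \<theta> *\<^sub>R v, \<theta>)" using z(2) inS[OF \<theta>] by blast
    then have "\<phi> w + K / 2 * (norm d)\<^sup>2 \<le> \<phi> (a + \<theta> *\<^sub>R v)" by (simp add: F_def d_def)
    moreover have "w - (a + \<theta> *\<^sub>R v) = d" by (simp add: d_def)
    ultimately have "K / 2 * (norm d)\<^sup>2 \<le> L * norm d"
      using lipD[of w "a + \<theta> *\<^sub>R v"] by simp
    then have "d \<bullet> d \<le> (2 * L / K) * norm d"
      using K by (simp add: field_simps power2_norm_eq_inner)
    then show ?thesis by (rule norm_le_of_inner_le) (use L0 K in simp)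
  qed
  \<comment> \<open>far from the segment the penalty exceeds the variation of \<open>\<phi>\<close>, so \<open>w\<close> is a global minimizer\<close>
  have gmin: "F z \<le> F (w', \<theta>)" for w'
  proof (cases "norm (w' - a - \<theta> *\<^sub>R v) \<le> 2 * L / K")
    case True
    have "norm (w' - a) \<le> norm (w' - a - \<theta> *\<^sub>R v) + norm (\<theta> *\<^sub>R v)"
      using norm_triangle_ineq[of "w' - a - \<theta> *\<^sub>R v" "\<theta> *\<^sub>R v"] by simp
    then have "(w', \<theta>) \<in> S"
      using True seg[OF \<theta>] \<theta> by (simp add: S_def R_def dist_norm norm_minus_commute)
    then show ?thesis using z by blast
  next
    case False
    define e where "e = norm (w' - a - \<theta> *\<^sub>R v)"
    have e: "e > 2 * L / K" using False by (simp add: e_def)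
    moreover have "0 \<le> 2 * L / K" using L0 K(1) by simp
    ultimately have e0: "e > 0" by linarith
    have "F z \<le> F (a + \<theta> *\<^sub>R v, \<theta>)" using z(2) inS[OF \<theta>] by blast
    also have "\<dots> = \<phi> (a + \<theta> *\<^sub>R v) - Q * \<theta>" by (simp add: F_def)
    also have "\<dots> \<le> \<phi> w' + L * e - Q * \<theta>"
      using lipD[of w' "a + \<theta> *\<^sub>R v"] by (simp add: e_def diff_diff_eq)
    also have "L * e \<le> K / 2 * e\<^sup>2"
    proof -
      have "L \<le> K / 2 * e" using e K by (simp add: field_simps)
      then have "L * e \<le> K / 2 * e * e" using e0 by (intro mult_right_mono) auto
      then show ?thesis by (simp add: power2_eq_square)
    qed
    finally show ?thesis by (simp add: F_def e_def)
  qed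
  define s where "s = - K *\<^sub>R d"
  have prox: "\<phi> w + s \<bullet> (w' - w) - K / 2 * (norm (w' - w))\<^sup>2 \<le> \<phi> w'" for w'
  proof -
    have *: "w' - a - \<theta> *\<^sub>R v = d + (w' - w)" by (simp add: d_def)
    have "(norm (w' - a - \<theta> *\<^sub>R v))\<^sup>2 = (norm d)\<^sup>2 + 2 * (d \<bullet> (w' - w)) + (norm (w' - w))\<^sup>2"
      unfolding * power2_norm_eq_inner by (simp add: inner_add_left inner_add_right inner_commute del: add_diff_eq)
    moreover have "\<phi> w + K / 2 * (norm d)\<^sup>2 \<le> \<phi> w' + K / 2 * (norm (w' - a - \<theta> *\<^sub>R v))\<^sup>2"
      using gmin[of w'] unfolding F_def d_def by simp
    ultimately have "\<phi> w + K / 2 * (norm d)\<^sup>2 \<le> \<phi> w' + K / 2 * ((norm d)\<^sup>2 + 2 * (d \<bullet> (w' - w)) + (norm (w' - w))\<^sup>2)"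
      by (simp only:)
    then show ?thesis
      by (simp add: s_def algebra_simps)
  qed
  have lower: "\<phi> y - L\<^sup>2 / (2 * K) \<le> \<phi> w' + K / 2 * (norm (w' - y))\<^sup>2" for y w'
  proof -
    define n where "n = norm (w' - y)"
    have "0 \<le> (K * n - L)\<^sup>2 / (2 * K)" using K by simp
    also have "\<dots> = K / 2 * n\<^sup>2 - L * n + L\<^sup>2 / (2 * K)"
      using K by (simp add: field_simps power2_eq_square)
    finally show ?thesis using lipD[of w' y] by (simp add: n_def)
  qed
  \<comment> \<open>the end point \<open>\<theta> = r\<close> is excluded because there \<open>Q\<close>, being smaller than the difference quotient,
    leaves a surplus \<open>\<epsilon> r\<close> over the value at \<open>(a, 0)\<close>\<close>
  have "\<theta> < r"
  proof (rule ccontr)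
    assume "\<not> \<theta> < r"
    then have "\<theta> = r" using \<theta> by simp
    have "F z \<le> F (a, 0)" using z(2) inS[of 0] r by auto
    then have "\<phi> w + K / 2 * (norm (w - (a + r *\<^sub>R v)))\<^sup>2 - Q * r \<le> \<phi> a"
      by (simp add: F_def \<open>\<theta> = r\<close> diff_diff_eq)
    then have "\<phi> (a + r *\<^sub>R v) - L\<^sup>2 / (2 * K) - Q * r \<le> \<phi> a"
      using lower[of "a + r *\<^sub>R v" w] by simp
    moreover have "Q * r = \<phi> (a + r *\<^sub>R v) - \<phi> a - \<epsilon> * r"
      using r by (simp add: Q_def field_simps)
    ultimately show False using K(2) by simp
  qed
  \<comment> \<open>otherwise a small increase of \<open>\<theta>\<close> would lower \<open>F\<close>\<close>
  have "Q \<le> s \<bullet> v"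
  proof (rule ccontr)
    assume "\<not> Q \<le> s \<bullet> v"
    then have gap: "Q - s \<bullet> v > 0" by simp
    define c where "c = K / 2 * (norm v)\<^sup>2 + 1"
    have c: "c > 0" using K by (auto simp: c_def intro!: add_nonneg_pos)
    define \<eta> where "\<eta> = min (r - \<theta>) ((Q - s \<bullet> v) / (2 * c))"
    have \<eta>: "\<eta> > 0" using \<open>\<theta> < r\<close> gap c by (simp add: \<eta>_def)
    have "(w, \<theta> + \<eta>) \<in> S" using z(1) \<theta> \<eta> by (auto simp: S_def \<eta>_def)
    then have "F z \<le> F (w, \<theta> + \<eta>)" using z(2) by blast
    moreover have "w - a - (\<theta> + \<eta>) *\<^sub>R v = d - \<eta> *\<^sub>R v" by (simp add: d_def algebra_simps)
    then have "(norm (w - a - (\<theta> + \<eta>) *\<^sub>R v))\<^sup>2 = (norm d)\<^sup>2 - 2 * \<eta> * (d \<bullet> v) + \<eta>\<^sup>2 * (norm v)\<^sup>2"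
      unfolding power2_norm_eq_inner
      by (simp add: inner_diff_left inner_diff_right inner_commute power2_eq_square algebra_simps)
    moreover have "F z = \<phi> w + K / 2 * (norm d)\<^sup>2 - Q * \<theta>"
      unfolding F_def d_def by simp
    moreover have "F (w, \<theta> + \<eta>) = \<phi> w + K / 2 * (norm (w - a - (\<theta> + \<eta>) *\<^sub>R v))\<^sup>2 - Q * (\<theta> + \<eta>)"
      unfolding F_def by simp
    ultimately have "\<phi> w + K / 2 * (norm d)\<^sup>2 - Q * \<theta> \<le>
        \<phi> w + K / 2 * ((norm d)\<^sup>2 - 2 * \<eta> * (d \<bullet> v) + \<eta>\<^sup>2 * (norm v)\<^sup>2) - Q * (\<theta> + \<eta>)"
      by (simp only:)
    then have "0 \<le> K / 2 * (- 2 * \<eta> * (d \<bullet> v) + \<eta>\<^sup>2 * (norm v)\<^sup>2) - Q * \<eta>"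
      by (simp add: algebra_simps)
    then have "0 \<le> \<eta> * (s \<bullet> v - Q + K / 2 * \<eta> * (norm v)\<^sup>2)"
      by (simp add: s_def algebra_simps power2_eq_square)
    then have "Q - s \<bullet> v \<le> \<eta> * (K / 2 * (norm v)\<^sup>2)"
    proof -
      assume "0 \<le> \<eta> * (s \<bullet> v - Q + K / 2 * \<eta> * (norm v)\<^sup>2)"
      then have "0 \<le> s \<bullet> v - Q + K / 2 * \<eta> * (norm v)\<^sup>2"
        using \<eta> by (simp only: zero_le_mult_iff) auto
      then show ?thesis by (simp add: algebra_simps)
    qed
    also have "\<dots> \<le> \<eta> * c" using \<eta> by (intro mult_left_mono) (auto simp: c_def)
    also have "\<dots> \<le> (Q - s \<bullet> v) / (2 * c) * c"
      using c by (intro mult_right_mono) (auto simp: \<eta>_def)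
    also have "\<dots> = (Q - s \<bullet> v) / 2" using c by simp
    finally show False using gap by simp
  qed
  show ?thesis
  proof
    have "w - a = d + \<theta> *\<^sub>R v" by (simp add: d_def)
    then show "norm (w - a) \<le> r * norm v + \<delta>"
      using norm_triangle_ineq[of d "\<theta> *\<^sub>R v"] nd K(3) seg[OF \<theta>] by simp
    have "norm s = K * norm d" using K by (simp add: s_def)
    also have "\<dots> \<le> 2 * L" using nd K by (simp add: field_simps)
    finally show "norm s \<le> 2 * L" .
    show "(\<phi> (a + r *\<^sub>R v) - \<phi> a) / r \<le> s \<bullet> v + \<epsilon>" using \<open>Q \<le> s \<bullet> v\<close> by (simp add: Q_def)
    show "\<phi> w + s \<bullet> (w' - w) - (K / 2) * (norm (w' - w))\<^sup>2 \<le> \<phi> w'" for w' by (rule prox)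
  qed
qed

section \<open>Derivatives along the proximal curve and normals to the graph\<close>

lemma tendsto_if_subsequential_limits:
  fixes X :: "nat \<Rightarrow> 'a::euclidean_space" and g :: "'a \<Rightarrow> 'b::metric_space"
  assumes bd: "bounded (range X)" and g: "continuous_on UNIV g"
    and lim: "\<And>r l. strict_mono (r::nat \<Rightarrow> nat) \<Longrightarrow> (X \<circ> r) \<longlonglongrightarrow> l \<Longrightarrow> g l = c"
  shows "(\<lambda>k. g (X k)) \<longlonglongrightarrow> c"
proof (rule tendstoI, rule ccontr)
  fix e :: real assume "0 < e"
  assume "\<not> (\<forall>\<^sub>F k in sequentially. dist (g (X k)) c < e)"
  then obtain r :: "nat \<Rightarrow> nat" where r: "strict_mono r" "\<And>n. \<not> dist (g (X (r n))) c < e"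
    using not_eventually_sequentiallyD by blast
  have "bounded (range (X \<circ> r))" using bd by (rule bounded_subset) auto
  then obtain l s where s: "strict_mono (s::nat \<Rightarrow> nat)" "((X \<circ> r) \<circ> s) \<longlonglongrightarrow> l"
    using bounded_imp_convergent_subsequence by blast
  have "g l = c"
    using lim[of "r \<circ> s" l] s r(1) by (simp add: strict_mono_o o_assoc)
  moreover have "(\<lambda>n. g ((X \<circ> r \<circ> s) n)) \<longlonglongrightarrow> g l"
    using s(2) g by (metis UNIV_I continuous_on_eq_continuous_at isCont_tendsto_compose open_UNIV)
  ultimately have "(\<lambda>n. g ((X \<circ> r \<circ> s) n)) \<longlonglongrightarrow> c" by simp
  then have "\<forall>\<^sub>F n in sequentially. dist (g ((X \<circ> r \<circ> s) n)) c < e"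
    using \<open>0 < e\<close> by (rule tendstoD)
  then show False using r(2) by (auto simp: eventually_sequentially)
qed

text \<open>The map \<open>w \<mapsto> (prox l f w, prox_slope l f w)\<close> parametrizes the graph of the subdifferential
  (Minty), with inverse \<open>(p, v) \<mapsto> p + l v\<close>. Hence a proximal subgradient at \<open>w\<close> of a linear
  functional composed with \<open>prox l f\<close> turns into a regular normal to the graph.\<close>

lemma regular_normal_if_proximal_subgradient:
  fixes f :: "'a::euclidean_space \<Rightarrow> ereal"
  assumes f: "f \<in> Gamma0" and l: "0 < l"
    and prx: "\<And>w'. c \<bullet> prox l f w + s \<bullet> (w' - w) - K * (norm (w' - w))\<^sup>2 \<le> c \<bullet> prox l f w'"
  shows "(s - c, l *\<^sub>R s) \<in> regular_normal_cone (gph (subdiff f)) (prox l f w, prox_slope l f w)"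
proof -
  let ?a = "(prox l f w, prox_slope l f w)"
  have a: "?a \<in> gph (subdiff f)" using prox_slope_subdiff[OF f l] by (simp add: gph_def)
  have "(s - c, l *\<^sub>R s) \<bullet> z \<le> 0" if z: "z \<in> tangent_cone (gph (subdiff f)) ?a" for z
  proof -
    obtain t zs where t: "pos_null t" "zs \<longlonglongrightarrow> z" "\<And>k. ?a + t k *\<^sub>R zs k \<in> gph (subdiff f)"
      using z unfolding tangent_cone_def by blast
    define \<zeta> where "\<zeta> = (\<lambda>k. fst (zs k) + l *\<^sub>R snd (zs k))"
    have t0: "t k > 0" for k using t(1) by (simp add: pos_null_def)
    have le: "s \<bullet> \<zeta> k - K * t k * (norm (\<zeta> k))\<^sup>2 \<le> c \<bullet> fst (zs k)" for k
    proof -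
      have "prox_slope l f w + t k *\<^sub>R snd (zs k) \<in> subdiff f (prox l f w + t k *\<^sub>R fst (zs k))"
        using t(3)[of k] by (cases "zs k") (simp add: gph_def)
      from prox_add_subgradient[OF f l this]
      moreover have "prox l f w + t k *\<^sub>R fst (zs k) + l *\<^sub>R (prox_slope l f w + t k *\<^sub>R snd (zs k))
          = (prox l f w + l *\<^sub>R prox_slope l f w) + t k *\<^sub>R \<zeta> k"
        by (simp add: \<zeta>_def algebra_simps)
      ultimately have "prox l f (w + t k *\<^sub>R \<zeta> k) = prox l f w + t k *\<^sub>R fst (zs k)"
        by (simp only: prox_add_slope[OF l])
      with prx[of "w + t k *\<^sub>R \<zeta> k"]
      have "t k * (s \<bullet> \<zeta> k) - K * (t k)\<^sup>2 * (norm (\<zeta> k))\<^sup>2 \<le> t k * (c \<bullet> fst (zs k))"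
        by (simp add: inner_add_right power_mult_distrib)
      then have "t k * (s \<bullet> \<zeta> k - K * t k * (norm (\<zeta> k))\<^sup>2) \<le> t k * (c \<bullet> fst (zs k))"
        by (simp add: algebra_simps power2_eq_square)
      then show ?thesis using t0[of k] by simp
    qed
    have t_lim: "t \<longlonglongrightarrow> 0" using t(1) by (simp add: pos_null_def)
    have \<zeta>: "\<zeta> \<longlonglongrightarrow> fst z + l *\<^sub>R snd z"
      unfolding \<zeta>_def by (intro tendsto_intros t)
    have "s \<bullet> (fst z + l *\<^sub>R snd z) - K * 0 * (norm (fst z + l *\<^sub>R snd z))\<^sup>2 \<le> c \<bullet> fst z"
    proof (rule LIMSEQ_le)
      show "(\<lambda>k. s \<bullet> \<zeta> k - K * t k * (norm (\<zeta> k))\<^sup>2) \<longlonglongrightarrow> s \<bullet> (fst z + l *\<^sub>R snd z) - K * 0 * (norm (fst z + l *\<^sub>R snd z))\<^sup>2"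
        by (intro tendsto_intros \<zeta> t_lim)
      show "(\<lambda>k. c \<bullet> fst (zs k)) \<longlonglongrightarrow> c \<bullet> fst z"
        by (intro tendsto_intros t)
      show "\<exists>N. \<forall>n\<ge>N. s \<bullet> \<zeta> n - K * t n * (norm (\<zeta> n))\<^sup>2 \<le> c \<bullet> fst (zs n)"
        using le by blast
    qed
    then show ?thesis
      by (cases z) (simp add: inner_add_right inner_diff_left)
  qed
  then show ?thesis using a by (simp add: regular_normal_cone_def)
qed

text \<open>If \<open>W l\<close> denotes the parameter of the proximal curve, \<open>W l = prox l f x + lbar *\<^sub>R
  prox_slope l f x\<close>, then \<open>W\<close> moves with velocity close to \<open>- vbar\<close>, where \<open>vbar = prox_slope lbar
  f x\<close>. So a derivative \<open>D\<close> of \<open>f (prox l f x)\<close> is, up to \<open>O(|l - lbar|)\<close>, a difference quotient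
  of \<open>w \<mapsto> vbar \<bullet> prox lbar f w\<close> in direction \<open>- vbar\<close>, and the mean value inequality applies. The
  sign \<open>\<tau>\<close> selects whether \<open>D\<close> is bounded from below or from above.\<close>

lemma derivative_bound_by_regular_normal:
  fixes f :: "'a::euclidean_space \<Rightarrow> ereal"
  assumes f: "f \<in> Gamma0" and lb: "0 < lbar"
  obtains C where "\<forall>l D \<tau>. 0 < \<bar>l - lbar\<bar> \<longrightarrow> \<bar>l - lbar\<bar> < lbar / 2 \<longrightarrow>
      ((\<lambda>m. rval f (prox m f x)) has_real_derivative D) (at l) \<longrightarrow> \<bar>\<tau>\<bar> = 1 \<longrightarrow>
      (\<exists>w s. norm (w - (prox l f x + lbar *\<^sub>R prox_slope l f x)) \<le> \<bar>l - lbar\<bar>\<^sup>2 \<and>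
        norm s \<le> 2 * norm (prox_slope lbar f x) \<and>
        (s - prox_slope lbar f x, lbar *\<^sub>R s) \<in>
          regular_normal_cone (gph (subdiff f)) (prox lbar f w, prox_slope lbar f w) \<and>
        - \<tau> * D \<le> \<tau> * (s \<bullet> prox_slope lbar f x) + C * \<bar>l - lbar\<bar>)"
proof -
  define P where "P = (\<lambda>m. prox m f x)"
  define V where "V = (\<lambda>m. prox_slope m f x)"
  define v where "v = prox_slope lbar f x"
  define h where "h = (\<lambda>m. rval f (P m))"
  obtain B where B: "0 < B"
    and VB: "\<And>l m. \<bar>l - lbar\<bar> < lbar / 2 \<Longrightarrow> \<bar>m - lbar\<bar> < lbar / 2 \<Longrightarrow>
       norm (V m - V l) \<le> B * \<bar>m - l\<bar>"
    and PB: "\<And>l m. \<bar>l - lbar\<bar> < lbar / 2 \<Longrightarrow> \<bar>m - lbar\<bar> < lbar / 2 \<Longrightarrow>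
       norm (P m - P l) \<le> B * \<bar>m - l\<bar>"
    and hB: "\<And>l m. \<bar>l - lbar\<bar> < lbar / 2 \<Longrightarrow> \<bar>m - lbar\<bar> < lbar / 2 \<Longrightarrow>
       \<bar>h m - h l - V l \<bullet> (P m - P l)\<bar> \<le> B * \<bar>m - l\<bar>\<^sup>2"
    unfolding P_def V_def h_def using prox_curve_bounds[OF f lb, of x] by metis
  define C where "C = 2 + 3 * B * norm v + B + B\<^sup>2"
  define \<phi> where "\<phi> = (\<lambda>w. v \<bullet> prox lbar f w)"
  have lip: "(norm v)-lipschitz_on UNIV \<phi>"
  proof (rule lipschitz_onI)
    fix y z
    have "\<bar>\<phi> y - \<phi> z\<bar> \<le> norm v * norm (prox lbar f y - prox lbar f z)"
      unfolding \<phi>_def inner_diff_right[symmetric] by (rule Cauchy_Schwarz_ineq2)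
    also have "\<dots> \<le> norm v * norm (y - z)"
      by (intro mult_left_mono prox_nonexpansive f lb) auto
    finally show "dist (\<phi> y) (\<phi> z) \<le> norm v * dist y z" by (simp add: dist_norm)
  qed auto
  define W where "W = (\<lambda>m. P m + lbar *\<^sub>R V m)"
  show ?thesis
  proof (rule that[of C], intro allI impI)
    fix l D \<tau> :: real
    assume t0: "0 < \<bar>l - lbar\<bar>" and tl: "\<bar>l - lbar\<bar> < lbar / 2"
      and der: "((\<lambda>m. rval f (prox m f x)) has_real_derivative D) (at l)" and \<tau>: "\<bar>\<tau>\<bar> = 1"
    define t where "t = \<bar>l - lbar\<bar>"
    have t: "0 < t" "t < lbar / 2" using t0 tl by (auto simp: t_def)
    have "(h has_derivative (\<lambda>y. D * y)) (at l)"
      using der by (simp add: has_field_derivative_def h_def P_def)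
    then obtain d where d: "d > 0" "\<And>m. \<bar>m - l\<bar> < d \<Longrightarrow> \<bar>h m - h l - D * (m - l)\<bar> \<le> t * \<bar>m - l\<bar>"
      using t(1) unfolding has_derivative_at_alt by (metis real_norm_def)
    \<comment> \<open>the step \<open>r\<close> is small enough for the derivative estimate, keeps \<open>m\<close> in range, and its last bound keeps
      the point \<open>w\<close> found below within \<open>t\<^sup>2\<close> of \<open>W l\<close>\<close>
    define r where "r = Min {d / 2, t, (lbar / 2 - t) / 2, t\<^sup>2 / (2 * (norm v + 1))}"
    have nv: "norm v + 1 > 0" by (simp add: add_nonneg_pos)
    have r: "0 < r" "r \<le> d / 2" "r \<le> t" "r \<le> (lbar / 2 - t) / 2" "r \<le> t\<^sup>2 / (2 * (norm v + 1))"
    proof -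
      show "0 < r" using d(1) t nv by (simp add: r_def)
      show "r \<le> d / 2" "r \<le> t" "r \<le> (lbar / 2 - t) / 2" "r \<le> t\<^sup>2 / (2 * (norm v + 1))"
        unfolding r_def by (rule Min_le; simp)+
    qed
    define m where "m = l - \<tau> * r"
    have \<tau>\<tau>: "\<tau> = 1 \<or> \<tau> = -1" using \<tau> by auto
    have ml: "\<bar>m - l\<bar> = r" using r \<tau>\<tau> by (auto simp: m_def)
    have mb: "\<bar>m - lbar\<bar> \<le> t + r" using ml unfolding t_def by linarith
    have mI: "\<bar>m - lbar\<bar> < lbar / 2"
      using mb r(1,4) t by (simp add: field_simps)
    have posm: "m > 0" "l > 0" using mI tl by linarith+
    have lbI: "\<bar>lbar - lbar\<bar> < lbar / 2" using lb by simp
    \<comment> \<open>difference quotient of \<open>h\<close> versus that of \<open>\<phi>\<close>\<close>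
    have e1: "- \<tau> * D * r \<le> h m - h l + t * r"
      using d(2)[of m] ml r(1,2) d(1) \<tau>\<tau> by (auto simp: m_def abs_le_iff algebra_simps)
    have e2: "h m - h l \<le> V l \<bullet> (P m - P l) + B * r\<^sup>2"
      using hB[OF tl mI] ml by simp
    have e3: "V l \<bullet> (P m - P l) \<le> v \<bullet> (P m - P l) + B\<^sup>2 * t * r"
    proof -
      have "(V l - v) \<bullet> (P m - P l) \<le> norm (V l - v) * norm (P m - P l)"
        by (rule norm_cauchy_schwarz)
      also have "\<dots> \<le> (B * t) * (B * r)"
        using VB[OF lbI tl] PB[OF tl mI] ml B t by (intro mult_mono) (auto simp: t_def v_def V_def)
      finally show ?thesis by (simp add: inner_diff_left power2_eq_square mult_ac)
    qed
    have QW: "prox lbar f (W k) = P k" if "k > 0" for k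
      unfolding W_def P_def V_def by (intro prox_add_subgradient f lb prox_slope_subdiff that)
    have e4: "v \<bullet> (P m - P l) = \<phi> (W m) - \<phi> (W l)"
      by (simp add: \<phi>_def QW posm inner_diff_right)
    have "W m - (W l + r *\<^sub>R (\<tau> *\<^sub>R v)) = (lbar - m) *\<^sub>R (V m - V l) + (l - m) *\<^sub>R (V l - v)"
    proof -
      have "P m = x - m *\<^sub>R V m" "P l = x - l *\<^sub>R V l"
        using prox_add_slope[OF posm(1), of f x] prox_add_slope[OF posm(2), of f x]
        unfolding P_def V_def by (metis add_diff_cancel_right')+
      then show ?thesis by (simp add: W_def m_def algebra_simps)
    qed
    then have "norm (W m - (W l + r *\<^sub>R (\<tau> *\<^sub>R v))) \<le> \<bar>lbar - m\<bar> * norm (V m - V l) + \<bar>l - m\<bar> * norm (V l - v)"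
      by (metis norm_scaleR norm_triangle_ineq)
    also have "\<dots> \<le> (2 * t) * (B * r) + r * (B * t)"
      using VB[OF lbI tl] VB[OF tl mI] ml mb r B t
      by (intro add_mono mult_mono) (auto simp: t_def v_def V_def abs_minus_commute)
    finally have e5: "norm (W m - (W l + r *\<^sub>R (\<tau> *\<^sub>R v))) \<le> 3 * B * t * r"
      by (simp add: algebra_simps)
    have "\<phi> (W m) - \<phi> (W l + r *\<^sub>R (\<tau> *\<^sub>R v)) \<le> norm v * norm (W m - (W l + r *\<^sub>R (\<tau> *\<^sub>R v)))"
      using lipschitz_onD[OF lip, of "W m" "W l + r *\<^sub>R (\<tau> *\<^sub>R v)"] by (simp add: dist_norm)
    also have "\<dots> \<le> norm v * (3 * B * t * r)" by (intro mult_left_mono e5) auto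
    finally have e6: "\<phi> (W m) \<le> \<phi> (W l + r *\<^sub>R (\<tau> *\<^sub>R v)) + norm v * (3 * B * t * r)" by simp
    have "t\<^sup>2 / 2 > 0" using t by simp
    from proximal_mean_value[OF lip r(1) t(1) this, of "W l" "\<tau> *\<^sub>R v"]
    obtain w s K where w: "norm (w - W l) \<le> r * norm (\<tau> *\<^sub>R v) + t\<^sup>2 / 2"
      and s: "norm s \<le> 2 * norm v"
      and prx: "\<And>w'. \<phi> w + s \<bullet> (w' - w) - K * (norm (w' - w))\<^sup>2 \<le> \<phi> w'"
      and mv: "(\<phi> (W l + r *\<^sub>R (\<tau> *\<^sub>R v)) - \<phi> (W l)) / r \<le> s \<bullet> (\<tau> *\<^sub>R v) + t"
      by metis
    have "\<phi> (W l + r *\<^sub>R (\<tau> *\<^sub>R v)) - \<phi> (W l) \<le> (\<tau> * (s \<bullet> v) + t) * r"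
      using mv r(1) by (simp add: field_simps)
    moreover have "B * r\<^sup>2 \<le> B * t * r"
      using B r by (simp add: power2_eq_square)
    ultimately have "- \<tau> * D * r \<le> (\<tau> * (s \<bullet> v) + C * t) * r"
      using e1 e2 e3 e4 e6 by (simp add: C_def algebra_simps)
    then have fin: "- \<tau> * D \<le> \<tau> * (s \<bullet> v) + C * t"
      using r(1) by (rule mult_right_le_imp_le)
    have "r * norm v \<le> t\<^sup>2 / (2 * (norm v + 1)) * (norm v + 1)"
      using r(1,5) by (intro mult_mono) auto
    also have "\<dots> = t\<^sup>2 / 2"
    proof -
      have "t\<^sup>2 / (2 * n) * n = t\<^sup>2 / 2" if "n \<noteq> 0" for n :: real using that by simp
      then show ?thesis by this (use nv in simp)
    qed
    finally have "norm (w - W l) \<le> t\<^sup>2" using w \<tau> by simp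
    moreover have "(s - v, lbar *\<^sub>R s) \<in> regular_normal_cone (gph (subdiff f)) (prox lbar f w, prox_slope lbar f w)"
      by (rule regular_normal_if_proximal_subgradient[OF f lb, of v w s K]) (use prx in \<open>simp add: \<phi>_def\<close>)
    ultimately show "\<exists>w s. norm (w - (prox l f x + lbar *\<^sub>R prox_slope l f x)) \<le> \<bar>l - lbar\<bar>\<^sup>2 \<and>
        norm s \<le> 2 * norm (prox_slope lbar f x) \<and>
        (s - prox_slope lbar f x, lbar *\<^sub>R s) \<in>
          regular_normal_cone (gph (subdiff f)) (prox lbar f w, prox_slope lbar f w) \<and>
        - \<tau> * D \<le> \<tau> * (s \<bullet> prox_slope lbar f x) + C * \<bar>l - lbar\<bar>"
      using s fin unfolding v_def W_def P_def V_def t_def by blast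
  qed
qed

section \<open>One-sided limits of the derivatives\<close>

text \<open>Proto-differentiability realizes both tangent directions along one sequence of step sizes,
  so monotonicity of the subdifferential passes to the tangent cone.\<close>

lemma tangent_cone_subdiff_monotone:
  fixes f :: "'a::euclidean_space \<Rightarrow> ereal"
  assumes f: "f \<in> Gamma0" and pd: "proto_differentiable_at (subdiff f) (p, v)"
    and z: "(w, z) \<in> tangent_cone (gph (subdiff f)) (p, v)"
    and z': "(w', z') \<in> tangent_cone (gph (subdiff f)) (p, v)"
  shows "0 \<le> (z - z') \<bullet> (w - w')"
proof -
  define t :: "nat \<Rightarrow> real" where "t = (\<lambda>k. inverse (real (Suc k)))"
  have t0: "t k > 0" for k by (simp add: t_def)
  have t: "pos_null t"
    using LIMSEQ_inverse_real_of_nat by (simp add: pos_null_def t_def)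
  have pdD: "\<exists>ws zs. ws \<longlonglongrightarrow> w \<and> zs \<longlonglongrightarrow> z \<and> (\<forall>k. v + t k *\<^sub>R zs k \<in> subdiff f (p + t k *\<^sub>R ws k))"
    if tc: "(w, z) \<in> tangent_cone (gph (subdiff f)) (p, v)" for w z
  proof -
    have "\<forall>(w, z)\<in>tangent_cone (gph (subdiff f)) (p, v). \<forall>t. pos_null t \<longrightarrow>
        (\<exists>ws zs. ws \<longlonglongrightarrow> w \<and> zs \<longlonglongrightarrow> z \<and>
           (\<forall>k. zs k \<in> (\<lambda>y. (y - v) /\<^sub>R t k) ` subdiff f (p + t k *\<^sub>R ws k)))"
      using pd by (simp add: proto_differentiable_at_def)
    from bspec[OF this tc] t obtain ws zs where ws: "ws \<longlonglongrightarrow> w" "zs \<longlonglongrightarrow> z"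
      "\<forall>k. zs k \<in> (\<lambda>y. (y - v) /\<^sub>R t k) ` subdiff f (p + t k *\<^sub>R ws k)" by auto
    have "v + t k *\<^sub>R zs k \<in> subdiff f (p + t k *\<^sub>R ws k)" for k
    proof -
      obtain y where y: "y \<in> subdiff f (p + t k *\<^sub>R ws k)" "zs k = (y - v) /\<^sub>R t k"
        using ws(3) by blast
      then have "v + t k *\<^sub>R zs k = y" using t0[of k] by simp
      then show ?thesis using y by simp
    qed
    then show ?thesis using ws by blast
  qed
  obtain ws zs where 1: "ws \<longlonglongrightarrow> w" "zs \<longlonglongrightarrow> z" "\<And>k. v + t k *\<^sub>R zs k \<in> subdiff f (p + t k *\<^sub>R ws k)"
    using pdD[OF z] by blast
  obtain ws' zs' where 2: "ws' \<longlonglongrightarrow> w'" "zs' \<longlonglongrightarrow> z'" "\<And>k. v + t k *\<^sub>R zs' k \<in> subdiff f (p + t k *\<^sub>R ws' k)"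
    using pdD[OF z'] by blast
  have "0 \<le> (zs k - zs' k) \<bullet> (ws k - ws' k)" for k
  proof -
    have "0 \<le> ((v + t k *\<^sub>R zs k) - (v + t k *\<^sub>R zs' k)) \<bullet> ((p + t k *\<^sub>R ws k) - (p + t k *\<^sub>R ws' k))"
      by (intro subdiff_monotone[OF f] 1 2)
    also have "\<dots> = t k * t k * ((zs k - zs' k) \<bullet> (ws k - ws' k))"
      by (simp add: scaleR_diff_right[symmetric])
    finally have "0 \<le> t k * t k * ((zs k - zs' k) \<bullet> (ws k - ws' k))" .
    moreover have "0 < t k * t k" using t0[of k] by simp
    ultimately show ?thesis by (metis mult_le_0_iff not_le order_less_imp_le zero_le_mult_iff)
  qed
  moreover have "(\<lambda>k. (zs k - zs' k) \<bullet> (ws k - ws' k)) \<longlonglongrightarrow> (z - z') \<bullet> (w - w')"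
    by (intro tendsto_intros 1 2)
  ultimately show ?thesis by (intro LIMSEQ_le_const) auto
qed

lemma tangent_cone_subdiff_unique:
  fixes f :: "'a::euclidean_space \<Rightarrow> ereal"
  assumes f: "f \<in> Gamma0" and l: "0 < l" and pd: "proto_differentiable_at (subdiff f) (p, v)"
    and z: "z \<in> tangent_cone (gph (subdiff f)) (p, v)" "z' \<in> tangent_cone (gph (subdiff f)) (p, v)"
    and eq: "fst z + l *\<^sub>R snd z = fst z' + l *\<^sub>R snd z'"
  shows "z = z'"
proof -
  define d where "d = snd z - snd z'"
  have "0 \<le> d \<bullet> (fst z - fst z')"
    unfolding d_def by (rule tangent_cone_subdiff_monotone[OF f pd]) (use z in simp_all)
  moreover have *: "fst z - fst z' = - l *\<^sub>R d" using eq by (simp add: d_def algebra_simps)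
  ultimately have "l * (d \<bullet> d) \<le> 0" by simp
  then have "d \<bullet> d \<le> 0" using l by (simp add: mult_le_0_iff)
  then have "d = 0" by (metis inner_ge_zero inner_eq_zero_iff order_antisym)
  then show ?thesis using * by (simp add: prod_eq_iff d_def)
qed

text \<open>The difference quotients of the proximal curve are bounded, their limit points are tangent
  directions \<open>(q, w)\<close> with \<open>q + lbar w = - \<sigma> vbar\<close>, where \<open>vbar = prox_slope lbar f x\<close>, and there
  is only one such direction.\<close>

lemma prox_curve_one_sided_derivative:
  fixes f :: "'a::euclidean_space \<Rightarrow> ereal"
  assumes f: "f \<in> Gamma0" and lb: "0 < lbar" and \<sigma>: "\<bar>\<sigma>\<bar> = 1"
    and pd: "proto_differentiable_at (subdiff f) (prox lbar f x, prox_slope lbar f x)"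
  obtains q w where "q + lbar *\<^sub>R w = - \<sigma> *\<^sub>R prox_slope lbar f x"
    "\<forall>t. pos_null t \<longrightarrow> (\<forall>k. t k < lbar / 2) \<longrightarrow>
      (\<lambda>k. (1 / t k) *\<^sub>R ((prox (lbar + \<sigma> * t k) f x, prox_slope (lbar + \<sigma> * t k) f x)
          - (prox lbar f x, prox_slope lbar f x))) \<longlonglongrightarrow> (q, w)"
proof -
  define P where "P = (\<lambda>m. prox m f x)"
  define V where "V = (\<lambda>m. prox_slope m f x)"
  define a where "a = (P lbar, V lbar)"
  define G where "G = gph (subdiff f)"
  define R where "R = (\<lambda>t. (1 / t) *\<^sub>R ((P (lbar + \<sigma> * t), V (lbar + \<sigma> * t)) - a))"
  have \<sigma>': "\<sigma> = 1 \<or> \<sigma> = -1" using \<sigma> by auto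
  obtain B where B: "0 < B"
    and VB: "\<And>l m. \<bar>l - lbar\<bar> < lbar / 2 \<Longrightarrow> \<bar>m - lbar\<bar> < lbar / 2 \<Longrightarrow>
       norm (V m - V l) \<le> B * \<bar>m - l\<bar>"
    and PB: "\<And>l m. \<bar>l - lbar\<bar> < lbar / 2 \<Longrightarrow> \<bar>m - lbar\<bar> < lbar / 2 \<Longrightarrow>
       norm (P m - P l) \<le> B * \<bar>m - l\<bar>"
    unfolding P_def V_def using prox_curve_bounds[OF f lb, of x] by metis
  have lbI: "\<bar>lbar - lbar\<bar> < lbar / 2" using lb by simp
  have inI: "\<bar>(lbar + \<sigma> * t) - lbar\<bar> < lbar / 2" "lbar + \<sigma> * t > 0" if "0 < t" "t < lbar / 2" for t
    using that \<sigma>' by auto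
  have VL: "norm (V (lbar + \<sigma> * t) - V lbar) \<le> B * t" if "0 < t" "t < lbar / 2" for t
    using VB[OF lbI inI(1)[OF that]] that \<sigma> by (simp add: abs_mult)
  have PL: "norm (P (lbar + \<sigma> * t) - P lbar) \<le> B * t" if "0 < t" "t < lbar / 2" for t
    using PB[OF lbI inI(1)[OF that]] that \<sigma> by (simp add: abs_mult)
  have Rbd: "norm (R t) \<le> 2 * B" if t: "0 < t" "t < lbar / 2" for t
  proof -
    have "norm ((P (lbar + \<sigma> * t), V (lbar + \<sigma> * t)) - a) \<le> B * t + B * t"
      unfolding a_def using norm_Pair_le[of "P (lbar + \<sigma> * t) - P lbar" "V (lbar + \<sigma> * t) - V lbar"] PL[OF t] VL[OF t] by simp
    then have "(1 / t) * norm ((P (lbar + \<sigma> * t), V (lbar + \<sigma> * t)) - a) \<le> (1 / t) * (B * t + B * t)"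
      using t by (intro mult_left_mono) auto
    also have "\<dots> = 2 * B" using t by simp
    finally show ?thesis using t unfolding R_def norm_scaleR by simp
  qed
  have RG: "a + t *\<^sub>R R t \<in> G" if t: "0 < t" "t < lbar / 2" for t
    using prox_slope_subdiff[OF f inI(2)[OF t], of x] t
    by (simp add: R_def G_def gph_def P_def V_def)
  have Req: "fst (R t) + lbar *\<^sub>R snd (R t) = - \<sigma> *\<^sub>R V (lbar + \<sigma> * t)" if t: "0 < t" "t < lbar / 2" for t
  proof -
    have "P (lbar + \<sigma> * t) = x - (lbar + \<sigma> * t) *\<^sub>R V (lbar + \<sigma> * t)" "P lbar = x - lbar *\<^sub>R V lbar"
      using prox_add_slope[OF lb, of f x] prox_add_slope[OF inI(2)[OF t], of f x]
      unfolding P_def V_def by (metis add_diff_cancel_right')+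
    then have "(P (lbar + \<sigma> * t) - P lbar) + lbar *\<^sub>R (V (lbar + \<sigma> * t) - V lbar) = t *\<^sub>R (- \<sigma> *\<^sub>R V (lbar + \<sigma> * t))"
      by (simp add: algebra_simps)
    then have "(1 / t) *\<^sub>R ((P (lbar + \<sigma> * t) - P lbar) + lbar *\<^sub>R (V (lbar + \<sigma> * t) - V lbar)) = - \<sigma> *\<^sub>R V (lbar + \<sigma> * t)"
      using t by simp
    then show ?thesis by (simp add: R_def a_def scaleR_add_right mult.commute)
  qed
  have lim: "z \<in> tangent_cone G a \<and> fst z + lbar *\<^sub>R snd z = - \<sigma> *\<^sub>R V lbar"
    if t: "pos_null t" "\<And>k. t k < lbar / 2" and z: "(\<lambda>k. R (t k)) \<longlonglongrightarrow> z" for t z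
  proof
    have t0: "t k > 0" for k using t(1) by (simp add: pos_null_def)
    show "z \<in> tangent_cone G a"
      unfolding tangent_cone_def using t z RG t0 by blast
    have tl: "t \<longlonglongrightarrow> 0" using t(1) by (simp add: pos_null_def)
    have "(\<lambda>k. V (lbar + \<sigma> * t k) - V lbar) \<longlonglongrightarrow> 0"
    proof (rule Lim_null_comparison)
      show "\<forall>\<^sub>F k in sequentially. norm (V (lbar + \<sigma> * t k) - V lbar) \<le> B * t k"
        using VL t0 t(2) by simp
      show "(\<lambda>k. B * t k) \<longlonglongrightarrow> 0" using tendsto_mult_right_zero[OF tl] .
    qed
    then have "(\<lambda>k. V (lbar + \<sigma> * t k)) \<longlonglongrightarrow> V lbar" by (simp add: LIM_zero_iff)
    then have "(\<lambda>k. - \<sigma> *\<^sub>R V (lbar + \<sigma> * t k)) \<longlonglongrightarrow> - \<sigma> *\<^sub>R V lbar"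
      by (intro tendsto_intros)
    moreover have "(\<lambda>k. fst (R (t k)) + lbar *\<^sub>R snd (R (t k))) \<longlonglongrightarrow> fst z + lbar *\<^sub>R snd z"
      by (intro tendsto_intros z)
    ultimately show "fst z + lbar *\<^sub>R snd z = - \<sigma> *\<^sub>R V lbar"
      using Req t0 t(2) by (simp add: LIMSEQ_unique)
  qed
  have sub: "pos_null (t \<circ> r)" if "pos_null t" "strict_mono (r::nat \<Rightarrow> nat)" for t r
    using that by (auto simp: pos_null_def intro: LIMSEQ_subseq_LIMSEQ)
  have bdR: "bounded (range (\<lambda>k. R (t k)))" if t: "pos_null t" "\<And>k. t k < lbar / 2" for t
    using Rbd t by (intro boundedI[of _ "2 * B"]) (auto simp: pos_null_def)
  define t0 where "t0 = (\<lambda>k. lbar / 3 * inverse (real (Suc k)))"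
  have t0: "pos_null t0" "t0 k < lbar / 2" for k
  proof -
    have "t0 \<longlonglongrightarrow> lbar / 3 * 0"
      unfolding t0_def by (intro tendsto_intros LIMSEQ_inverse_real_of_nat)
    then show "pos_null t0" using lb by (simp add: pos_null_def t0_def)
    have "t0 k \<le> lbar / 3 * 1"
      unfolding t0_def using lb by (intro mult_left_mono) (auto simp: field_simps)
    then show "t0 k < lbar / 2" using lb by simp
  qed
  obtain z r where z: "strict_mono (r::nat \<Rightarrow> nat)" "((\<lambda>k. R (t0 k)) \<circ> r) \<longlonglongrightarrow> z"
    using bounded_imp_convergent_subsequence[OF bdR[OF t0]] by blast
  have z_prop: "z \<in> tangent_cone G a \<and> fst z + lbar *\<^sub>R snd z = - \<sigma> *\<^sub>R V lbar"
    using z(2) t0(2) by (intro lim[OF sub[OF t0(1) z(1)]]) (simp_all add: o_def)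
  show ?thesis
  proof (rule that[of "fst z" "snd z"])
    show "fst z + lbar *\<^sub>R snd z = - \<sigma> *\<^sub>R prox_slope lbar f x"
      using z_prop by (simp add: V_def)
    have "(\<lambda>k. R (t k)) \<longlonglongrightarrow> z" if t: "pos_null t" "\<And>k. t k < lbar / 2" for t
    proof (rule tendsto_if_subsequential_limits[of "\<lambda>k. R (t k)" "\<lambda>z. z"])
      show "bounded (range (\<lambda>k. R (t k)))" by (rule bdR[OF t])
      fix r :: "nat \<Rightarrow> nat" and l assume r: "strict_mono r" "((\<lambda>k. R (t k)) \<circ> r) \<longlonglongrightarrow> l"
      have "l \<in> tangent_cone G a \<and> fst l + lbar *\<^sub>R snd l = - \<sigma> *\<^sub>R V lbar"
        using r(2) t(2) by (intro lim[OF sub[OF t(1) r(1)]]) (simp_all add: o_def)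
      with z_prop show "l = z"
        by (intro tangent_cone_subdiff_unique[OF f lb pd]) (auto simp: G_def a_def P_def V_def)
    qed auto
    then show "\<forall>t. pos_null t \<longrightarrow> (\<forall>k. t k < lbar / 2) \<longrightarrow>
        (\<lambda>k. (1 / t k) *\<^sub>R ((prox (lbar + \<sigma> * t k) f x, prox_slope (lbar + \<sigma> * t k) f x)
          - (prox lbar f x, prox_slope lbar f x))) \<longlonglongrightarrow> (fst z, snd z)"
      by (simp add: R_def P_def V_def a_def)
  qed
qed

text \<open>The limit is \<open>\<sigma> (vbar \<bullet> q)\<close>, with \<open>vbar = prox_slope lbar f x\<close> and \<open>(q, w)\<close> the one-sided
  derivative of the proximal curve. The regular normals \<open>(s - vbar, lbar s)\<close> that control the
  derivatives accumulate at directional normals in direction \<open>(q, w)\<close>. Since these are orthogonal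
  to \<open>(q, w)\<close>, every limit \<open>s\<close> satisfies \<open>s \<bullet> (q + lbar w) = vbar \<bullet> q\<close>, which determines \<open>s \<bullet>
  vbar\<close>.\<close>

lemma one_sided_limit_of_derivatives:
  fixes f :: "'a::euclidean_space \<Rightarrow> ereal"
  assumes f: "f \<in> Gamma0" and lb: "0 < lbar" and \<sigma>: "\<bar>\<sigma>\<bar> = 1"
    and pd: "proto_differentiable_at (subdiff f) (prox lbar f x, prox_slope lbar f x)"
    and ss: "semismooth_star_at (subdiff f) (prox lbar f x, prox_slope lbar f x)"
  obtains L where "\<forall>\<epsilon>>0. \<exists>\<delta>>0. \<forall>l D. 0 < \<sigma> * (l - lbar) \<and> \<sigma> * (l - lbar) < \<delta> \<and>
      ((\<lambda>m. rval f (prox m f x)) has_real_derivative D) (at l) \<longrightarrow> \<bar>D - L\<bar> \<le> \<epsilon>"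
proof -
  define v where "v = prox_slope lbar f x"
  define p where "p = prox lbar f x"
  define G where "G = gph (subdiff f)"
  have \<sigma>': "\<sigma> = 1 \<or> \<sigma> = -1" using \<sigma> by auto
  then have \<sigma>\<sigma>: "\<sigma> * \<sigma> = 1" by auto
  obtain q w where qw: "q + lbar *\<^sub>R w = - \<sigma> *\<^sub>R v"
    and R: "\<forall>t. pos_null t \<longrightarrow> (\<forall>k. t k < lbar / 2) \<longrightarrow>
      (\<lambda>k. (1 / t k) *\<^sub>R ((prox (lbar + \<sigma> * t k) f x, prox_slope (lbar + \<sigma> * t k) f x) - (p, v))) \<longlonglongrightarrow> (q, w)"
    using prox_curve_one_sided_derivative[OF f lb \<sigma> pd] unfolding v_def p_def by blast
  obtain C where C: "\<forall>l D \<tau>. 0 < \<bar>l - lbar\<bar> \<longrightarrow> \<bar>l - lbar\<bar> < lbar / 2 \<longrightarrow>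
      ((\<lambda>m. rval f (prox m f x)) has_real_derivative D) (at l) \<longrightarrow> \<bar>\<tau>\<bar> = 1 \<longrightarrow>
      (\<exists>w s. norm (w - (prox l f x + lbar *\<^sub>R prox_slope l f x)) \<le> \<bar>l - lbar\<bar>\<^sup>2 \<and>
        norm s \<le> 2 * norm v \<and>
        (s - v, lbar *\<^sub>R s) \<in> regular_normal_cone G (prox lbar f w, prox_slope lbar f w) \<and>
        - \<tau> * D \<le> \<tau> * (s \<bullet> v) + C * \<bar>l - lbar\<bar>)"
    using derivative_bound_by_regular_normal[OF f lb, of x] unfolding v_def G_def by blast
  have key: "(\<lambda>k. s k \<bullet> v) \<longlonglongrightarrow> - \<sigma> * (v \<bullet> q)"
    if t: "pos_null t" "\<And>k. t k < lbar / 2"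
      and y: "\<And>k. norm (y k - (prox (lbar + \<sigma> * t k) f x + lbar *\<^sub>R prox_slope (lbar + \<sigma> * t k) f x)) \<le> (t k)\<^sup>2"
      and sb: "\<And>k. norm (s k) \<le> 2 * norm v"
      and s: "\<And>k. (s k - v, lbar *\<^sub>R s k) \<in> regular_normal_cone G (prox lbar f (y k), prox_slope lbar f (y k))"
    for t s y
  proof -
    have t0: "t k > 0" for k using t(1) by (simp add: pos_null_def)
    have tl: "t \<longlonglongrightarrow> 0" using t(1) by (simp add: pos_null_def)
    define P where "P = (\<lambda>k. prox (lbar + \<sigma> * t k) f x)"
    define V where "V = (\<lambda>k. prox_slope (lbar + \<sigma> * t k) f x)"
    \<comment> \<open>moving the base point by at most \<open>(t k)\<^sup>2\<close> does not change the direction of approach\<close>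
    define us where "us = (\<lambda>k. (1 / t k) *\<^sub>R ((prox lbar f (y k), prox_slope lbar f (y k)) - (p, v)))"
    have us_R: "norm (us k - (1 / t k) *\<^sub>R ((P k, V k) - (p, v))) \<le> t k * (1 + 2 / lbar)" for k
    proof -
      have pos: "lbar + \<sigma> * t k > 0" using \<sigma>' t0[of k] t(2)[of k] lb by auto
      have vk: "V k \<in> subdiff f (P k)" unfolding V_def P_def by (rule prox_slope_subdiff[OF f pos])
      have 1: "prox lbar f (P k + lbar *\<^sub>R V k) = P k" by (rule prox_add_subgradient[OF f lb vk])
      then have 2: "prox_slope lbar f (P k + lbar *\<^sub>R V k) = V k" unfolding prox_slope_def using lb by simp
      define \<Delta> where "\<Delta> = y k - (P k + lbar *\<^sub>R V k)"
      have \<Delta>: "norm \<Delta> \<le> (t k)\<^sup>2" using y[of k] by (simp add: \<Delta>_def P_def V_def)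
      have d1: "norm (prox lbar f (y k) - P k) \<le> (t k)\<^sup>2"
        using prox_nonexpansive[OF f lb, of "y k" "P k + lbar *\<^sub>R V k"] \<Delta> unfolding 1 \<Delta>_def by linarith
      have "prox_slope lbar f (y k) - V k = (1 / lbar) *\<^sub>R (\<Delta> - (prox lbar f (y k) - P k))"
        unfolding \<Delta>_def prox_slope_def using lb by (simp add: algebra_simps)
      then have "norm (prox_slope lbar f (y k) - V k) = (1 / lbar) * norm (\<Delta> - (prox lbar f (y k) - P k))"
        using lb by simp
      also have "\<dots> \<le> (1 / lbar) * ((t k)\<^sup>2 + (t k)\<^sup>2)"
        using lb norm_triangle_ineq4[of \<Delta> "prox lbar f (y k) - P k"] \<Delta> d1 by (intro mult_left_mono) auto
      finally have d2: "norm (prox_slope lbar f (y k) - V k) \<le> (1 / lbar) * (2 * (t k)\<^sup>2)" by simp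
      have "us k - (1 / t k) *\<^sub>R ((P k, V k) - (p, v)) = (1 / t k) *\<^sub>R (prox lbar f (y k) - P k, prox_slope lbar f (y k) - V k)"
        by (simp add: us_def algebra_simps)
      then have "norm (us k - (1 / t k) *\<^sub>R ((P k, V k) - (p, v))) = (1 / t k) * norm (prox lbar f (y k) - P k, prox_slope lbar f (y k) - V k)"
        using t0[of k] by (simp only: norm_scaleR) simp
      also have "\<dots> \<le> (1 / t k) * ((t k)\<^sup>2 + (1 / lbar) * (2 * (t k)\<^sup>2))"
        using norm_Pair_le[of "prox lbar f (y k) - P k" "prox_slope lbar f (y k) - V k"] d1 d2 t0[of k]
        by (intro mult_left_mono) auto
      also have "\<dots> = t k * (1 + 2 / lbar)" using t0[of k] lb by (simp add: field_simps power2_eq_square)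
      finally show ?thesis .
    qed
    have "(\<lambda>k. us k - (1 / t k) *\<^sub>R ((P k, V k) - (p, v))) \<longlonglongrightarrow> 0"
    proof (rule Lim_null_comparison)
      show "\<forall>\<^sub>F k in sequentially. norm (us k - (1 / t k) *\<^sub>R ((P k, V k) - (p, v))) \<le> t k * (1 + 2 / lbar)"
        using us_R by simp
      show "(\<lambda>k. t k * (1 + 2 / lbar)) \<longlonglongrightarrow> 0" by (rule tendsto_mult_left_zero[OF tl])
    qed
    from tendsto_add[OF this R[rule_format, OF t]] have us: "us \<longlonglongrightarrow> (q, w)"
      by (simp add: P_def V_def)
    show ?thesis
    proof (rule tendsto_if_subsequential_limits[of s "\<lambda>s. s \<bullet> v"])
      show "bounded (range s)" using sb by (intro boundedI[of _ "2 * norm v"]) auto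
      show "continuous_on UNIV (\<lambda>s. s \<bullet> v)" by (intro continuous_intros)
      fix r :: "nat \<Rightarrow> nat" and l assume r: "strict_mono r" "(s \<circ> r) \<longlonglongrightarrow> l"
      have "(l - v, lbar *\<^sub>R l) \<in> directional_normal_cone G (p, v) (q, w)"
        unfolding directional_normal_cone_def mem_Collect_eq
      proof (intro exI conjI allI)
        show "pos_null (t \<circ> r)" using t r(1) by (auto simp: pos_null_def intro: LIMSEQ_subseq_LIMSEQ)
        show "(us \<circ> r) \<longlonglongrightarrow> (q, w)" using us r(1) by (rule LIMSEQ_subseq_LIMSEQ)
        have sr: "(\<lambda>k. s (r k)) \<longlonglongrightarrow> l" using r(2) by (simp add: o_def)
        show "(\<lambda>k. (s (r k) - v, lbar *\<^sub>R s (r k))) \<longlonglongrightarrow> (l - v, lbar *\<^sub>R l)"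
          by (intro tendsto_intros sr)
        fix k
        have "(p, v) + (t \<circ> r) k *\<^sub>R (us \<circ> r) k = (prox lbar f (y (r k)), prox_slope lbar f (y (r k)))"
          using t0[of "r k"] by (simp add: us_def)
        then show "(s (r k) - v, lbar *\<^sub>R s (r k)) \<in> regular_normal_cone G ((p, v) + (t \<circ> r) k *\<^sub>R (us \<circ> r) k)"
          using s[of "r k"] by simp
      qed
      then have "(l - v, lbar *\<^sub>R l) \<bullet> (q, w) = 0"
        using ss unfolding semismooth_star_at_def G_def p_def v_def by blast
      then have "l \<bullet> (q + lbar *\<^sub>R w) = v \<bullet> q"
        by (simp add: inner_add_right inner_diff_left)
      then have "- \<sigma> * (l \<bullet> v) = v \<bullet> q" unfolding qw by simp
      then show "l \<bullet> v = - \<sigma> * (v \<bullet> q)" using \<sigma>' by auto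
    qed
  qed
  define L where "L = \<sigma> * (v \<bullet> q)"
  have "\<exists>\<delta>>0. \<forall>l D. 0 < \<sigma> * (l - lbar) \<and> \<sigma> * (l - lbar) < \<delta> \<and>
      ((\<lambda>m. rval f (prox m f x)) has_real_derivative D) (at l) \<longrightarrow> \<bar>D - L\<bar> \<le> \<epsilon>" if \<epsilon>: "0 < \<epsilon>" for \<epsilon>
  proof (rule ccontr)
    assume neg: "\<not> ?thesis"
    define t0 where "t0 = (\<lambda>k. lbar / 2 * inverse (real (Suc k)))"
    have t0_lim: "t0 \<longlonglongrightarrow> 0"
    proof -
      have "t0 \<longlonglongrightarrow> lbar / 2 * 0"
        unfolding t0_def by (intro tendsto_intros LIMSEQ_inverse_real_of_nat)
      then show ?thesis by simp
    qed
    have t0p: "t0 k > 0" "t0 k \<le> lbar / 2" for k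
    proof -
      show "t0 k > 0" using lb by (simp add: t0_def)
      have "t0 k \<le> lbar / 2 * 1"
        unfolding t0_def using lb by (intro mult_left_mono) (auto simp: field_simps)
      then show "t0 k \<le> lbar / 2" by simp
    qed
    have "\<forall>k. \<exists>l D. 0 < \<sigma> * (l - lbar) \<and> \<sigma> * (l - lbar) < t0 k \<and>
      ((\<lambda>m. rval f (prox m f x)) has_real_derivative D) (at l) \<and> \<not> \<bar>D - L\<bar> \<le> \<epsilon>"
      using neg t0p(1) by blast
    then obtain l D where lD: "\<And>k. 0 < \<sigma> * (l k - lbar)" "\<And>k. \<sigma> * (l k - lbar) < t0 k"
      "\<And>k. ((\<lambda>m. rval f (prox m f x)) has_real_derivative D k) (at (l k))" "\<And>k. \<not> \<bar>D k - L\<bar> \<le> \<epsilon>"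
      by metis
    define t where "t = (\<lambda>k. \<sigma> * (l k - lbar))"
    have t0': "t k > 0" for k using lD by (simp add: t_def)
    have tl: "t \<longlonglongrightarrow> 0"
    proof (rule tendsto_sandwich[OF _ _ tendsto_const t0_lim])
      show "\<forall>\<^sub>F k in sequentially. 0 \<le> t k" using t0' by (simp add: less_imp_le)
      show "\<forall>\<^sub>F k in sequentially. t k \<le> t0 k" using lD(2) by (simp add: t_def less_imp_le)
    qed
    have t: "pos_null t" "t k < lbar / 2" for k
      using tl t0' lD(2)[of k] t0p(2)[of k] by (auto simp: pos_null_def t_def)
    have lt: "l k = lbar + \<sigma> * t k" for k
      using \<sigma>\<sigma> by (simp add: t_def mult.assoc[symmetric])
    have at: "\<bar>l k - lbar\<bar> = t k" for k
      using \<sigma> t0'[of k] by (simp add: lt abs_mult)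
    have side: "\<exists>e. e \<longlonglongrightarrow> \<tau> * (- L) \<and> (\<forall>k. - \<tau> * D k \<le> e k)" if \<tau>: "\<bar>\<tau>\<bar> = 1" for \<tau>
    proof -
      have "\<forall>k. \<exists>w s. norm (w - (prox (l k) f x + lbar *\<^sub>R prox_slope (l k) f x)) \<le> (t k)\<^sup>2 \<and>
        norm s \<le> 2 * norm v \<and>
        (s - v, lbar *\<^sub>R s) \<in> regular_normal_cone G (prox lbar f w, prox_slope lbar f w) \<and>
        - \<tau> * D k \<le> \<tau> * (s \<bullet> v) + C * t k"
        using C[rule_format, OF _ _ lD(3) \<tau>] t t0' unfolding at by blast
      then obtain y s where ys:
        "\<And>k. norm (y k - (prox (l k) f x + lbar *\<^sub>R prox_slope (l k) f x)) \<le> (t k)\<^sup>2"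
        "\<And>k. norm (s k) \<le> 2 * norm v"
        "\<And>k. (s k - v, lbar *\<^sub>R s k) \<in> regular_normal_cone G (prox lbar f (y k), prox_slope lbar f (y k))"
        "\<And>k. - \<tau> * D k \<le> \<tau> * (s k \<bullet> v) + C * t k" by metis
      have "(\<lambda>k. s k \<bullet> v) \<longlonglongrightarrow> - \<sigma> * (v \<bullet> q)"
        by (rule key[OF t, of y]) (use ys in \<open>simp_all add: lt\<close>)
      then have "(\<lambda>k. \<tau> * (s k \<bullet> v) + C * t k) \<longlonglongrightarrow> \<tau> * (- \<sigma> * (v \<bullet> q)) + C * 0"
        by (intro tendsto_intros tl)
      then show ?thesis using ys(4) by (auto simp: L_def)
    qed
    obtain e where e: "e \<longlonglongrightarrow> - L" "\<And>k. - D k \<le> e k" using side[of 1] by auto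
    obtain e' where e': "e' \<longlonglongrightarrow> L" "\<And>k. D k \<le> e' k" using side[of "-1"] by auto
    have "D \<longlonglongrightarrow> L"
    proof (rule tendsto_sandwich)
      show "\<forall>\<^sub>F k in sequentially. - e k \<le> D k" using e(2) by (simp add: minus_le_iff)
      show "\<forall>\<^sub>F k in sequentially. D k \<le> e' k" using e'(2) by simp
      show "e' \<longlonglongrightarrow> L" by fact
      show "(\<lambda>k. - e k) \<longlonglongrightarrow> L" using tendsto_minus[OF e(1)] by simp
    qed
    then have "\<forall>\<^sub>F k in sequentially. dist (D k) L < \<epsilon>" using \<epsilon> by (rule tendstoD)
    then obtain N where "dist (D N) L < \<epsilon>" by (auto simp: eventually_sequentially)
    then show False using lD(4)[of N] by (simp add: dist_real_def)
  qed
  then show ?thesis using that by blast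
qed

section \<open>Semismoothness\<close>

lemma blinfun_real_apply:
  fixes V :: "real \<Rightarrow>\<^sub>L real"
  shows "blinfun_apply V y = y * blinfun_apply V 1"
  using blinfun.scaleR_right[of V y 1] by simp

text \<open>Bounds on derivatives pass to limits and to convex combinations.\<close>

lemma clarke_jacobian_bound:
  fixes F :: "real \<Rightarrow> real"
  assumes S: "open S" and m: "m \<in> S"
    and bound: "\<And>l D. l \<in> S \<Longrightarrow> (F has_real_derivative D) (at l) \<Longrightarrow> \<bar>D - L\<bar> \<le> \<epsilon>"
    and V: "V \<in> clarke_jacobian F m"
  shows "\<bar>blinfun_apply V 1 - L\<bar> \<le> \<epsilon>"
proof -
  define K where "K = {V :: real \<Rightarrow>\<^sub>L real. \<bar>blinfun_apply V 1 - L\<bar> \<le> \<epsilon>}"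
  have "convex K"
  proof (rule convexI)
    fix A B :: "real \<Rightarrow>\<^sub>L real" and u w :: real
    assume A: "A \<in> K" and B: "B \<in> K" and uw: "0 \<le> u" "0 \<le> w" "u + w = 1"
    define a where "a = blinfun_apply A 1 - L"
    define b where "b = blinfun_apply B 1 - L"
    have "blinfun_apply (u *\<^sub>R A + w *\<^sub>R B) 1 - L = u * a + w * b + (u + w - 1) * L"
      by (simp add: blinfun.add_left blinfun.scaleR_left a_def b_def algebra_simps)
    also have "\<bar>\<dots>\<bar> \<le> u * \<bar>a\<bar> + w * \<bar>b\<bar>"
      using uw abs_triangle_ineq[of "u * a" "w * b"] by (simp add: abs_mult)
    also have "\<dots> \<le> u * \<epsilon> + w * \<epsilon>"
      using A B uw by (intro add_mono mult_left_mono) (auto simp: K_def a_def b_def)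
    also have "\<dots> = \<epsilon>" using uw by (simp add: distrib_right[symmetric])
    finally show "u *\<^sub>R A + w *\<^sub>R B \<in> K" by (simp add: K_def)
  qed
  moreover have "{V. \<exists>xs Vs. xs \<longlonglongrightarrow> m \<and> (\<forall>k. (F has_derivative blinfun_apply (Vs k)) (at (xs k))) \<and>
          Vs \<longlonglongrightarrow> V} \<subseteq> K"
  proof clarify
    fix V xs Vs assume xs: "xs \<longlonglongrightarrow> m" and der: "\<forall>k. (F has_derivative blinfun_apply (Vs k)) (at (xs k))"
      and Vs: "Vs \<longlonglongrightarrow> (V :: real \<Rightarrow>\<^sub>L real)"
    have "(F has_real_derivative (blinfun_apply (Vs k) 1)) (at (xs k))" for k
    proof -
      have "blinfun_apply (Vs k) = (*) (blinfun_apply (Vs k) 1)"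
      proof
        fix y show "blinfun_apply (Vs k) y = blinfun_apply (Vs k) 1 * y"
          by (subst blinfun_real_apply) (rule mult.commute)
      qed
      then show ?thesis using der unfolding has_field_derivative_def by metis
    qed
    moreover have "\<forall>\<^sub>F k in sequentially. xs k \<in> S" using topological_tendstoD[OF xs S m] .
    ultimately have "\<forall>\<^sub>F k in sequentially. \<bar>blinfun_apply (Vs k) 1 - L\<bar> \<le> \<epsilon>"
      using bound by (auto elim!: eventually_mono)
    moreover have "(\<lambda>k. \<bar>blinfun_apply (Vs k) 1 - L\<bar>) \<longlonglongrightarrow> \<bar>blinfun_apply V 1 - L\<bar>"
      by (intro tendsto_intros Vs)
    ultimately have "\<bar>blinfun_apply V 1 - L\<bar> \<le> \<epsilon>"
      by (intro tendsto_upperbound[of _ _ sequentially]) auto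
    then show "V \<in> K" by (simp add: K_def)
  qed
  ultimately have "clarke_jacobian F m \<subseteq> K"
    unfolding clarke_jacobian_def by (rule hull_minimal[rotated])
  then show ?thesis using V by (auto simp: K_def)
qed

lemma lipschitz_real_derivative_bound:
  fixes F :: "real \<Rightarrow> real"
  assumes lip: "B-lipschitz_on S F" and S: "open S" "l \<in> S" and D: "(F has_real_derivative D) (at l)"
  shows "\<bar>D\<bar> \<le> B"
proof -
  have "((\<lambda>y. \<bar>(F (l + y) - F l) / y\<bar>) \<longlongrightarrow> \<bar>D\<bar>) (at 0)"
    using D unfolding DERIV_def by (rule tendsto_rabs)
  moreover have "\<forall>\<^sub>F y in at 0. \<bar>(F (l + y) - F l) / y\<bar> \<le> B"
  proof -
    have "((\<lambda>y. l + y) \<longlongrightarrow> l + 0) (at 0)" by (intro tendsto_intros)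
    then have "\<forall>\<^sub>F y in at 0. l + y \<in> S" using topological_tendstoD S by fastforce
    then show ?thesis
    proof (rule eventually_mono)
      fix y assume "l + y \<in> S"
      then have "\<bar>F (l + y) - F l\<bar> \<le> B * \<bar>y\<bar>"
        using lipschitz_onD[OF lip, of "l + y" l] S by (simp add: dist_norm)
      then show "\<bar>(F (l + y) - F l) / y\<bar> \<le> B"
        using lipschitz_on_nonneg[OF lip] by (cases "y = 0") (auto simp: field_simps)
    qed
  qed
  ultimately show ?thesis by (rule tendsto_upperbound) simp
qed

text \<open>On the line only the two sides of \<open>x\<close> matter, and direction \<open>0\<close> is covered by the Lipschitz
  bound.\<close>

lemma semismooth_at_if_one_sided_limits:
  fixes F :: "real \<Rightarrow> real"
  assumes D: "ball x r \<subseteq> D" and r: "0 < r" and lip: "B-lipschitz_on (ball x r) F"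
    and lims: "\<And>\<sigma>. \<bar>\<sigma>\<bar> = 1 \<Longrightarrow> \<exists>L. \<forall>\<epsilon>>0. \<exists>\<delta>>0. \<forall>l d. 0 < \<sigma> * (l - x) \<and> \<sigma> * (l - x) < \<delta> \<and>
      (F has_real_derivative d) (at l) \<longrightarrow> \<bar>d - L\<bar> \<le> \<epsilon>"
  shows "semismooth_at D F x"
  unfolding semismooth_at_def
proof (intro conjI)
  show "x \<in> interior D" using D r by (auto simp: mem_interior)
  show "\<exists>e>0. \<exists>L. L-lipschitz_on (ball x e) F" using lip r by blast
  show "\<forall>h. \<exists>l. \<forall>t hs V. pos_null t \<and> hs \<longlonglongrightarrow> h \<and> (\<forall>k. V k \<in> clarke_jacobian F (x + t k *\<^sub>R hs k)) \<longrightarrow>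
        (\<lambda>k. blinfun_apply (V k) (hs k)) \<longlonglongrightarrow> l"
  proof
    fix h :: real
    show "\<exists>l. \<forall>t hs V. pos_null t \<and> hs \<longlonglongrightarrow> h \<and> (\<forall>k. V k \<in> clarke_jacobian F (x + t k *\<^sub>R hs k)) \<longrightarrow>
        (\<lambda>k. blinfun_apply (V k) (hs k)) \<longlonglongrightarrow> l"
    proof (cases "h = 0")
      case True
      show ?thesis
      proof (intro exI[of _ 0] allI impI, elim conjE)
        fix t hs V assume t: "pos_null t" and hs: "hs \<longlonglongrightarrow> h" and V: "\<forall>k. V k \<in> clarke_jacobian F (x + t k *\<^sub>R hs k)"
        have tl: "t \<longlonglongrightarrow> 0" using t by (simp add: pos_null_def)
        have "(\<lambda>k. x + t k *\<^sub>R hs k) \<longlonglongrightarrow> x + 0 *\<^sub>R h" by (intro tendsto_intros tl hs)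
        then have "(\<lambda>k. x + t k *\<^sub>R hs k) \<longlonglongrightarrow> x" by simp
        then have "\<forall>\<^sub>F k in sequentially. x + t k *\<^sub>R hs k \<in> ball x r"
          by (rule topological_tendstoD) (use r in auto)
        then have bd: "\<forall>\<^sub>F k in sequentially. norm (blinfun_apply (V k) (hs k)) \<le> B * \<bar>hs k\<bar>"
        proof (rule eventually_mono)
          fix k assume "x + t k *\<^sub>R hs k \<in> ball x r"
          then have "\<bar>blinfun_apply (V k) 1 - 0\<bar> \<le> B"
            by (rule clarke_jacobian_bound[OF open_ball]) (use lipschitz_real_derivative_bound[OF lip open_ball] V in auto)
          then show "norm (blinfun_apply (V k) (hs k)) \<le> B * \<bar>hs k\<bar>"
            using mult_left_mono[of "\<bar>blinfun_apply (V k) 1\<bar>" B "\<bar>hs k\<bar>"]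
            by (subst blinfun_real_apply) (simp add: abs_mult mult.commute)
        qed
        have "(\<lambda>k. B * \<bar>hs k\<bar>) \<longlonglongrightarrow> B * \<bar>h\<bar>" by (intro tendsto_intros hs)
        then have "(\<lambda>k. B * \<bar>hs k\<bar>) \<longlonglongrightarrow> 0" using True by simp
        with bd show "(\<lambda>k. blinfun_apply (V k) (hs k)) \<longlonglongrightarrow> 0" by (rule Lim_null_comparison)
      qed
    next
      case False
      define \<sigma> where "\<sigma> = sgn h"
      have \<sigma>: "\<bar>\<sigma>\<bar> = 1" "\<sigma> * h > 0" using False by (auto simp: \<sigma>_def sgn_if)
      then have \<sigma>': "\<sigma> = 1 \<or> \<sigma> = -1" by auto
      obtain L where L: "\<And>\<epsilon>. \<epsilon> > 0 \<Longrightarrow> \<exists>\<delta>>0. \<forall>l d. 0 < \<sigma> * (l - x) \<and> \<sigma> * (l - x) < \<delta> \<and>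
        (F has_real_derivative d) (at l) \<longrightarrow> \<bar>d - L\<bar> \<le> \<epsilon>"
        using lims[OF \<sigma>(1)] by blast
      show ?thesis
      proof (intro exI[of _ "h * L"] allI impI, elim conjE)
        fix t hs V assume t: "pos_null t" and hs: "hs \<longlonglongrightarrow> h" and V: "\<forall>k. V k \<in> clarke_jacobian F (x + t k *\<^sub>R hs k)"
        have tl: "t \<longlonglongrightarrow> 0" and tp: "\<And>k. t k > 0" using t by (auto simp: pos_null_def)
        have "(\<lambda>k. blinfun_apply (V k) 1) \<longlonglongrightarrow> L"
        proof (rule tendstoI)
          fix e :: real assume "0 < e"
          then obtain \<delta> where \<delta>: "\<delta> > 0" "\<And>l d. 0 < \<sigma> * (l - x) \<Longrightarrow> \<sigma> * (l - x) < \<delta> \<Longrightarrow>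
            (F has_real_derivative d) (at l) \<Longrightarrow> \<bar>d - L\<bar> \<le> e / 2"
            using L[of "e / 2"] by auto
          define S where "S = {l. 0 < \<sigma> * (l - x)} \<inter> {l. \<sigma> * (l - x) < \<delta>}"
          have S: "open S" unfolding S_def by (intro open_Int open_Collect_less continuous_intros)
          have "(\<lambda>k. \<sigma> * (t k * hs k)) \<longlonglongrightarrow> \<sigma> * (0 * h)" by (intro tendsto_intros tl hs)
          then have "(\<lambda>k. \<sigma> * (t k * hs k)) \<longlonglongrightarrow> 0" by simp
          then have ev1: "\<forall>\<^sub>F k in sequentially. \<sigma> * (t k * hs k) < \<delta>"
            using \<delta>(1) by (rule order_tendstoD)
          have "(\<lambda>k. \<sigma> * hs k) \<longlonglongrightarrow> \<sigma> * h" by (intro tendsto_intros hs)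
          then have "\<forall>\<^sub>F k in sequentially. 0 < \<sigma> * hs k" using \<sigma>(2) by (rule order_tendstoD)
          with ev1 show "\<forall>\<^sub>F k in sequentially. dist (blinfun_apply (V k) 1) L < e"
          proof eventually_elim
            case (elim k)
            have "0 < t k * (\<sigma> * hs k)" using elim tp[of k] by simp
            then have "x + t k *\<^sub>R hs k \<in> S" using elim by (simp add: S_def mult.left_commute)
            then have "\<bar>blinfun_apply (V k) 1 - L\<bar> \<le> e / 2"
              by (rule clarke_jacobian_bound[OF S]) (use \<delta>(2) V in \<open>auto simp: S_def\<close>)
            then show ?case using \<open>0 < e\<close> by (simp add: dist_real_def)
          qed
        qed
        then have "(\<lambda>k. hs k * blinfun_apply (V k) 1) \<longlonglongrightarrow> h * L" by (intro tendsto_intros hs)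
        then show "(\<lambda>k. blinfun_apply (V k) (hs k)) \<longlonglongrightarrow> h * L"
          by (subst (asm) blinfun_real_apply[symmetric])
      qed
    qed
  qed
qed

lemma eta_eq: "0 < l \<Longrightarrow> real_of_ereal (eta f x l) = rval f (prox l f x)"
  by (simp add: eta_def)

lemma eta_finite_dom:
  assumes "f \<in> Gamma0" "0 < l" shows "l \<in> finite_dom (eta f x)"
proof -
  have "eta f x l = ereal (rval f (prox l f x))"
    using Gamma0_eq_rval[OF assms(1) prox_edom[OF assms]] assms by (simp add: eta_def)
  then show ?thesis by (simp add: finite_dom_def)
qed

lemma eta_has_derivative_iff:
  assumes l: "0 < l"
  shows "((\<lambda>m. real_of_ereal (eta f x m)) has_real_derivative D) (at l) \<longleftrightarrow>
    ((\<lambda>m. rval f (prox m f x)) has_real_derivative D) (at l)"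
proof -
  have "\<forall>\<^sub>F m in nhds l. real_of_ereal (eta f x m) = rval f (prox m f x)"
    using eventually_nhds_in_open[of "{0<..}" l] l by (auto elim!: eventually_mono simp: eta_eq)
  then show ?thesis by (rule DERIV_cong_ev[OF refl _ refl])
qed

lemma eta_semismooth_at:
  fixes f :: "'a::euclidean_space \<Rightarrow> ereal"
  assumes f: "f \<in> Gamma0" and lb: "0 < lbar"
    and pd: "proto_differentiable_at (subdiff f) (prox lbar f x, prox_slope lbar f x)"
    and ss: "semismooth_star_at (subdiff f) (prox lbar f x, prox_slope lbar f x)"
  shows "semismooth_at (finite_dom (eta f x)) (\<lambda>l. real_of_ereal (eta f x l)) lbar"
proof -
  obtain B where B: "0 < B" and hB: "\<And>l m. \<bar>l - lbar\<bar> < lbar / 2 \<Longrightarrow> \<bar>m - lbar\<bar> < lbar / 2 \<Longrightarrow>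
       \<bar>rval f (prox m f x) - rval f (prox l f x)\<bar> \<le> B * \<bar>m - l\<bar>"
    using prox_curve_bounds[OF f lb, of x] by metis
  have pos: "l > 0" "\<bar>l - lbar\<bar> < lbar / 2" if "l \<in> ball lbar (lbar / 2)" for l
  proof -
    show *: "\<bar>l - lbar\<bar> < lbar / 2" using that by (simp add: dist_real_def abs_minus_commute)
    show "l > 0" using * lb by linarith
  qed
  show ?thesis
  proof (rule semismooth_at_if_one_sided_limits)
    show "ball lbar (lbar / 2) \<subseteq> finite_dom (eta f x)"
      using eta_finite_dom[OF f] pos by blast
    show "0 < lbar / 2" using lb by simp
    show "B-lipschitz_on (ball lbar (lbar / 2)) (\<lambda>l. real_of_ereal (eta f x l))"
    proof (rule lipschitz_onI)
      fix l m assume "l \<in> ball lbar (lbar / 2)" "m \<in> ball lbar (lbar / 2)"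
      then show "dist (real_of_ereal (eta f x l)) (real_of_ereal (eta f x m)) \<le> B * dist l m"
        using hB[of m l] pos by (simp add: eta_eq dist_real_def)
    qed (use B in simp)
    fix \<sigma> :: real assume \<sigma>: "\<bar>\<sigma>\<bar> = 1"
    then have \<sigma>': "\<sigma> = 1 \<or> \<sigma> = -1" by auto
    obtain L where L: "\<forall>\<epsilon>>0. \<exists>\<delta>>0. \<forall>l D. 0 < \<sigma> * (l - lbar) \<and> \<sigma> * (l - lbar) < \<delta> \<and>
      ((\<lambda>m. rval f (prox m f x)) has_real_derivative D) (at l) \<longrightarrow> \<bar>D - L\<bar> \<le> \<epsilon>"
      using one_sided_limit_of_derivatives[OF f lb \<sigma> pd ss] by blast
    show "\<exists>L. \<forall>\<epsilon>>0. \<exists>\<delta>>0. \<forall>l d. 0 < \<sigma> * (l - lbar) \<and> \<sigma> * (l - lbar) < \<delta> \<and>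
      ((\<lambda>m. real_of_ereal (eta f x m)) has_real_derivative d) (at l) \<longrightarrow> \<bar>d - L\<bar> \<le> \<epsilon>"
    proof (rule exI[of _ L], intro allI impI)
      fix \<epsilon> :: real assume "0 < \<epsilon>"
      then obtain \<delta> where \<delta>: "\<delta> > 0" "\<forall>l D. 0 < \<sigma> * (l - lbar) \<and> \<sigma> * (l - lbar) < \<delta> \<and>
        ((\<lambda>m. rval f (prox m f x)) has_real_derivative D) (at l) \<longrightarrow> \<bar>D - L\<bar> \<le> \<epsilon>"
        using L by blast
      show "\<exists>\<delta>>0. \<forall>l d. 0 < \<sigma> * (l - lbar) \<and> \<sigma> * (l - lbar) < \<delta> \<and>
        ((\<lambda>m. real_of_ereal (eta f x m)) has_real_derivative d) (at l) \<longrightarrow> \<bar>d - L\<bar> \<le> \<epsilon>"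
      proof (intro exI[of _ "min \<delta> lbar"] conjI allI impI, goal_cases)
        case 1 then show ?case using \<delta>(1) lb by simp
      next
        case (2 l d)
        then have "l > 0" using \<sigma>' by auto
        then show ?case using 2 \<delta>(2)[rule_format, of l d] by (simp add: eta_has_derivative_iff)
      qed
    qed
  qed
qed

section \<open>Locally conic sets\<close>

text \<open>Near each point \<open>a\<close> the set coincides with a translated cone with apex \<open>a\<close> (which need not
  itself belong to the set). Since \<open>s\<close> ranges over all positive scalings that stay near \<open>a\<close>, the
  class is closed under complements, hence under all finite Boolean operations; it contains the
  half-spaces.\<close>

definition locally_conic :: "'a::real_normed_vector set \<Rightarrow> bool" where
  "locally_conic G \<longleftrightarrow> (\<forall>a. \<exists>\<rho>>0. \<forall>z s. norm z < \<rho> \<and> 0 < s \<and> norm (s *\<^sub>R z) < \<rho> \<and>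
     a + z \<in> G \<longrightarrow> a + s *\<^sub>R z \<in> G)"

lemma locally_conicE:
  assumes "locally_conic G"
  obtains \<rho> where "0 < \<rho>"
    "\<And>z s. norm z < \<rho> \<Longrightarrow> 0 < s \<Longrightarrow> norm (s *\<^sub>R z) < \<rho> \<Longrightarrow> a + z \<in> G \<Longrightarrow> a + s *\<^sub>R z \<in> G"
proof -
  from assms obtain \<rho> where "0 < \<rho>" "\<forall>z s. norm z < \<rho> \<and> 0 < s \<and> norm (s *\<^sub>R z) < \<rho> \<and>
     a + z \<in> G \<longrightarrow> a + s *\<^sub>R z \<in> G" unfolding locally_conic_def by blast
  then show ?thesis by (intro that[of \<rho>]) simp_all
qed

lemma locally_conic_UNIV [simp]: "locally_conic UNIV"
  by (auto simp: locally_conic_def intro: exI[of _ 1])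

lemma locally_conic_Int:
  assumes "locally_conic G" "locally_conic H"
  shows "locally_conic (G \<inter> H)"
  unfolding locally_conic_def
proof
  fix a
  obtain \<rho> where \<rho>: "0 < \<rho>"
    "\<And>z s. norm z < \<rho> \<Longrightarrow> 0 < s \<Longrightarrow> norm (s *\<^sub>R z) < \<rho> \<Longrightarrow> a + z \<in> G \<Longrightarrow> a + s *\<^sub>R z \<in> G"
    using locally_conicE[OF assms(1), of a] by blast
  obtain \<rho>' where \<rho>': "0 < \<rho>'"
    "\<And>z s. norm z < \<rho>' \<Longrightarrow> 0 < s \<Longrightarrow> norm (s *\<^sub>R z) < \<rho>' \<Longrightarrow> a + z \<in> H \<Longrightarrow> a + s *\<^sub>R z \<in> H"
    using locally_conicE[OF assms(2), of a] by blast
  show "\<exists>\<rho>>0. \<forall>z s. norm z < \<rho> \<and> 0 < s \<and> norm (s *\<^sub>R z) < \<rho> \<and>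
     a + z \<in> G \<inter> H \<longrightarrow> a + s *\<^sub>R z \<in> G \<inter> H"
    using \<rho> \<rho>' by (intro exI[of _ "min \<rho> \<rho>'"]) auto
qed

lemma locally_conic_Compl:
  assumes "locally_conic G"
  shows "locally_conic (- G)"
  unfolding locally_conic_def
proof
  fix a
  obtain \<rho> where \<rho>: "0 < \<rho>"
    "\<And>z s. norm z < \<rho> \<Longrightarrow> 0 < s \<Longrightarrow> norm (s *\<^sub>R z) < \<rho> \<Longrightarrow> a + z \<in> G \<Longrightarrow> a + s *\<^sub>R z \<in> G"
    using locally_conicE[OF assms, of a] by blast
  have "a + s *\<^sub>R z \<notin> G" if "norm z < \<rho>" "0 < s" "norm (s *\<^sub>R z) < \<rho>" "a + z \<notin> G" for z s
    using \<rho>(2)[of "s *\<^sub>R z" "1 / s"] that by auto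
  then show "\<exists>\<rho>>0. \<forall>z s. norm z < \<rho> \<and> 0 < s \<and> norm (s *\<^sub>R z) < \<rho> \<and>
     a + z \<in> - G \<longrightarrow> a + s *\<^sub>R z \<in> - G"
    using \<rho>(1) by (intro exI[of _ \<rho>]) (simp del: norm_scaleR)
qed

lemma locally_conic_Un:
  assumes "locally_conic G" "locally_conic H"
  shows "locally_conic (G \<union> H)"
proof -
  have "G \<union> H = - (- G \<inter> - H)" by blast
  then show ?thesis using assms by (simp only: locally_conic_Compl locally_conic_Int)
qed

lemma locally_conic_INT:
  assumes "finite I" "\<And>i. i \<in> I \<Longrightarrow> locally_conic (G i)"
  shows "locally_conic (\<Inter>i\<in>I. G i)"
  using assms by (induction I rule: finite_induct) (auto intro: locally_conic_Int)

lemma locally_conic_UN: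
  assumes "finite I" "\<And>i. i \<in> I \<Longrightarrow> locally_conic (G i)"
  shows "locally_conic (\<Union>i\<in>I. G i)"
proof -
  have "(\<Union>i\<in>I. G i) = - (\<Inter>i\<in>I. - G i)" by blast
  then show ?thesis using assms by (simp only: locally_conic_Compl locally_conic_INT)
qed

lemma locally_conic_affine_vimage:
  assumes G: "locally_conic G" and L: "bounded_linear L" and T: "\<And>a z. T (a + z) = T a + L z"
  shows "locally_conic (T -` G)"
  unfolding locally_conic_def
proof
  fix a
  obtain \<rho> where \<rho>: "0 < \<rho>"
    "\<And>z s. norm z < \<rho> \<Longrightarrow> 0 < s \<Longrightarrow> norm (s *\<^sub>R z) < \<rho> \<Longrightarrow> T a + z \<in> G \<Longrightarrow> T a + s *\<^sub>R z \<in> G"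
    using locally_conicE[OF G, of "T a"] by blast
  obtain K where K: "K > 0" "\<And>x. norm (L x) \<le> norm x * K"
    using bounded_linear.pos_bounded[OF L] by blast
  have lt: "norm (L z) < \<rho>" if "norm z < \<rho> / K" for z
  proof -
    have "norm z * K < \<rho>" using that K(1) by (simp add: field_simps)
    then show ?thesis using K(2)[of z] by simp
  qed
  have Ls: "L (s *\<^sub>R z) = s *\<^sub>R L z" for s z
    by (rule linear_scale[OF bounded_linear.linear[OF L]])
  show "\<exists>\<rho>>0. \<forall>z s. norm z < \<rho> \<and> 0 < s \<and> norm (s *\<^sub>R z) < \<rho> \<and>
     a + z \<in> T -` G \<longrightarrow> a + s *\<^sub>R z \<in> T -` G"
  proof (intro exI[of _ "\<rho> / K"] conjI allI impI)
    show "\<rho> / K > 0" using \<rho>(1) K(1) by simp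
    fix z s assume zs: "norm z < \<rho> / K \<and> 0 < s \<and> norm (s *\<^sub>R z) < \<rho> / K \<and> a + z \<in> T -` G"
    then have "T a + s *\<^sub>R L z \<in> G"
      using lt[of z] lt[of "s *\<^sub>R z"] by (intro \<rho>(2)) (auto simp: T Ls simp del: norm_scaleR)
    then show "a + s *\<^sub>R z \<in> T -` G" by (simp add: T Ls)
  qed
qed

lemma locally_conic_halfspace:
  fixes c :: "'a::real_inner"
  shows "locally_conic {x. c \<bullet> x \<le> b}"
  unfolding locally_conic_def
proof
  fix a :: 'a
  define g where "g = b - c \<bullet> a"
  have mem: "a + z \<in> {x. c \<bullet> x \<le> b} \<longleftrightarrow> c \<bullet> z \<le> g" for z
    by (auto simp: g_def inner_add_right)
  show "\<exists>\<rho>>0. \<forall>z s. norm z < \<rho> \<and> 0 < s \<and> norm (s *\<^sub>R z) < \<rho> \<and>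
     a + z \<in> {x. c \<bullet> x \<le> b} \<longrightarrow> a + s *\<^sub>R z \<in> {x. c \<bullet> x \<le> b}"
  proof (cases "g = 0")
    case True
    have "c \<bullet> (s *\<^sub>R z) \<le> g" if "0 < s" "c \<bullet> z \<le> g" for s z
      using that True by (simp add: mult_le_0_iff)
    then show ?thesis unfolding mem by (intro exI[of _ 1]) auto
  next
    case False
    \<comment> \<open>near a point off the bounding hyperplane, membership does not depend on \<open>z\<close>\<close>
    have small: "\<bar>c \<bullet> z\<bar> < \<bar>g\<bar>" if "norm z < \<bar>g\<bar> / (norm c + 1)" for z
    proof -
      have "\<bar>c \<bullet> z\<bar> \<le> norm c * norm z" by (rule Cauchy_Schwarz_ineq2)
      also have "\<dots> \<le> (norm c + 1) * norm z" by (intro mult_right_mono) auto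
      also have "\<dots> < \<bar>g\<bar>"
        using that by (simp add: pos_less_divide_eq add_nonneg_pos mult.commute)
      finally show ?thesis .
    qed
    show ?thesis
      unfolding mem
    proof (intro exI[of _ "\<bar>g\<bar> / (norm c + 1)"] conjI allI impI)
      show "0 < \<bar>g\<bar> / (norm c + 1)" using False by (simp add: add_nonneg_pos)
      fix z s assume "norm z < \<bar>g\<bar> / (norm c + 1) \<and> 0 < s \<and> norm (s *\<^sub>R z) < \<bar>g\<bar> / (norm c + 1) \<and> c \<bullet> z \<le> g"
      then show "c \<bullet> (s *\<^sub>R z) \<le> g" using small[of z] small[of "s *\<^sub>R z"] by linarith
    qed
  qed
qed

lemma locally_conic_hyperplane:
  fixes c :: "'a::real_inner"
  shows "locally_conic {x. c \<bullet> x = b}"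
proof -
  have "{x. c \<bullet> x = b} = {x. c \<bullet> x \<le> b} \<inter> {x. (- c) \<bullet> x \<le> - b}" by auto
  then show ?thesis by (simp only: locally_conic_Int locally_conic_halfspace)
qed

lemma polyhedron_imp_locally_conic:
  assumes "polyhedron P"
  shows "locally_conic P"
proof -
  obtain F where F: "finite F" "P = \<Inter>F" "\<forall>h\<in>F. \<exists>a b. a \<noteq> 0 \<and> h = {x. a \<bullet> x \<le> b}"
    using assms unfolding polyhedron_def by blast
  have "locally_conic h" if "h \<in> F" for h
  proof -
    obtain a b where "h = {x. a \<bullet> x \<le> b}" using F(3) \<open>h \<in> F\<close> by blast
    then show ?thesis by (simp add: locally_conic_halfspace)
  qed
  then have "locally_conic (\<Inter>h\<in>F. h)" by (rule locally_conic_INT[OF F(1)])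
  then show ?thesis using F by simp
qed

lemma locally_conic_Times:
  assumes "locally_conic S" "locally_conic T"
  shows "locally_conic (S \<times> T)"
proof -
  have "S \<times> T = fst -` S \<inter> snd -` T" by auto
  moreover have "locally_conic (fst -` S :: ('a \<times> 'b) set)"
    by (rule locally_conic_affine_vimage[OF assms(1) bounded_linear_fst]) simp
  moreover have "locally_conic (snd -` T :: ('a \<times> 'b) set)"
    by (rule locally_conic_affine_vimage[OF assms(2) bounded_linear_snd]) simp
  ultimately show ?thesis by (simp add: locally_conic_Int)
qed

text \<open>The step sizes of a sequence that realizes a tangent direction can be exchanged for any
  others, as soon as both lie within the conic neighbourhood.\<close>

lemma proto_differentiable_at_if_locally_conic:
  fixes S :: "'a::euclidean_space \<Rightarrow> 'b::euclidean_space set"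
  assumes G: "locally_conic (gph S)" and a: "a \<in> gph S"
  shows "proto_differentiable_at S a"
proof -
  obtain \<rho> where \<rho>: "0 < \<rho>"
    "\<And>z s. norm z < \<rho> \<Longrightarrow> 0 < s \<Longrightarrow> norm (s *\<^sub>R z) < \<rho> \<Longrightarrow> a + z \<in> gph S \<Longrightarrow> a + s *\<^sub>R z \<in> gph S"
    using locally_conicE[OF G, of a] by blast
  have "\<exists>ws zs. ws \<longlonglongrightarrow> w \<and> zs \<longlonglongrightarrow> z \<and> (\<forall>k. zs k \<in> (\<lambda>y. (y - snd a) /\<^sub>R t k) ` S (fst a + t k *\<^sub>R ws k))"
    if wz: "(w, z) \<in> tangent_cone (gph S) a" and t: "pos_null t" for w z t
  proof -
    obtain \<tau> us where \<tau>: "pos_null \<tau>" and us: "us \<longlonglongrightarrow> (w, z)" and mem: "\<And>k. a + \<tau> k *\<^sub>R us k \<in> gph S"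
      using wz unfolding tangent_cone_def by blast
    have small: "\<forall>\<^sub>F k in sequentially. norm (r k *\<^sub>R us k) < \<rho>" if "pos_null r" for r
    proof -
      have r: "r \<longlonglongrightarrow> 0" using that by (simp add: pos_null_def)
      have "(\<lambda>k. norm (r k *\<^sub>R us k)) \<longlonglongrightarrow> norm (0 *\<^sub>R (w, z))"
        by (intro tendsto_intros r us)
      then have "(\<lambda>k. norm (r k *\<^sub>R us k)) \<longlonglongrightarrow> 0" by simp
      then show ?thesis using \<rho>(1) by (rule order_tendstoD)
    qed
    have t0: "t k > 0" and \<tau>0: "\<tau> k > 0" for k using t \<tau> by (auto simp: pos_null_def)
    define vs where "vs = (\<lambda>k. if a + t k *\<^sub>R us k \<in> gph S then us k else 0)"
    have "\<forall>\<^sub>F k in sequentially. a + t k *\<^sub>R us k \<in> gph S"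
      using small[OF t] small[OF \<tau>]
    proof eventually_elim
      case (elim k)
      have eq: "(t k / \<tau> k) *\<^sub>R (\<tau> k *\<^sub>R us k) = t k *\<^sub>R us k"
        using less_imp_neq[OF \<tau>0[of k]] by simp
      have "a + (t k / \<tau> k) *\<^sub>R (\<tau> k *\<^sub>R us k) \<in> gph S"
      proof (rule \<rho>(2))
        show "norm (\<tau> k *\<^sub>R us k) < \<rho>" by (rule elim(2))
        show "norm ((t k / \<tau> k) *\<^sub>R (\<tau> k *\<^sub>R us k)) < \<rho>" unfolding eq by (rule elim(1))
      qed (use t0[of k] \<tau>0[of k] mem[of k] in simp_all)
      then show ?case unfolding eq .
    qed
    then have "\<forall>\<^sub>F k in sequentially. us k = vs k"
      by (rule eventually_mono) (simp add: vs_def)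
    then have vs: "vs \<longlonglongrightarrow> (w, z)" using us by (simp add: tendsto_cong)
    have mem_vs: "a + t k *\<^sub>R vs k \<in> gph S" for k using a by (simp add: vs_def)
    have "snd (vs k) \<in> (\<lambda>y. (y - snd a) /\<^sub>R t k) ` S (fst a + t k *\<^sub>R fst (vs k))" for k
    proof (rule image_eqI)
      show "snd a + t k *\<^sub>R snd (vs k) \<in> S (fst a + t k *\<^sub>R fst (vs k))"
        using mem_vs[of k] by (simp add: gph_def case_prod_beta)
      show "snd (vs k) = (snd a + t k *\<^sub>R snd (vs k) - snd a) /\<^sub>R t k" using t0[of k] by simp
    qed
    moreover have "(\<lambda>k. fst (vs k)) \<longlonglongrightarrow> w" "(\<lambda>k. snd (vs k)) \<longlonglongrightarrow> z"
      using tendsto_fst[OF vs] tendsto_snd[OF vs] by simp_all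
    ultimately show ?thesis by blast
  qed
  then show ?thesis using a unfolding proto_differentiable_at_def by blast
qed

text \<open>At a graph point \<open>b\<close> near \<open>a\<close> both directions of the line through \<open>a\<close> and \<open>b\<close> are tangent,
  so every regular normal at \<open>b\<close> is orthogonal to \<open>b - a\<close>.\<close>

lemma semismooth_star_at_if_locally_conic:
  fixes S :: "'a::euclidean_space \<Rightarrow> 'b::euclidean_space set"
  assumes G: "locally_conic (gph S)" and a: "a \<in> gph S"
  shows "semismooth_star_at S a"
proof -
  obtain \<rho> where \<rho>: "0 < \<rho>"
    "\<And>z s. norm z < \<rho> \<Longrightarrow> 0 < s \<Longrightarrow> norm (s *\<^sub>R z) < \<rho> \<Longrightarrow> a + z \<in> gph S \<Longrightarrow> a + s *\<^sub>R z \<in> gph S"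
    using locally_conicE[OF G, of a] by blast
  have "v \<bullet> u = 0" if v: "v \<in> directional_normal_cone (gph S) a u" for u v
  proof -
    obtain t us vs where t: "pos_null t" and us: "us \<longlonglongrightarrow> u" and vs: "vs \<longlonglongrightarrow> v"
      and reg: "\<And>k. vs k \<in> regular_normal_cone (gph S) (a + t k *\<^sub>R us k)"
      using v unfolding directional_normal_cone_def by blast
    have t0: "t k > 0" for k using t by (simp add: pos_null_def)
    have tl: "t \<longlonglongrightarrow> 0" using t by (simp add: pos_null_def)
    have zero: "vs k \<bullet> us k = 0" if k: "norm (t k *\<^sub>R us k) < \<rho> / 2" for k
    proof -
      define b where "b = a + t k *\<^sub>R us k"
      have b: "b \<in> gph S" using reg[of k] by (simp add: b_def regular_normal_cone_def split: if_splits)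
      \<comment> \<open>the graph contains a segment around \<open>b\<close> on the ray from \<open>a\<close>\<close>
      have seg: "b + r *\<^sub>R us k \<in> gph S" if "\<bar>r\<bar> < t k" for r
      proof -
        define s where "s = 1 + r / t k"
        have s: "0 < s" "s < 2" using that t0[of k] by (auto simp: s_def field_simps abs_less_iff)
        have eq: "b + r *\<^sub>R us k = a + s *\<^sub>R (t k *\<^sub>R us k)"
          using t0[of k] by (simp add: b_def s_def algebra_simps)
        have "norm (s *\<^sub>R (t k *\<^sub>R us k)) \<le> 2 * norm (t k *\<^sub>R us k)"
          unfolding norm_scaleR[of s] using s by (intro mult_right_mono) auto
        then have "norm (s *\<^sub>R (t k *\<^sub>R us k)) < \<rho>" using k by linarith
        moreover have "norm (t k *\<^sub>R us k) < \<rho>" using k \<rho>(1) by linarith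
        ultimately show ?thesis unfolding eq using s(1) b unfolding b_def by (intro \<rho>(2)[of "t k *\<^sub>R us k" s])
      qed
      have tan: "\<epsilon> *\<^sub>R us k \<in> tangent_cone (gph S) b" if \<epsilon>: "\<bar>\<epsilon>\<bar> = 1" for \<epsilon>
      proof -
        define r where "r = (\<lambda>n. t k / 2 * inverse (real (Suc n)))"
        have r0: "0 < r n" "r n < t k" for n
        proof -
          show "0 < r n" using t0[of k] by (simp add: r_def)
          have "r n \<le> t k / 2 * 1"
            unfolding r_def using t0[of k] by (intro mult_left_mono) (auto simp: field_simps)
          then show "r n < t k" using t0[of k] by simp
        qed
        have "r \<longlonglongrightarrow> t k / 2 * 0" unfolding r_def by (intro tendsto_intros LIMSEQ_inverse_real_of_nat)
        then have "pos_null r" using r0 by (simp add: pos_null_def)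
        moreover have "b + r n *\<^sub>R (\<epsilon> *\<^sub>R us k) \<in> gph S" for n
          using seg[of "r n * \<epsilon>"] r0[of n] \<epsilon> by (simp add: abs_mult)
        moreover have "(\<lambda>n. \<epsilon> *\<^sub>R us k) \<longlonglongrightarrow> \<epsilon> *\<^sub>R us k" by simp
        ultimately show ?thesis unfolding tangent_cone_def by blast
      qed
      have "vs k \<bullet> z \<le> 0" if "z \<in> tangent_cone (gph S) b" for z
        using reg[of k] b that by (simp add: b_def regular_normal_cone_def)
      from this[OF tan[of 1]] this[OF tan[of "-1"]] show ?thesis by simp
    qed
    have "(\<lambda>k. norm (t k *\<^sub>R us k)) \<longlonglongrightarrow> norm (0 *\<^sub>R u)" by (intro tendsto_intros tl us)
    then have "(\<lambda>k. norm (t k *\<^sub>R us k)) \<longlonglongrightarrow> 0" by simp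
    then have "\<forall>\<^sub>F k in sequentially. norm (t k *\<^sub>R us k) < \<rho> / 2"
      by (rule order_tendstoD) (use \<rho>(1) in simp)
    then have "\<forall>\<^sub>F k in sequentially. vs k \<bullet> us k = 0"
      by (rule eventually_mono) (rule zero)
    then have "(\<lambda>k. vs k \<bullet> us k) \<longlonglongrightarrow> 0" by (rule tendsto_eventually)
    moreover have "(\<lambda>k. vs k \<bullet> us k) \<longlonglongrightarrow> v \<bullet> u" by (intro tendsto_intros vs us)
    ultimately show ?thesis by (rule LIMSEQ_unique[symmetric])
  qed
  then show ?thesis using a unfolding semismooth_star_at_def by blast
qed

text \<open>The graph of the normal cone map of a (convex) set.\<close>

definition normal_cone_graph :: "'a::real_inner set \<Rightarrow> ('a \<times> 'a) set" where
  "normal_cone_graph P = {(x, m). x \<in> P \<and> (\<forall>y\<in>P. m \<bullet> (y - x) \<le> 0)}"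

text \<open>Farkas: a normal vector of a polyhedron is a nonnegative combination of the active
  constraint normals. A vector \<open>d\<close> separating \<open>m\<close> from their cone would make \<open>- d\<close> a feasible
  direction along which \<open>m\<close> increases.\<close>

lemma polyhedral_normal_in_active_cone:
  fixes A :: "'i \<Rightarrow> 'a::euclidean_space"
  assumes F: "finite F" and x: "\<And>i. i \<in> F \<Longrightarrow> A i \<bullet> x \<le> b i"
    and m: "\<And>y. (\<And>i. i \<in> F \<Longrightarrow> A i \<bullet> y \<le> b i) \<Longrightarrow> m \<bullet> (y - x) \<le> 0"
  shows "m \<in> convex_cone hull (A ` {i \<in> F. A i \<bullet> x = b i})"
proof (rule ccontr)
  define J where "J = {i \<in> F. A i \<bullet> x = b i}"
  define C where "C = convex_cone hull (A ` J)"
  assume "m \<notin> convex_cone hull (A ` {i \<in> F. A i \<bullet> x = b i})"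
  then have mC: "m \<notin> C" by (simp add: C_def J_def)
  have "finite (A ` J)" using F by (simp add: J_def)
  then have "closed C" unfolding C_def by (intro polyhedron_imp_closed polyhedron_convex_cone_hull)
  moreover have "convex C" unfolding C_def by (rule convex_convex_cone_hull)
  ultimately obtain d \<beta> where d: "d \<bullet> m < \<beta>" "\<forall>c\<in>C. d \<bullet> c > \<beta>"
    using separating_hyperplane_closed_point mC by blast
  have "0 \<in> C" unfolding C_def by (rule convex_cone_hull_contains_0)
  then have \<beta>: "\<beta> < 0" using d(2) by force
  have dC: "d \<bullet> c \<ge> 0" if c: "c \<in> C" for c
  proof (rule ccontr)
    assume "\<not> 0 \<le> d \<bullet> c"
    then have neg: "d \<bullet> c < 0" by simp
    have "(\<beta> / (d \<bullet> c)) *\<^sub>R c \<in> C"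
      unfolding C_def by (rule convex_cone_hull_mul) (use c neg \<beta> in \<open>auto simp: C_def divide_nonpos_neg\<close>)
    then have "d \<bullet> ((\<beta> / (d \<bullet> c)) *\<^sub>R c) > \<beta>" using d(2) by blast
    then show False using neg by simp
  qed
  have act: "A i \<bullet> (- d) \<le> 0" if "i \<in> J" for i
    using dC[of "A i"] that by (simp add: C_def hull_inc inner_commute)
  \<comment> \<open>a short step along \<open>- d\<close> stays in the polyhedron\<close>
  have "\<exists>e>0. \<forall>i\<in>F. A i \<bullet> (x + e *\<^sub>R (- d)) \<le> b i"
  proof -
    have "\<forall>i\<in>F. \<exists>e>0. \<forall>e'. 0 < e' \<and> e' \<le> e \<longrightarrow> A i \<bullet> (x + e' *\<^sub>R (- d)) \<le> b i"
    proof
      fix i assume i: "i \<in> F"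
      show "\<exists>e>0. \<forall>e'. 0 < e' \<and> e' \<le> e \<longrightarrow> A i \<bullet> (x + e' *\<^sub>R (- d)) \<le> b i"
      proof (cases "i \<in> J")
        case True
        then have "A i \<bullet> (x + e' *\<^sub>R (- d)) \<le> b i" if "0 < e'" for e'
          using act[OF True] that by (simp add: J_def inner_diff_right)
        then show ?thesis by (intro exI[of _ 1]) auto
      next
        case False
        then have gap: "b i - A i \<bullet> x > 0" using x[OF i] i by (simp add: J_def)
        define e where "e = (b i - A i \<bullet> x) / (\<bar>A i \<bullet> d\<bar> + 1)"
        have e: "e > 0" using gap by (simp add: e_def)
        have "A i \<bullet> (x + e' *\<^sub>R (- d)) \<le> b i" if e': "0 < e'" "e' \<le> e" for e'
        proof -
          have "- (e' * (A i \<bullet> d)) \<le> e' * (\<bar>A i \<bullet> d\<bar> + 1)"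
            using e' mult_left_mono[of "- (A i \<bullet> d)" "\<bar>A i \<bullet> d\<bar> + 1" e'] by simp
          also have "\<dots> \<le> e * (\<bar>A i \<bullet> d\<bar> + 1)" using e' by (intro mult_right_mono) auto
          also have "\<dots> = b i - A i \<bullet> x" by (simp add: e_def)
          finally show ?thesis by (simp add: inner_diff_right)
        qed
        then show ?thesis using e by blast
      qed
    qed
    then obtain e where e: "\<forall>i\<in>F. e i > 0 \<and> (\<forall>e'. 0 < e' \<and> e' \<le> e i \<longrightarrow> A i \<bullet> (x + e' *\<^sub>R (- d)) \<le> b i)"
      by metis
    define e0 where "e0 = Min (insert 1 (e ` F))"
    have "e0 > 0" "\<And>i. i \<in> F \<Longrightarrow> e0 \<le> e i" using F e by (auto simp: e0_def)
    then show ?thesis using e by blast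
  qed
  then obtain e where e: "e > 0" "\<forall>i\<in>F. A i \<bullet> (x + e *\<^sub>R (- d)) \<le> b i" by blast
  then have "m \<bullet> (x + e *\<^sub>R (- d) - x) \<le> 0" by (intro m) blast
  then have "0 \<le> e * (d \<bullet> m)" by (simp add: inner_commute)
  then show False using e(1) d(1) \<beta> by (simp add: zero_le_mult_iff)
qed

text \<open>The graph is a finite union of products of a polyhedron, on which a set \<open>J\<close> of constraints
  is active, and the cone generated by the normals of these constraints.\<close>

lemma locally_conic_normal_cone_graph:
  fixes P :: "'a::euclidean_space set"
  assumes P: "polyhedron P"
  shows "locally_conic (normal_cone_graph P)"
proof -
  obtain F where F: "finite F" "P = \<Inter>F" "\<forall>h\<in>F. \<exists>a b. a \<noteq> 0 \<and> h = {x. a \<bullet> x \<le> b}"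
    using P unfolding polyhedron_def by blast
  then obtain A b where Ab: "\<forall>h\<in>F. h = {x. A h \<bullet> x \<le> b h}" by metis
  then have P_iff: "x \<in> P \<longleftrightarrow> (\<forall>h\<in>F. A h \<bullet> x \<le> b h)" for x using F(2) by blast
  define X where "X = (\<lambda>J. P \<inter> (\<Inter>h\<in>J. {x. A h \<bullet> x = b h}))"
  define C where "C = (\<lambda>J. convex_cone hull (A ` J))"
  have eq: "normal_cone_graph P = (\<Union>J\<in>Pow F. X J \<times> C J)"
  proof (intro equalityI subsetI)
    fix z assume "z \<in> normal_cone_graph P"
    then obtain x m where z: "z = (x, m)" "x \<in> P" "\<And>y. y \<in> P \<Longrightarrow> m \<bullet> (y - x) \<le> 0"
      by (auto simp: normal_cone_graph_def)
    define J where "J = {h \<in> F. A h \<bullet> x = b h}"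
    have "m \<in> C J"
      unfolding C_def J_def
      by (rule polyhedral_normal_in_active_cone[OF F(1)]) (use z P_iff in auto)
    moreover have "x \<in> X J" using z by (simp add: X_def J_def)
    moreover have "J \<in> Pow F" by (auto simp: J_def)
    ultimately show "z \<in> (\<Union>J\<in>Pow F. X J \<times> C J)" using z(1) by blast
  next
    fix z assume "z \<in> (\<Union>J\<in>Pow F. X J \<times> C J)"
    then obtain J x m where z: "z = (x, m)" "J \<subseteq> F" "x \<in> X J" "m \<in> C J" by blast
    have "m \<bullet> (y - x) \<le> 0" if y: "y \<in> P" for y
    proof -
      have "C J \<subseteq> {m. (y - x) \<bullet> m \<le> 0}"
        unfolding C_def
      proof (rule hull_minimal)
        show "convex_cone {m. (y - x) \<bullet> m \<le> 0}" by (rule convex_cone_halfspace_le)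
        show "A ` J \<subseteq> {m. (y - x) \<bullet> m \<le> 0}"
        proof clarify
          fix h assume h: "h \<in> J"
          have "A h \<bullet> x = b h" using z(3) h by (simp add: X_def)
          moreover have "A h \<bullet> y \<le> b h" using y h z(2) P_iff by blast
          ultimately have "A h \<bullet> (y - x) \<le> 0" by (simp add: inner_diff_right)
          then show "(y - x) \<bullet> A h \<le> 0" by (subst inner_commute)
        qed
      qed
      then show ?thesis using z by (auto simp: inner_commute)
    qed
    then show "z \<in> normal_cone_graph P" using z by (simp add: normal_cone_graph_def X_def)
  qed
  have "locally_conic (X J \<times> C J)" if J: "J \<in> Pow F" for J
  proof (rule locally_conic_Times)
    have finJ: "finite J" using J F(1) finite_subset by blast
    show "locally_conic (X J)"
      unfolding X_def
      by (intro locally_conic_Int polyhedron_imp_locally_conic P locally_conic_INT finJ locally_conic_hyperplane)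
    show "locally_conic (C J)"
      unfolding C_def by (intro polyhedron_imp_locally_conic polyhedron_convex_cone_hull finite_imageI finJ)
  qed
  then show ?thesis unfolding eq by (intro locally_conic_UN) (simp add: F(1))
qed

section \<open>Piecewise linear-quadratic functions\<close>

lemma quadratic_expansion:
  fixes A :: "'a::euclidean_space \<Rightarrow> 'a"
  assumes A: "linear A"
  shows "(x + \<theta> *\<^sub>R d) \<bullet> A (x + \<theta> *\<^sub>R d) + b \<bullet> (x + \<theta> *\<^sub>R d) + c =
    (x \<bullet> A x + b \<bullet> x + c) + \<theta> * ((A x + adjoint A x + b) \<bullet> d) + \<theta>\<^sup>2 * (d \<bullet> A d)"
proof -
  have "A (x + \<theta> *\<^sub>R d) = A x + \<theta> *\<^sub>R A d" using A by (simp add: linear_add linear_scale)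
  moreover have "adjoint A x \<bullet> d = x \<bullet> A d"
    using adjoint_works[OF A, of d x] by (simp add: inner_commute)
  ultimately show ?thesis
    by (simp add: inner_add_left inner_add_right inner_commute algebra_simps power2_eq_square)
qed

text \<open>Because \<open>f\<close> is convex, a subgradient need only be tested along short segments, and every
  segment in the domain starting at \<open>x\<close> has points arbitrarily close to \<open>x\<close> in some piece
  containing \<open>x\<close>. The adjoint appears because the matrices of the quadratic forms are not assumed
  symmetric.\<close>

lemma subdiff_piecewise_quadratic_iff:
  fixes f :: "'a::euclidean_space \<Rightarrow> ereal"
  assumes f: "f \<in> Gamma0" and fin: "finite PP" and poly: "\<And>P. P \<in> PP \<Longrightarrow> polyhedron P"
    and dom: "edom f = \<Union>PP" and lin: "\<And>P. P \<in> PP \<Longrightarrow> linear (A P)"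
    and quad: "\<And>P x. P \<in> PP \<Longrightarrow> x \<in> P \<Longrightarrow> rval f x = x \<bullet> A P x + b P \<bullet> x + c P"
  shows "v \<in> subdiff f x \<longleftrightarrow> x \<in> edom f \<and>
    (\<forall>P\<in>PP. x \<in> P \<longrightarrow> (x, v - (A P x + adjoint (A P) x + b P)) \<in> normal_cone_graph P)"
proof -
  define g where "g P = A P x + adjoint (A P) x + b P" for P
  have expand: "rval f (x + \<theta> *\<^sub>R d) = rval f x + \<theta> * (g P \<bullet> d) + \<theta>\<^sup>2 * (d \<bullet> A P d)"
    if "P \<in> PP" "x \<in> P" "x + \<theta> *\<^sub>R d \<in> P" for P \<theta> d
    unfolding quad[OF that(1,2)] quad[OF that(1,3)] g_def by (rule quadratic_expansion[OF lin[OF that(1)]])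
  show ?thesis
    unfolding g_def[symmetric]
  proof
    assume v: "v \<in> subdiff f x"
    have "(x, v - g P) \<in> normal_cone_graph P" if P: "P \<in> PP" and x: "x \<in> P" for P
    proof -
      have "(v - g P) \<bullet> (y - x) \<le> 0" if y: "y \<in> P" for y
      proof -
        have "v \<bullet> (y - x) \<le> g P \<bullet> (y - x)"
        proof (rule le_of_le_add_small)
          fix \<theta> :: real assume \<theta>: "0 < \<theta>" "\<theta> \<le> 1"
          have mem: "x + \<theta> *\<^sub>R (y - x) \<in> P"
            using convexD_alt[OF polyhedron_imp_convex[OF poly[OF P]] x y, of \<theta>] \<theta> by (simp add: algebra_simps)
          then have "x + \<theta> *\<^sub>R (y - x) \<in> edom f" using dom P by blast
          then have "rval f x + v \<bullet> (\<theta> *\<^sub>R (y - x)) \<le> rval f (x + \<theta> *\<^sub>R (y - x))"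
            using v unfolding subdiff_iff[OF f] by force
          then have "\<theta> * (v \<bullet> (y - x)) \<le> \<theta> * (g P \<bullet> (y - x) + \<theta> * ((y - x) \<bullet> A P (y - x)))"
            unfolding expand[OF P x mem] by (simp add: power2_eq_square algebra_simps)
          then show "v \<bullet> (y - x) \<le> g P \<bullet> (y - x) + \<theta> * ((y - x) \<bullet> A P (y - x))"
            using \<theta> by simp
        qed
        then show ?thesis by (simp add: inner_diff_left)
      qed
      then show ?thesis using x by (simp add: normal_cone_graph_def)
    qed
    then show "x \<in> edom f \<and> (\<forall>P\<in>PP. x \<in> P \<longrightarrow> (x, v - g P) \<in> normal_cone_graph P)"
      using v by (simp add: subdiff_def)
  next
    assume "x \<in> edom f \<and> (\<forall>P\<in>PP. x \<in> P \<longrightarrow> (x, v - g P) \<in> normal_cone_graph P)"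
    then have x: "x \<in> edom f" and N: "\<forall>P\<in>PP. x \<in> P \<longrightarrow> (x, v - g P) \<in> normal_cone_graph P" by auto
    have "rval f x + v \<bullet> (y - x) \<le> rval f y" if y: "y \<in> edom f" for y
    proof -
      define d where "d = y - x"
      define \<theta> where "\<theta> = (\<lambda>n. inverse (real (Suc n)))"
      have \<theta>: "0 < \<theta> n" "\<theta> n \<le> 1" for n by (auto simp: \<theta>_def field_simps)
      have seg: "x + \<theta> n *\<^sub>R d \<in> edom f"
        "rval f (x + \<theta> n *\<^sub>R d) \<le> (1 - \<theta> n) * rval f x + \<theta> n * rval f y" for n
        using Gamma0_convex[OF f x y, of "\<theta> n"] \<theta>[of n] by (auto simp: d_def)
      \<comment> \<open>some piece contains points of the segment arbitrarily close to \<open>x\<close>\<close>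
      have "\<forall>n\<in>UNIV. \<exists>P\<in>PP. x + \<theta> n *\<^sub>R d \<in> P" using seg(1) dom by blast
      from pigeonhole_infinite_rel[OF infinite_UNIV_nat fin this]
      obtain P where P: "P \<in> PP" "infinite {n \<in> UNIV. x + \<theta> n *\<^sub>R d \<in> P}" ..
      obtain r :: "nat \<Rightarrow> nat" where r: "strict_mono r" "\<And>n. x + \<theta> (r n) *\<^sub>R d \<in> P"
        using infinite_enumerate[OF P(2)] by auto
      have "\<theta> \<longlonglongrightarrow> 0" unfolding \<theta>_def by (rule LIMSEQ_inverse_real_of_nat)
      then have \<theta>r: "(\<lambda>n. \<theta> (r n)) \<longlonglongrightarrow> 0" using LIMSEQ_subseq_LIMSEQ[OF _ r(1)] by (simp add: o_def)
      then have "(\<lambda>n. x + \<theta> (r n) *\<^sub>R d) \<longlonglongrightarrow> x + 0 *\<^sub>R d" by (intro tendsto_intros)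
      then have "(\<lambda>n. x + \<theta> (r n) *\<^sub>R d) \<longlonglongrightarrow> x" by simp
      with r(2) have xP: "x \<in> P"
        by (rule closed_sequentially[OF polyhedron_imp_closed[OF poly[OF P(1)]]])
      have "v \<bullet> d + \<theta> (r n) * (d \<bullet> A P d) \<le> rval f y - rval f x" for n
      proof -
        have "(x, v - g P) \<in> normal_cone_graph P" using N P(1) xP by blast
        then have "(v - g P) \<bullet> (x + \<theta> (r n) *\<^sub>R d - x) \<le> 0"
          using r(2)[of n] unfolding normal_cone_graph_def by blast
        then have "\<theta> (r n) * ((v - g P) \<bullet> d) \<le> 0" by simp
        then have 1: "v \<bullet> d \<le> g P \<bullet> d"
          using \<theta>(1)[of "r n"] by (simp add: mult_le_0_iff inner_diff_left)
        have "\<theta> (r n) * (g P \<bullet> d + \<theta> (r n) * (d \<bullet> A P d)) \<le> \<theta> (r n) * (rval f y - rval f x)"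
          using seg(2)[of "r n"] unfolding expand[OF P(1) xP r(2)] by (simp add: power2_eq_square algebra_simps)
        then have "g P \<bullet> d + \<theta> (r n) * (d \<bullet> A P d) \<le> rval f y - rval f x"
          using \<theta>(1)[of "r n"] by simp
        with 1 show ?thesis by simp
      qed
      moreover have "(\<lambda>n. v \<bullet> d + \<theta> (r n) * (d \<bullet> A P d)) \<longlonglongrightarrow> v \<bullet> d + 0 * (d \<bullet> A P d)"
        by (intro tendsto_intros \<theta>r)
      ultimately have "v \<bullet> d + 0 * (d \<bullet> A P d) \<le> rval f y - rval f x"
        by (intro LIMSEQ_le_const2) auto
      then show ?thesis by (simp add: d_def)
    qed
    then show "v \<in> subdiff f x" using x by (simp add: subdiff_iff[OF f])
  qed
qed

text \<open>The characterization above exhibits the graph as a finite Boolean combination of affine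
  preimages of polyhedra and of graphs of polyhedral normal cone maps.\<close>

lemma locally_conic_gph_subdiff:
  fixes f :: "'a::euclidean_space \<Rightarrow> ereal"
  assumes f: "f \<in> Gamma0" and plq: "piecewise_linear_quadratic f"
  shows "locally_conic (gph (subdiff f))"
proof -
  obtain PP where PP: "finite PP" "\<forall>P\<in>PP. polyhedron P" "edom f = \<Union>PP"
    "\<forall>P\<in>PP. \<exists>A b c. linear A \<and> (\<forall>x\<in>P. f x = ereal (x \<bullet> A x + b \<bullet> x + c))"
    using plq unfolding piecewise_linear_quadratic_def by blast
  then obtain A b c where Abc: "\<forall>P\<in>PP. linear (A P) \<and> (\<forall>x\<in>P. f x = ereal (x \<bullet> A P x + b P \<bullet> x + c P))"
    by metis
  define T where "T = (\<lambda>P (z::'a \<times> 'a). (fst z, snd z - (A P (fst z) + adjoint (A P) (fst z) + b P)))"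
  have "v \<in> subdiff f x \<longleftrightarrow> x \<in> edom f \<and>
    (\<forall>P\<in>PP. x \<in> P \<longrightarrow> (x, v - (A P x + adjoint (A P) x + b P)) \<in> normal_cone_graph P)" for v x
    by (rule subdiff_piecewise_quadratic_iff[OF f PP(1) _ PP(3), of A b c]) (use PP(2) Abc in auto)
  then have "gph (subdiff f) = (\<Union>P\<in>PP. fst -` P) \<inter> (\<Inter>P\<in>PP. - (fst -` P) \<union> T P -` normal_cone_graph P)"
    unfolding gph_def T_def PP(3) by auto
  moreover have "locally_conic (fst -` P :: ('a \<times> 'a) set)" if "P \<in> PP" for P
    by (rule locally_conic_affine_vimage[OF polyhedron_imp_locally_conic bounded_linear_fst])
      (use PP(2) that in auto)
  moreover have "locally_conic (T P -` normal_cone_graph P)" if P: "P \<in> PP" for P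
  proof -
    define L where "L = (\<lambda>z::'a \<times> 'a. (fst z, snd z - (A P (fst z) + adjoint (A P) (fst z))))"
    have A: "linear (A P)" "linear (adjoint (A P))" using Abc P adjoint_linear by blast+
    have "linear L"
      unfolding L_def using A
      by (intro linearI) (simp_all add: linear_add linear_scale algebra_simps)
    then have "bounded_linear L" by (simp add: linear_conv_bounded_linear)
    then show ?thesis
      using PP(2) P A
      by (intro locally_conic_affine_vimage[of _ L] locally_conic_normal_cone_graph)
        (auto simp: T_def L_def linear_add algebra_simps)
  qed
  ultimately show ?thesis
    using PP(1) by (auto intro!: locally_conic_Int locally_conic_UN locally_conic_INT locally_conic_Un locally_conic_Compl)
qed

section \<open>Maps with a smooth graph\<close>

lemma difference_quotient_tendsto:
  fixes g :: "'a::real_normed_vector \<Rightarrow> 'b::real_normed_vector"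
  assumes g: "(g has_derivative M) (at p)" and t: "pos_null t" and w: "ws \<longlonglongrightarrow> w"
  shows "(\<lambda>k. (1 / t k) *\<^sub>R (g (p + t k *\<^sub>R ws k) - g p)) \<longlonglongrightarrow> M w"
proof -
  have t0: "t k > 0" for k using t by (simp add: pos_null_def)
  have tl: "t \<longlonglongrightarrow> 0" using t by (simp add: pos_null_def)
  have M: "bounded_linear M" using g by (rule has_derivative_bounded_linear)
  have "(\<lambda>k. (1 / t k) *\<^sub>R (g (p + t k *\<^sub>R ws k) - g p) - M (ws k)) \<longlonglongrightarrow> 0"
  proof (rule tendstoI)
    fix e :: real assume e: "0 < e"
    define N where "N = norm w + 1"
    have N: "N > 0" by (simp add: N_def add_nonneg_pos)
    define e' where "e' = e / (2 * N)"
    have e': "e' > 0" using e N by (simp add: e'_def)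
    obtain d where d: "d > 0" "\<And>y. norm (y - p) < d \<Longrightarrow> norm (g y - g p - M (y - p)) \<le> e' * norm (y - p)"
      using g e' unfolding has_derivative_at_alt by blast
    have "(\<lambda>k. norm (t k *\<^sub>R ws k)) \<longlonglongrightarrow> norm (0 *\<^sub>R w)" by (intro tendsto_intros tl w)
    then have "(\<lambda>k. norm (t k *\<^sub>R ws k)) \<longlonglongrightarrow> 0" by simp
    then have "\<forall>\<^sub>F k in sequentially. norm (t k *\<^sub>R ws k) < d" using d(1) by (rule order_tendstoD)
    moreover have "(\<lambda>k. norm (ws k)) \<longlonglongrightarrow> norm w" by (intro tendsto_intros w)
    then have "\<forall>\<^sub>F k in sequentially. norm (ws k) < N" by (rule order_tendstoD) (simp add: N_def)
    ultimately show "\<forall>\<^sub>F k in sequentially. dist ((1 / t k) *\<^sub>R (g (p + t k *\<^sub>R ws k) - g p) - M (ws k)) 0 < e"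
    proof eventually_elim
      case (elim k)
      have Mt: "M (t k *\<^sub>R ws k) = t k *\<^sub>R M (ws k)" using linear_scale[OF bounded_linear.linear[OF M]] .
      have "norm (g (p + t k *\<^sub>R ws k) - g p - t k *\<^sub>R M (ws k)) \<le> e' * (t k * norm (ws k))"
        using d(2)[of "p + t k *\<^sub>R ws k"] elim t0[of k] by (simp add: Mt)
      then have "(1 / t k) * norm (g (p + t k *\<^sub>R ws k) - g p - t k *\<^sub>R M (ws k)) \<le> (1 / t k) * (e' * (t k * norm (ws k)))"
        using t0[of k] by (intro mult_left_mono) auto
      also have "\<dots> = e' * norm (ws k)" using t0[of k] by simp
      also have "\<dots> \<le> e' * N" using elim e' by (intro mult_left_mono) auto
      also have "\<dots> = e / 2" using N by (simp add: e'_def)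
      finally have "norm ((1 / t k) *\<^sub>R (g (p + t k *\<^sub>R ws k) - g p - t k *\<^sub>R M (ws k))) \<le> e / 2"
        using t0[of k] unfolding norm_scaleR by simp
      moreover have "(1 / t k) *\<^sub>R (g (p + t k *\<^sub>R ws k) - g p - t k *\<^sub>R M (ws k)) = (1 / t k) *\<^sub>R (g (p + t k *\<^sub>R ws k) - g p) - M (ws k)"
        using less_imp_neq[OF t0[of k]] by (simp add: scaleR_diff_right)
      ultimately show ?case using e by simp
    qed
  qed
  moreover have "(\<lambda>k. M (ws k)) \<longlonglongrightarrow> M w"
    by (rule bounded_linear.tendsto[OF M w])
  ultimately have "(\<lambda>k. ((1 / t k) *\<^sub>R (g (p + t k *\<^sub>R ws k) - g p) - M (ws k)) + M (ws k)) \<longlonglongrightarrow> 0 + M w"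
    by (rule tendsto_add)
  then show ?thesis by simp
qed

lemma eventually_in_open_near:
  fixes p :: "'a::real_normed_vector"
  assumes "open U" "p \<in> U" "pos_null t" "ws \<longlonglongrightarrow> w"
  shows "\<forall>\<^sub>F k in sequentially. p + t k *\<^sub>R ws k \<in> U"
proof -
  have tl: "t \<longlonglongrightarrow> 0" using assms(3) by (simp add: pos_null_def)
  have "(\<lambda>k. p + t k *\<^sub>R ws k) \<longlonglongrightarrow> p + 0 *\<^sub>R w" by (intro tendsto_intros tl assms)
  then show ?thesis by (rule topological_tendstoD) (use assms in auto)
qed

lemma tangent_cone_smooth_graph:
  fixes S :: "'a::euclidean_space \<Rightarrow> 'b::euclidean_space set"
  assumes U: "open U" "p \<in> U" and S: "\<And>x. x \<in> U \<Longrightarrow> S x = {g x}"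
    and M: "(g has_derivative M) (at p)"
  shows "tangent_cone (gph S) (p, g p) = {(w, M w) | w. True}"
proof (intro equalityI subsetI)
  fix wz assume wz: "wz \<in> tangent_cone (gph S) (p, g p)"
  obtain t us where t: "pos_null t" and us: "us \<longlonglongrightarrow> wz"
    and mem: "\<And>k. (p, g p) + t k *\<^sub>R us k \<in> gph S"
    using wz unfolding tangent_cone_def by blast
  have t0: "t k > 0" for k using t by (simp add: pos_null_def)
  have f: "(\<lambda>k. fst (us k)) \<longlonglongrightarrow> fst wz" and s: "(\<lambda>k. snd (us k)) \<longlonglongrightarrow> snd wz"
    using us by (auto intro: tendsto_fst tendsto_snd)
  have "\<forall>\<^sub>F k in sequentially. (1 / t k) *\<^sub>R (g (p + t k *\<^sub>R fst (us k)) - g p) = snd (us k)"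
    using eventually_in_open_near[OF U t f]
  proof eventually_elim
    case (elim k)
    have "g p + t k *\<^sub>R snd (us k) \<in> S (p + t k *\<^sub>R fst (us k))"
      using mem[of k] by (simp add: gph_def case_prod_beta)
    then have "g p + t k *\<^sub>R snd (us k) = g (p + t k *\<^sub>R fst (us k))" using S[OF elim] by simp
    then have "g (p + t k *\<^sub>R fst (us k)) - g p = t k *\<^sub>R snd (us k)" by (metis add_diff_cancel_left')
    then show ?case using less_imp_neq[OF t0[of k]] by simp
  qed
  with difference_quotient_tendsto[OF M t f] have "(\<lambda>k. snd (us k)) \<longlonglongrightarrow> M (fst wz)"
    by (rule Lim_transform_eventually)
  then have "snd wz = M (fst wz)" using s LIMSEQ_unique by blast
  then show "wz \<in> {(w, M w) | w. True}" by (cases wz) simp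
next
  fix wz assume "wz \<in> {(w, M w) | w. True}"
  then obtain w where w: "wz = (w, M w)" by blast
  define t0 where "t0 = (\<lambda>k. inverse (real (Suc k)))"
  have t0: "pos_null t0" using LIMSEQ_inverse_real_of_nat by (simp add: pos_null_def t0_def)
  have "\<forall>\<^sub>F k in sequentially. p + t0 k *\<^sub>R w \<in> U"
    using eventually_in_open_near[OF U t0 tendsto_const] .
  then obtain N where N: "\<And>k. k \<ge> N \<Longrightarrow> p + t0 k *\<^sub>R w \<in> U" by (auto simp: eventually_sequentially)
  define t where "t = (\<lambda>k. t0 (k + N))"
  have t: "pos_null t"
    using t0 unfolding pos_null_def t_def by (auto intro: LIMSEQ_ignore_initial_segment)
  have tp: "t k > 0" for k using t by (simp add: pos_null_def)
  define zs where "zs = (\<lambda>k. (w, (1 / t k) *\<^sub>R (g (p + t k *\<^sub>R w) - g p)))"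
  have "(\<lambda>k. (1 / t k) *\<^sub>R (g (p + t k *\<^sub>R w) - g p)) \<longlonglongrightarrow> M w"
    using difference_quotient_tendsto[OF M t tendsto_const] .
  then have "zs \<longlonglongrightarrow> wz" unfolding zs_def w by (intro tendsto_intros)
  moreover have "(p, g p) + t k *\<^sub>R zs k \<in> gph S" for k
  proof -
    have "p + t k *\<^sub>R w \<in> U" using N[of "k + N"] by (simp add: t_def)
    then show ?thesis using S less_imp_neq[OF tp[of k]] by (simp add: gph_def zs_def)
  qed
  ultimately show "wz \<in> tangent_cone (gph S) (p, g p)" using t unfolding tangent_cone_def by blast
qed

lemma proto_differentiable_at_if_smooth:
  fixes S :: "'a::euclidean_space \<Rightarrow> 'b::euclidean_space set"
  assumes U: "open U" "p \<in> U" and S: "\<And>x. x \<in> U \<Longrightarrow> S x = {g x}"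
    and M: "(g has_derivative M) (at p)"
  shows "proto_differentiable_at S (p, g p)"
proof -
  have "\<exists>ws zs. ws \<longlonglongrightarrow> w \<and> zs \<longlonglongrightarrow> z \<and> (\<forall>k. zs k \<in> (\<lambda>y. (y - g p) /\<^sub>R t k) ` S (p + t k *\<^sub>R ws k))"
    if wz: "(w, z) \<in> tangent_cone (gph S) (p, g p)" and t: "pos_null t" for w z t
  proof -
    have tc: "tangent_cone (gph S) (p, g p) = {(w, M w) | w. True}"
      by (rule tangent_cone_smooth_graph[OF U S M])
    have z: "z = M w" using wz unfolding tc by blast
    define ws where "ws = (\<lambda>k. if p + t k *\<^sub>R w \<in> U then w else 0)"
    have "\<forall>\<^sub>F k in sequentially. p + t k *\<^sub>R w \<in> U"
      using eventually_in_open_near[OF U t tendsto_const] .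
    then have "\<forall>\<^sub>F k in sequentially. ws k = w" by (rule eventually_mono) (simp add: ws_def)
    then have ws: "ws \<longlonglongrightarrow> w" by (rule tendsto_eventually)
    define zs where "zs = (\<lambda>k. (1 / t k) *\<^sub>R (g (p + t k *\<^sub>R ws k) - g p))"
    have "zs \<longlonglongrightarrow> z" unfolding zs_def z using difference_quotient_tendsto[OF M t ws] .
    moreover have "zs k \<in> (\<lambda>y. (y - g p) /\<^sub>R t k) ` S (p + t k *\<^sub>R ws k)" for k
    proof -
      have "p + t k *\<^sub>R ws k \<in> U" using U by (simp add: ws_def)
      then show ?thesis using S by (simp add: zs_def inverse_eq_divide)
    qed
    ultimately show ?thesis using ws by blast
  qed
  moreover have "(p, g p) \<in> gph S" using S U by (simp add: gph_def)
  ultimately show ?thesis unfolding proto_differentiable_at_def by auto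
qed

text \<open>A regular normal at \<open>(x, g x)\<close> annihilates the whole tangent space, the graph of \<open>M x\<close>; by
  continuity of \<open>M\<close> this persists in the limit, where the direction \<open>u\<close> is itself tangent.\<close>

lemma semismooth_star_at_if_smooth:
  fixes S :: "'a::euclidean_space \<Rightarrow> 'b::euclidean_space set"
  assumes U: "open U" "p \<in> U" and S: "\<And>x. x \<in> U \<Longrightarrow> S x = {g x}"
    and M: "\<And>x. x \<in> U \<Longrightarrow> (g has_derivative M x) (at x)"
    and cont: "\<And>xs ws w. xs \<longlonglongrightarrow> p \<Longrightarrow> ws \<longlonglongrightarrow> w \<Longrightarrow> (\<lambda>k. M (xs k) (ws k)) \<longlonglongrightarrow> M p w"
  shows "semismooth_star_at S (p, g p)"
proof -
  have "v \<bullet> u = 0" if v: "v \<in> directional_normal_cone (gph S) (p, g p) u" for u v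
  proof -
    obtain t us vs where t: "pos_null t" and us: "us \<longlonglongrightarrow> u" and vs: "vs \<longlonglongrightarrow> v"
      and reg: "\<And>k. vs k \<in> regular_normal_cone (gph S) ((p, g p) + t k *\<^sub>R us k)"
      using v unfolding directional_normal_cone_def by blast
    have t0: "t k > 0" for k using t by (simp add: pos_null_def)
    have tl: "t \<longlonglongrightarrow> 0" using t by (simp add: pos_null_def)
    have mem: "(p, g p) + t k *\<^sub>R us k \<in> gph S" for k
      using reg[of k] by (simp add: regular_normal_cone_def split: if_splits)
    have tc: "tangent_cone (gph S) (x, g x) = {(w, M x w) | w. True}" if "x \<in> U" for x
      by (rule tangent_cone_smooth_graph[OF U(1) that S M[OF that]])
    have "u \<in> tangent_cone (gph S) (p, g p)"
      unfolding tangent_cone_def using t us mem by blast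
    then have u: "u = (fst u, M p (fst u))"
      unfolding tc[OF U(2)] by auto
    define xs where "xs = (\<lambda>k. p + t k *\<^sub>R fst (us k))"
    have fus: "(\<lambda>k. fst (us k)) \<longlonglongrightarrow> fst u" using us by (rule tendsto_fst)
    have "xs \<longlonglongrightarrow> p + 0 *\<^sub>R fst u" unfolding xs_def by (intro tendsto_intros tl fus)
    then have xs: "xs \<longlonglongrightarrow> p" by simp
    have "\<forall>\<^sub>F k in sequentially. vs k \<bullet> (fst u, M (xs k) (fst u)) = 0"
      using eventually_in_open_near[OF U t fus]
    proof eventually_elim
      case (elim k)
      then have xU: "xs k \<in> U" by (simp add: xs_def)
      have "snd ((p, g p) + t k *\<^sub>R us k) \<in> S (xs k)"
        using mem[of k] by (simp add: gph_def case_prod_beta xs_def)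
      then have eq: "(p, g p) + t k *\<^sub>R us k = (xs k, g (xs k))"
        using S[OF xU] by (simp add: prod_eq_iff xs_def)
      have le: "vs k \<bullet> (w, M (xs k) w) \<le> 0" for w
        using reg[of k] unfolding eq regular_normal_cone_def tc[OF xU]
        by (auto split: if_splits)
      have "M (xs k) (- fst u) = - M (xs k) (fst u)"
        using linear_neg[OF bounded_linear.linear[OF has_derivative_bounded_linear[OF M[OF xU]]]] .
      then have "(- fst u, M (xs k) (- fst u)) = - (fst u, M (xs k) (fst u))" by simp
      with le[of "fst u"] le[of "- fst u"] show ?case by (metis inner_minus_right neg_le_0_iff_le order_antisym)
    qed
    then have "(\<lambda>k. vs k \<bullet> (fst u, M (xs k) (fst u))) \<longlonglongrightarrow> 0" by (rule tendsto_eventually)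
    moreover have "(\<lambda>k. vs k \<bullet> (fst u, M (xs k) (fst u))) \<longlonglongrightarrow> v \<bullet> (fst u, M p (fst u))"
      by (intro tendsto_intros vs cont[OF xs tendsto_const])
    ultimately have "v \<bullet> (fst u, M p (fst u)) = 0" by (rule LIMSEQ_unique[symmetric])
    then show ?thesis using u by simp
  qed
  moreover have "(p, g p) \<in> gph S" using S U by (simp add: gph_def)
  ultimately show ?thesis unfolding semismooth_star_at_def by blast
qed


section \<open>Twice continuously differentiable functions\<close>

lemma subdiff_at_differentiable_point:
  fixes f :: "'a::euclidean_space \<Rightarrow> ereal"
  assumes f: "f \<in> Gamma0" and y: "y \<in> edom f"
    and nbhd: "\<forall>\<^sub>F z in nhds y. z \<in> edom f"
    and D: "(rval f has_derivative (\<lambda>\<xi>. g \<bullet> \<xi>)) (at y)"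
  shows "subdiff f y = {g}"
proof -
  have quot: "(\<lambda>k. (1 / t k) * (rval f (y + t k *\<^sub>R w) - rval f y)) \<longlonglongrightarrow> g \<bullet> w" if "pos_null t" for t w
    using difference_quotient_tendsto[OF D that tendsto_const[of w]] by simp
  define t where "t = (\<lambda>k. inverse (real (Suc k)))"
  have t: "pos_null t" using LIMSEQ_inverse_real_of_nat by (simp add: pos_null_def t_def)
  have t0: "0 < t k" "t k \<le> 1" for k by (auto simp: t_def field_simps)
  have "v = g" if v: "v \<in> subdiff f y" for v
  proof -
    have le: "v \<bullet> w \<le> g \<bullet> w" for w
    proof -
      have "(\<lambda>k. y + t k *\<^sub>R w) \<longlonglongrightarrow> y + 0 *\<^sub>R w"
        using t by (intro tendsto_intros) (simp add: pos_null_def)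
      then have "filterlim (\<lambda>k. y + t k *\<^sub>R w) (nhds y) sequentially" by simp
      then have "\<forall>\<^sub>F k in sequentially. y + t k *\<^sub>R w \<in> edom f"
        using nbhd by (rule eventually_compose_filterlim[rotated])
      then have "\<forall>\<^sub>F k in sequentially. v \<bullet> w \<le> (1 / t k) * (rval f (y + t k *\<^sub>R w) - rval f y)"
      proof eventually_elim
        case (elim k)
        then have "rval f y + v \<bullet> (y + t k *\<^sub>R w - y) \<le> rval f (y + t k *\<^sub>R w)"
          using v unfolding subdiff_iff[OF f] by blast
        then show ?case using t0(1)[of k] by (simp add: field_simps)
      qed
      then show ?thesis
        using tendsto_lowerbound[OF quot[OF t]] by simp
    qed
    have "(v - g) \<bullet> (v - g) \<le> 0" using le[of "v - g"] by (simp add: inner_diff_left)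
    then show ?thesis by (metis inner_ge_zero inner_eq_zero_iff order_antisym right_minus_eq)
  qed
  moreover have "g \<in> subdiff f y"
    unfolding subdiff_iff[OF f]
  proof (intro conjI ballI)
    fix z assume z: "z \<in> edom f"
    have "(1 / t k) * (rval f (y + t k *\<^sub>R (z - y)) - rval f y) \<le> rval f z - rval f y" for k
    proof -
      have "rval f (y + t k *\<^sub>R (z - y)) \<le> (1 - t k) * rval f y + t k * rval f z"
        using Gamma0_convex(2)[OF f y z, of "t k"] t0[of k] by simp
      then show ?thesis using t0(1)[of k] by (simp add: field_simps)
    qed
    then have "g \<bullet> (z - y) \<le> rval f z - rval f y"
      by (intro LIMSEQ_le_const2[OF quot[OF t]]) auto
    then show "rval f y + g \<bullet> (z - y) \<le> rval f z" by simp
  qed (fact y)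
  ultimately show ?thesis by blast
qed

lemma gradient_derivative_nonneg:
  fixes f :: "'a::euclidean_space \<Rightarrow> ereal"
  assumes f: "f \<in> Gamma0" and U: "open U" "y \<in> U" and S: "\<And>x. x \<in> U \<Longrightarrow> g x \<in> subdiff f x"
    and M: "(g has_derivative M) (at y)"
  shows "0 \<le> \<xi> \<bullet> M \<xi>"
proof -
  define t where "t = (\<lambda>k. inverse (real (Suc k)))"
  have t: "pos_null t" using LIMSEQ_inverse_real_of_nat by (simp add: pos_null_def t_def)
  have t0: "0 < t k" for k by (simp add: t_def)
  have "(\<lambda>k. \<xi> \<bullet> ((1 / t k) *\<^sub>R (g (y + t k *\<^sub>R \<xi>) - g y))) \<longlonglongrightarrow> \<xi> \<bullet> M \<xi>"
    by (intro tendsto_intros difference_quotient_tendsto[OF M t])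
  moreover have "\<forall>\<^sub>F k in sequentially. 0 \<le> \<xi> \<bullet> ((1 / t k) *\<^sub>R (g (y + t k *\<^sub>R \<xi>) - g y))"
    using eventually_in_open_near[OF U t tendsto_const[of \<xi>]]
  proof eventually_elim
    case (elim k)
    have "0 \<le> (g (y + t k *\<^sub>R \<xi>) - g y) \<bullet> (y + t k *\<^sub>R \<xi> - y)"
      by (intro subdiff_monotone[OF f] S elim U)
    then show ?case using t0[of k] by (simp add: zero_le_mult_iff inner_commute)
  qed
  ultimately show ?thesis by (rule tendsto_lowerbound) simp
qed

lemma norm_le_norm_add_monotone:
  fixes \<xi> :: "'a::real_inner"
  assumes "0 \<le> \<xi> \<bullet> M \<xi>" "0 \<le> l"
  shows "norm \<xi> \<le> norm (\<xi> + l *\<^sub>R M \<xi>)"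
proof (rule norm_le_of_inner_le)
  have "\<xi> \<bullet> \<xi> \<le> (\<xi> + l *\<^sub>R M \<xi>) \<bullet> \<xi>"
    using assms by (simp add: inner_add_left inner_commute[of "M \<xi>"])
  also have "\<dots> \<le> norm (\<xi> + l *\<^sub>R M \<xi>) * norm \<xi>" by (rule norm_cauchy_schwarz)
  finally show "\<xi> \<bullet> \<xi> \<le> norm (\<xi> + l *\<^sub>R M \<xi>) * norm \<xi>" .
qed simp

text \<open>On the smooth part the slope is \<open>g (prox l f x)\<close>, so \<open>p = prox l f x\<close> solves \<open>p + l g p =
  x\<close>. The operator \<open>T l = id + l M p\<close> is invertible with inverse of norm at most one, since \<open>M p\<close>
  is positive semidefinite. Hence \<open>l \<mapsto> p\<close> has the derivative \<open>u l\<close> given by \<open>T l (u l) = - g p\<close>,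
  and \<open>u\<close> depends continuously on \<open>l\<close>.\<close>

lemma eta_C1_around:
  fixes f :: "'a::euclidean_space \<Rightarrow> ereal"
  assumes f: "f \<in> Gamma0" and lb: "0 < lbar" and U: "open U" "prox lbar f x \<in> U"
    and S: "\<And>y. y \<in> U \<Longrightarrow> subdiff f y = {g y}"
    and grad: "\<And>y. y \<in> U \<Longrightarrow> (rval f has_derivative (\<lambda>\<xi>. g y \<bullet> \<xi>)) (at y)"
    and M: "\<And>y. y \<in> U \<Longrightarrow> (g has_derivative M y) (at y)"
    and cont: "\<And>y xs w. y \<in> U \<Longrightarrow> xs \<longlonglongrightarrow> y \<Longrightarrow> (\<lambda>k. M (xs k) w) \<longlonglongrightarrow> M y w"
  shows "C1_around (finite_dom (eta f x)) (\<lambda>l. real_of_ereal (eta f x l)) lbar"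
proof -
  define P where "P = (\<lambda>m. prox m f x)"
  define V where "V = (\<lambda>m. prox_slope m f x)"
  obtain B where B: "0 < B"
    and VB: "\<And>l m. \<bar>l - lbar\<bar> < lbar / 2 \<Longrightarrow> \<bar>m - lbar\<bar> < lbar / 2 \<Longrightarrow>
       norm (V m - V l) \<le> B * \<bar>m - l\<bar>"
    and PB: "\<And>l m. \<bar>l - lbar\<bar> < lbar / 2 \<Longrightarrow> \<bar>m - lbar\<bar> < lbar / 2 \<Longrightarrow>
       norm (P m - P l) \<le> B * \<bar>m - l\<bar>"
    unfolding P_def V_def using prox_curve_bounds[OF f lb, of x] by metis
  obtain d0 where d0: "d0 > 0" "ball (P lbar) d0 \<subseteq> U"
    using U by (auto simp: P_def open_contains_ball)
  define r where "r = min (lbar / 2) (d0 / B)"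
  have r: "r > 0" using lb d0 B by (simp add: r_def)
  define I where "I = ball lbar r"
  have inI: "\<bar>l - lbar\<bar> < lbar / 2" "l > 0" "P l \<in> U" if "l \<in> I" for l
  proof -
    have l: "\<bar>l - lbar\<bar> < r" using that by (simp add: I_def dist_real_def abs_minus_commute)
    show *: "\<bar>l - lbar\<bar> < lbar / 2" using l by (simp add: r_def)
    show "l > 0" using * lb by linarith
    have "norm (P l - P lbar) \<le> B * \<bar>l - lbar\<bar>" by (rule PB) (use * lb in auto)
    also have "\<dots> < B * (d0 / B)" using l B by (intro mult_strict_left_mono) (auto simp: r_def)
    also have "\<dots> = d0" using B by simp
    finally show "P l \<in> U" using d0(2) by (auto simp: dist_norm norm_minus_commute)
  qed
  have Vg: "V l = g (P l)" if "l \<in> I" for l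
    using prox_slope_subdiff[OF f inI(2)[OF that], of x] S[OF inI(3)[OF that]] by (simp add: V_def P_def)
  have lin: "linear (M y)" if "y \<in> U" for y
    using bounded_linear.linear[OF has_derivative_bounded_linear[OF M[OF that]]] .
  have psd: "0 \<le> \<xi> \<bullet> M y \<xi>" if "y \<in> U" for y \<xi>
    by (rule gradient_derivative_nonneg[OF f U(1) that _ M[OF that]]) (use S in auto)
  define T where "T = (\<lambda>l \<xi>. \<xi> + l *\<^sub>R M (P l) \<xi>)"
  have Tlin: "linear (T l)" if "l \<in> I" for l
    unfolding T_def using lin[OF inI(3)[OF that]]
    by (intro linearI) (simp_all add: linear_add linear_scale algebra_simps)
  have Tnorm: "norm \<xi> \<le> norm (T l \<xi>)" if "l \<in> I" for l \<xi>
    unfolding T_def using psd inI[OF that] by (intro norm_le_norm_add_monotone) auto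
  have "\<exists>u. T l u = - V l" if "l \<in> I" for l
  proof -
    have "inj (T l)"
      unfolding linear_injective_0[OF Tlin[OF that]] using Tnorm[OF that] by (metis norm_le_zero_iff norm_zero)
    then have "surj (T l)" using linear_injective_imp_surjective[OF Tlin[OF that]] by blast
    then show ?thesis by (metis surj_def)
  qed
  then obtain u where u: "\<And>l. l \<in> I \<Longrightarrow> T l (u l) = - V l" by metis
  have derP: "(P has_derivative (\<lambda>s. s *\<^sub>R u l)) (at l)" if l: "l \<in> I" for l
    unfolding has_derivative_at_alt
  proof (intro conjI allI impI)
    show "bounded_linear (\<lambda>s. s *\<^sub>R u l)" by (rule bounded_linear_scaleR_left)
    fix e :: real assume e: "0 < e"
    have l0: "l > 0" by (rule inI(2)[OF l])
    define \<epsilon> where "\<epsilon> = e / (2 * l * B)"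
    have \<epsilon>: "\<epsilon> > 0" using e l0 B by (simp add: \<epsilon>_def)
    obtain d where d: "d > 0" "\<And>y. norm (y - P l) < d \<Longrightarrow> norm (g y - g (P l) - M (P l) (y - P l)) \<le> \<epsilon> * norm (y - P l)"
      using M[OF inI(3)[OF l]] \<epsilon> unfolding has_derivative_at_alt by blast
    obtain d1 where d1: "d1 > 0" "ball l d1 \<subseteq> I"
      using l unfolding I_def using open_ball open_contains_ball by blast
    define \<delta> where "\<delta> = min d1 (min (d / B) (e / (2 * B)))"
    have "norm (P m - P l - (m - l) *\<^sub>R u l) \<le> e * norm (m - l)" if m: "norm (m - l) < \<delta>" for m
    proof -
      have mI: "m \<in> I" using m d1(2) by (auto simp: \<delta>_def dist_real_def abs_minus_commute)
      have PmB: "norm (P m - P l) \<le> B * \<bar>m - l\<bar>" by (rule PB[OF inI(1)[OF l] inI(1)[OF mI]])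
      have VmB: "norm (V m - V l) \<le> B * \<bar>m - l\<bar>" by (rule VB[OF inI(1)[OF l] inI(1)[OF mI]])
      have "B * \<bar>m - l\<bar> < B * (d / B)" using m B by (intro mult_strict_left_mono) (auto simp: \<delta>_def)
      then have "norm (P m - P l) < d" using PmB B by simp
      from d(2)[OF this] have R: "norm (V m - V l - M (P l) (P m - P l)) \<le> \<epsilon> * norm (P m - P l)"
        by (simp add: Vg l mI)
      have "P m = x - m *\<^sub>R V m" "P l = x - l *\<^sub>R V l"
        using prox_add_slope[OF inI(2)[OF mI], of f x] prox_add_slope[OF inI(2)[OF l], of f x]
        unfolding P_def V_def by (metis add_diff_cancel_right')+
      then have *: "P m - P l = - l *\<^sub>R (V m - V l) - (m - l) *\<^sub>R V m" by (simp add: algebra_simps)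
      have "T l (P m - P l - (m - l) *\<^sub>R u l) = T l (P m - P l) - (m - l) *\<^sub>R (- V l)"
        using Tlin[OF l] u[OF l] by (simp add: linear_diff linear_scale)
      also have "\<dots> = (P m - P l) + l *\<^sub>R M (P l) (P m - P l) + (m - l) *\<^sub>R V l" by (simp add: T_def)
      also have "\<dots> = - l *\<^sub>R (V m - V l) - (m - l) *\<^sub>R V m + l *\<^sub>R M (P l) (P m - P l) + (m - l) *\<^sub>R V l"
        by (subst (1) *) simp
      also have "\<dots> = - l *\<^sub>R (V m - V l - M (P l) (P m - P l)) - (m - l) *\<^sub>R (V m - V l)"
        by (simp add: algebra_simps)
      finally have "norm (T l (P m - P l - (m - l) *\<^sub>R u l)) \<le>
          norm (- l *\<^sub>R (V m - V l - M (P l) (P m - P l))) + norm ((m - l) *\<^sub>R (V m - V l))"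
        by (metis norm_triangle_ineq4)
      also have "\<dots> = l * norm (V m - V l - M (P l) (P m - P l)) + \<bar>m - l\<bar> * norm (V m - V l)"
        unfolding norm_scaleR using l0 by simp
      also have "\<dots> \<le> l * (\<epsilon> * (B * \<bar>m - l\<bar>)) + \<bar>m - l\<bar> * (B * (e / (2 * B)))"
      proof (intro add_mono mult_left_mono)
        show "norm (V m - V l - M (P l) (P m - P l)) \<le> \<epsilon> * (B * \<bar>m - l\<bar>)"
          by (rule order_trans[OF R mult_left_mono[OF PmB]]) (use \<epsilon> in simp)
        have "B * \<bar>m - l\<bar> \<le> B * (e / (2 * B))" using m B by (intro mult_left_mono) (auto simp: \<delta>_def)
        then show "norm (V m - V l) \<le> B * (e / (2 * B))" using VmB by simp
      qed (use l0 in auto)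
      also have "\<dots> = e * norm (m - l)" using l0 B by (simp add: \<epsilon>_def field_simps)
      finally show ?thesis using Tnorm[OF l, of "P m - P l - (m - l) *\<^sub>R u l"] by simp
    qed
    moreover have "\<delta> > 0" using d(1) d1(1) B e by (simp add: \<delta>_def)
    ultimately show "\<exists>d>0. \<forall>m. norm (m - l) < d \<longrightarrow> norm (P m - P l - (m - l) *\<^sub>R u l) \<le> e * norm (m - l)"
      by blast
  qed
  have derh: "((\<lambda>l. real_of_ereal (eta f x l)) has_vector_derivative (V l \<bullet> u l)) (at l)" if l: "l \<in> I" for l
  proof -
    have "(rval f \<circ> P has_derivative (\<lambda>\<xi>. g (P l) \<bullet> \<xi>) \<circ> (\<lambda>s. s *\<^sub>R u l)) (at l)"
      by (rule diff_chain_at[OF derP[OF l] grad[OF inI(3)[OF l]]])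
    then have "((\<lambda>m. rval f (prox m f x)) has_derivative (\<lambda>s. (V l \<bullet> u l) * s)) (at l)"
      by (simp add: o_def P_def Vg[OF l, unfolded P_def] mult.commute)
    then have "((\<lambda>m. rval f (prox m f x)) has_real_derivative (V l \<bullet> u l)) (at l)"
      by (simp add: has_field_derivative_def)
    then have "((\<lambda>l. real_of_ereal (eta f x l)) has_real_derivative (V l \<bullet> u l)) (at l)"
      by (simp add: eta_has_derivative_iff[OF inI(2)[OF l]])
    then show ?thesis by (rule has_real_derivative_iff_has_vector_derivative[THEN iffD1])
  qed
  have contD: "continuous_on I (\<lambda>l. V l \<bullet> u l)"
    unfolding continuous_on_sequentially
  proof (intro allI ballI impI; elim conjE)
    fix ls l assume l: "l \<in> I" and ls: "\<forall>n. ls n \<in> I" "ls \<longlonglongrightarrow> l"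
    have d0: "(\<lambda>n. B * \<bar>ls n - l\<bar>) \<longlonglongrightarrow> 0"
    proof -
      have "(\<lambda>n. B * \<bar>ls n - l\<bar>) \<longlonglongrightarrow> B * \<bar>l - l\<bar>" by (intro tendsto_intros ls)
      then show ?thesis by simp
    qed
    have "(\<lambda>n. V (ls n) - V l) \<longlonglongrightarrow> 0"
      by (rule Lim_null_comparison[OF _ d0]) (use VB inI(1) l ls(1) in simp)
    then have Vl: "(\<lambda>n. V (ls n)) \<longlonglongrightarrow> V l" by (simp add: LIM_zero_iff)
    have "(\<lambda>n. P (ls n) - P l) \<longlonglongrightarrow> 0"
      by (rule Lim_null_comparison[OF _ d0]) (use PB inI(1) l ls(1) in simp)
    then have Pl: "(\<lambda>n. P (ls n)) \<longlonglongrightarrow> P l" by (simp add: LIM_zero_iff)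
    have "(\<lambda>n. - V (ls n) - T (ls n) (u l)) \<longlonglongrightarrow> - V l - T l (u l)"
      unfolding T_def by (intro tendsto_intros Vl ls cont[OF inI(3)[OF l] Pl])
    then have "(\<lambda>n. - V (ls n) - T (ls n) (u l)) \<longlonglongrightarrow> 0" by (simp add: u[OF l])
    then have lim0: "(\<lambda>n. norm (- V (ls n) - T (ls n) (u l))) \<longlonglongrightarrow> 0" by (rule tendsto_norm_zero)
    have bd: "norm (u (ls n) - u l) \<le> norm (- V (ls n) - T (ls n) (u l))" for n
    proof -
      have lsn: "ls n \<in> I" using ls(1) by blast
      have "T (ls n) (u (ls n) - u l) = - V (ls n) - T (ls n) (u l)"
        by (simp only: linear_diff[OF Tlin[OF lsn]] u[OF lsn])
      then show ?thesis using Tnorm[OF lsn, of "u (ls n) - u l"] by (simp only:)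
    qed
    have "(\<lambda>n. u (ls n) - u l) \<longlonglongrightarrow> 0"
      by (rule Lim_null_comparison[OF always_eventually lim0]) (intro allI bd)
    then have "(\<lambda>n. u (ls n)) \<longlonglongrightarrow> u l" by (simp add: LIM_zero_iff)
    then show "((\<lambda>l. V l \<bullet> u l) \<circ> ls) \<longlonglongrightarrow> V l \<bullet> u l"
      unfolding o_def by (intro tendsto_intros Vl)
  qed
  have "(\<lambda>l. real_of_ereal (eta f x l)) C1_differentiable_on I"
    unfolding C1_differentiable_on_def
    by (intro exI[of _ "\<lambda>l. V l \<bullet> u l"] conjI ballI derh contD)
  moreover have "I \<subseteq> finite_dom (eta f x)" using inI(2) eta_finite_dom[OF f] by blast
  moreover have "open I" "lbar \<in> I" using r by (auto simp: I_def)
  ultimately show ?thesis unfolding C1_around_def by blast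
qed

text \<open>The two derivatives of a twice continuously differentiable function, transported from linear
  functionals to vectors by means of the orthonormal basis.\<close>

lemma C2_around_gradient:
  fixes F :: "'a::euclidean_space \<Rightarrow> real"
  assumes "C2_around D F p"
  obtains U g M where "open U" "p \<in> U" "U \<subseteq> D"
    "\<forall>y\<in>U. (F has_derivative (\<lambda>\<xi>. g y \<bullet> \<xi>)) (at y)"
    "\<forall>y\<in>U. (g has_derivative M y) (at y)"
    "\<forall>y\<in>U. \<forall>xs ws w. xs \<longlonglongrightarrow> y \<longrightarrow> ws \<longlonglongrightarrow> w \<longrightarrow> (\<lambda>k. M (xs k) (ws k)) \<longlonglongrightarrow> M y w"
proof -
  obtain U and F' :: "'a \<Rightarrow> 'a \<Rightarrow>\<^sub>L real" and F'' :: "'a \<Rightarrow> 'a \<Rightarrow>\<^sub>L 'a \<Rightarrow>\<^sub>L real"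
    where U: "open U" "p \<in> U" "U \<subseteq> D"
      and F': "\<forall>y\<in>U. (F has_derivative blinfun_apply (F' y)) (at y)"
      and F'': "\<forall>y\<in>U. (F' has_derivative blinfun_apply (F'' y)) (at y)"
      and cont: "continuous_on U F''"
    using assms unfolding C2_around_def by blast
  define g where "g = (\<lambda>y. \<Sum>b\<in>Basis. blinfun_apply (F' y) b *\<^sub>R b)"
  define M where "M = (\<lambda>y \<xi>. \<Sum>b\<in>Basis. blinfun_apply (blinfun_apply (F'' y) \<xi>) b *\<^sub>R b)"
  have g_inner: "g y \<bullet> \<xi> = blinfun_apply (F' y) \<xi>" for y \<xi>
  proof -
    have "blinfun_apply (F' y) \<xi> = blinfun_apply (F' y) (\<Sum>b\<in>Basis. (\<xi> \<bullet> b) *\<^sub>R b)"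
      by (simp add: euclidean_representation)
    also have "\<dots> = (\<Sum>b\<in>Basis. (\<xi> \<bullet> b) * blinfun_apply (F' y) b)"
      by (simp add: blinfun.sum_right blinfun.scaleR_right)
    finally show ?thesis by (simp add: g_def inner_sum_left mult.commute inner_commute[of \<xi>])
  qed
  show ?thesis
  proof (rule that[OF U, of g M])
    show "\<forall>y\<in>U. (F has_derivative (\<lambda>\<xi>. g y \<bullet> \<xi>)) (at y)"
      using F' by (simp add: g_inner)
    show "\<forall>y\<in>U. (g has_derivative M y) (at y)"
    proof
      fix y assume y: "y \<in> U"
      have "((\<lambda>y. blinfun_apply (F' y) b) has_derivative (\<lambda>\<xi>. blinfun_apply (blinfun_apply (F'' y) \<xi>) b)) (at y)" for b
        using bounded_linear.has_derivative[OF blinfun.bounded_linear_left bspec[OF F'' y]] .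
      then show "(g has_derivative M y) (at y)"
        unfolding g_def M_def by (intro has_derivative_sum has_derivative_scaleR_left)
    qed
    show "\<forall>y\<in>U. \<forall>xs ws w. xs \<longlonglongrightarrow> y \<longrightarrow> ws \<longlonglongrightarrow> w \<longrightarrow> (\<lambda>k. M (xs k) (ws k)) \<longlonglongrightarrow> M y w"
    proof (intro ballI allI impI)
      fix y w :: 'a and xs ws :: "nat \<Rightarrow> 'a" assume y: "y \<in> U" and xs: "xs \<longlonglongrightarrow> y" and ws: "ws \<longlonglongrightarrow> w"
      have "isCont F'' y" using cont U(1) y by (simp add: continuous_on_eq_continuous_at)
      then have "(\<lambda>k. F'' (xs k)) \<longlonglongrightarrow> F'' y" using xs by (rule isCont_tendsto_compose)
      then show "(\<lambda>k. M (xs k) (ws k)) \<longlonglongrightarrow> M y w"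
        unfolding M_def by (intro tendsto_intros ws)
    qed
  qed
qed

section \<open>Semismoothness of the value along the proximal curve\<close>

theorem proposition7:
  fixes f :: "'a::euclidean_space \<Rightarrow> ereal" and xbar :: 'a and lbar :: real
  assumes "f \<in> Gamma0" and "0 < lbar"
  defines "p \<equiv> prox lbar f xbar"
  defines "a \<equiv> (p, (1 / lbar) *\<^sub>R (xbar - p))"
  defines "H \<equiv> finite_dom (eta f xbar)"
  defines "h \<equiv> (\<lambda>l. real_of_ereal (eta f xbar l))"
  shows
    "(proto_differentiable_at (subdiff f) a \<and> semismooth_star_at (subdiff f) a \<longrightarrow>
        semismooth_at H h lbar) \<and>
     (piecewise_linear_quadratic f \<longrightarrow>
        proto_differentiable_at (subdiff f) a \<and> semismooth_star_at (subdiff f) a \<and>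
        semismooth_at H h lbar) \<and>
     (C2_around (finite_dom f) (\<lambda>u. real_of_ereal (f u)) p \<longrightarrow>
        proto_differentiable_at (subdiff f) a \<and> semismooth_star_at (subdiff f) a \<and>
        semismooth_at H h lbar \<and> C1_around H h lbar)"
proof -
  note f = assms(1) and lb = assms(2)
  have a: "a = (prox lbar f xbar, prox_slope lbar f xbar)"
    by (simp add: a_def p_def prox_slope_def)
  have a_gph: "a \<in> gph (subdiff f)"
    using prox_slope_subdiff[OF f lb] by (simp add: a gph_def)
  have main: "semismooth_at H h lbar"
    if "proto_differentiable_at (subdiff f) a" "semismooth_star_at (subdiff f) a"
    using eta_semismooth_at[OF f lb] that unfolding a H_def h_def by blast
  have plq: "proto_differentiable_at (subdiff f) a \<and> semismooth_star_at (subdiff f) a"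
    if "piecewise_linear_quadratic f"
    using locally_conic_gph_subdiff[OF f that] a_gph
    by (simp add: proto_differentiable_at_if_locally_conic semismooth_star_at_if_locally_conic)
  have smooth: "proto_differentiable_at (subdiff f) a \<and> semismooth_star_at (subdiff f) a \<and> C1_around H h lbar"
    if C2: "C2_around (finite_dom f) (\<lambda>u. real_of_ereal (f u)) p"
  proof -
    obtain U g M where U: "open U" "p \<in> U" "U \<subseteq> finite_dom f"
      and grad: "\<forall>y\<in>U. (rval f has_derivative (\<lambda>\<xi>. g y \<bullet> \<xi>)) (at y)"
      and M: "\<forall>y\<in>U. (g has_derivative M y) (at y)"
      and cont: "\<forall>y\<in>U. \<forall>xs ws w. xs \<longlonglongrightarrow> y \<longrightarrow> ws \<longlonglongrightarrow> w \<longrightarrow> (\<lambda>k. M (xs k) (ws k)) \<longlonglongrightarrow> M y w"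
      by (rule C2_around_gradient[OF C2])
    have Ue: "U \<subseteq> edom f" using U(3) by (auto simp: finite_dom_def edom_def less_top[symmetric] top_ereal_def)
    have S: "subdiff f y = {g y}" if y: "y \<in> U" for y
    proof (rule subdiff_at_differentiable_point[OF f])
      show "y \<in> edom f" using Ue y by blast
      show "\<forall>\<^sub>F z in nhds y. z \<in> edom f"
        using eventually_nhds_in_open[OF U(1) y] Ue by (auto elim!: eventually_mono)
    qed (use grad y in blast)
    have a': "a = (p, g p)"
      using prox_slope_subdiff[OF f lb, of xbar] S[OF U(2)] by (simp add: a p_def)
    have "proto_differentiable_at (subdiff f) (p, g p)"
      by (rule proto_differentiable_at_if_smooth[where M = "M p", OF U(1,2)]) (use S M U(2) in auto)
    moreover have "semismooth_star_at (subdiff f) (p, g p)"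
      by (rule semismooth_star_at_if_smooth[where M = M, OF U(1,2)]) (use S M cont U(2) in auto)
    moreover have "C1_around H h lbar"
      unfolding H_def h_def
      by (rule eta_C1_around[where g = g and M = M, OF f lb U(1)]) (use U(2) S grad M cont in \<open>auto simp: p_def\<close>)
    ultimately show ?thesis by (simp add: a')
  qed
  show ?thesis using main plq smooth by blast
qed

end
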